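(* There exist $\eta\in(0,1)$ and $M>1$, only depending on $n$, such that the following result holds true. Let $r\in(0,1)$, and let $g:\mathbb{R}^n\to\mathbb{R}$ be $\mathbb{Z}^n$-periodic, with zero average in $[0,1]^n$ and such that $\|g\|_{L^\infty(\mathbb{R}^n)}\le\eta$. Let $\omega\in S^{n-1}$. Then there exists $E^*_\omega$ which is a Class A minimizer for $\mathcal{F}_{r,g}$, such that $$\{\omega\cdot x\le-M\}\subseteq E^*_\omega\subseteq\{\omega\cdot x\le M\}.$$ Moreover, if $\omega$ is rational, then $E^*_\omega$ is $\omega$-periodic.
   Context: $B_\rho(x)$ is the ball of radius $\rho$ centered at $x$ in $\mathbb{R}^n$, and $\mathcal{L}^n$ is the $n$-dimensional Lebesgue measure. For $A\subseteq\mathbb{R}^n$, $A\oplus B_r:=\bigcup_{x\in A}B_r(x)$ and $A\ominus B_r:=A\setminus\big((\partial A)\oplus B_r\big)$. Measurable sets are identified with their sets of points of density one (so equalities and inclusions of sets are up to null sets), and $\partial E$ denotes the topological boundary of the set of points of density one of $E$. For a domain $\Omega$ and measurable $E\subseteq\mathbb{R}^n$, $$\mathrm{Per}_r(E,\Omega):=\frac{1}{2r}\mathcal{L}^n\Big(\big((\partial E)\oplus B_r\big)\cap\Omega\Big),\qquad \mathcal{F}_{r,g}(E,\Omega):=\mathrm{Per}_r(E,\Omega)+\int_{E\cap\Omega}g(x)\,dx .$$ A set $E$ is a minimizer for $\mathcal{F}_{r,g}$ in a bounded domain $\Omega$ if $\mathcal{F}_{r,g}(E,\Omega)\le\mathcal{F}_{r,g}(F,\Omega)$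 for any measurable $F\subseteq\mathbb{R}^n$ with $F\setminus(\Omega\ominus B_r)=E\setminus(\Omega\ominus B_r)$; $E$ is a Class A minimizer if it is a minimizer in this sense in any ball of $\mathbb{R}^n$. A direction $\omega\in S^{n-1}$ is rational if there exist linearly independent $K_1,\dots,K_{n-1}\in\mathbb{Z}^n$ such that $\omega\cdot K_j=0$ for any $j\in\{1,\dots,n-1\}$. For a rational direction $\omega$, a set $E$ is $\omega$-periodic if $E+k=E$ for any $k\in\mathbb{Z}^n$ with $\omega\cdot k=0$. A function $g$ is $\mathbb{Z}^n$-periodic if $g(x+k)=g(x)$ for all $x\in\mathbb{R}^n$ and $k\in\mathbb{Z}^n$. *)

theory Defs
  imports "HOL-Analysis.Analysis" "HOL-Probability.Essential_Supremum"
begin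

text \<open>
  Measurable means Lebesgue measurable, and measurable sets are identified when they agree up to a
  null set; inclusions and equalities of measurable sets are therefore stated with the following
  two relations.
\<close>

definition ae_subset :: "(real^'n) set \<Rightarrow> (real^'n) set \<Rightarrow> bool" where
  "ae_subset A B \<longleftrightarrow> A - B \<in> null_sets lebesgue"

definition ae_equal :: "(real^'n) set \<Rightarrow> (real^'n) set \<Rightarrow> bool" where
  "ae_equal A B \<longleftrightarrow> ae_subset A B \<and> ae_subset B A"

definition density_one :: "(real^'n) set \<Rightarrow> (real^'n) set" where
  "density_one E =
    {x. ((\<lambda>\<rho>. measure lebesgue (E \<inter> ball x \<rho>) / measure lebesgue (ball x \<rho>)) \<longlongrightarrow> 1) (at_right 0)}"

text \<open>Boundary of a measurable set modulo null sets.\<close>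

definition ess_boundary :: "(real^'n) set \<Rightarrow> (real^'n) set" where
  "ess_boundary E = frontier (density_one E)"

definition dilate :: "(real^'n) set \<Rightarrow> real \<Rightarrow> (real^'n) set" where
  "dilate A r = (\<Union>x\<in>A. ball x r)"

text \<open>
  Below, erosion is applied only to open balls, which coincide with their sets of points of
  density one, so the ordinary topological boundary is used here.
\<close>

definition erode :: "(real^'n) set \<Rightarrow> real \<Rightarrow> (real^'n) set" where
  "erode A r = A - dilate (frontier A) r"

text \<open>
  The next two functionals are real-valued and are meant for bounded \<open>\<Omega>\<close>, where the measure of the
  tube around the boundary is finite.
\<close>

definition Per :: "real \<Rightarrow> (real^'n) set \<Rightarrow> (real^'n) set \<Rightarrow> real" where
  "Per r E \<Omega> = 1 / (2 * r) * measure lebesgue (dilate (ess_boundary E) r \<inter> \<Omega>)"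

definition energy :: "real \<Rightarrow> (real^'n \<Rightarrow> real) \<Rightarrow> (real^'n) set \<Rightarrow> (real^'n) set \<Rightarrow> real" where
  "energy r g E \<Omega> = Per r E \<Omega> + set_lebesgue_integral lebesgue (E \<inter> \<Omega>) g"

definition minimizer_in :: "real \<Rightarrow> (real^'n \<Rightarrow> real) \<Rightarrow> (real^'n) set \<Rightarrow> (real^'n) set \<Rightarrow> bool" where
  "minimizer_in r g \<Omega> E \<longleftrightarrow>
     E \<in> sets lebesgue \<and>
     (\<forall>F \<in> sets lebesgue. ae_equal (F - erode \<Omega> r) (E - erode \<Omega> r)
        \<longrightarrow> energy r g E \<Omega> \<le> energy r g F \<Omega>)"

definition class_A_minimizer :: "real \<Rightarrow> (real^'n \<Rightarrow> real) \<Rightarrow> (real^'n) set \<Rightarrow> bool" where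
  "class_A_minimizer r g E \<longleftrightarrow> (\<forall>x R. 0 < R \<longrightarrow> minimizer_in r g (ball x R) E)"

definition int_vecs :: "(real^'n) set" where
  "int_vecs = {k. \<forall>i. k $ i \<in> \<int>}"

text \<open>
  Linear independence of the family \<open>K 1, \<dots>, K (n - 1)\<close> is injectivity of the family together with
  independence of the set of its members.
\<close>

definition rational_direction :: "real^'n \<Rightarrow> bool" where
  "rational_direction \<omega> \<longleftrightarrow>
     (\<exists>K :: nat \<Rightarrow> real^'n.
        (\<forall>j \<in> {1..CARD('n) - 1}. K j \<in> int_vecs \<and> \<omega> \<bullet> K j = 0) \<and>
        inj_on K {1..CARD('n) - 1} \<and> independent (K ` {1..CARD('n) - 1}))"

definition direction_periodic :: "real^'n \<Rightarrow> (real^'n) set \<Rightarrow> bool" where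
  "direction_periodic \<omega> E \<longleftrightarrow>
     (\<forall>k \<in> int_vecs. \<omega> \<bullet> k = 0 \<longrightarrow> ae_equal ((\<lambda>x. x + k) ` E) E)"

definition int_periodic :: "(real^'n \<Rightarrow> real) \<Rightarrow> bool" where
  "int_periodic g \<longleftrightarrow> (\<forall>x. \<forall>k \<in> int_vecs. g (x + k) = g x)"

definition Linf_norm :: "(real^'n \<Rightarrow> real) \<Rightarrow> ereal" where
  "Linf_norm g = esssup lebesgue (\<lambda>x. ereal \<bar>g x\<bar>)"

end

theory Submission
  imports Defs
begin

text \<open>
  All the sets \<open>E\<close> are obtained as superlevel sets of one function.  By Lebesgue's density theorem,
  \<open>Per r E \<Omega>\<close> is \<open>1 / (2 r)\<close> times the measure of the points \<open>x \<in> \<Omega>\<close> whose ball \<open>ball x r\<close> meets both \<open>E\<close>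
  and its complement in positive measure (\<open>dilate_ess_boundary\<close>).  In other words, it is the integral
  over \<open>\<Omega>\<close> of the essential oscillation of the indicator of \<open>E\<close> on balls of radius \<open>r\<close>, divided by \<open>2 r\<close>.  The
  functional \<open>u \<mapsto> \<integral> osc (u, ball x r) dx\<close> makes sense for all functions; it is convex, positively
  homogeneous, submodular, and additive along a decomposition of \<open>u\<close> into horizontal slices (the
  coarea identity \<open>osc_coarea\<close>).

  Cell problem.  Among the \<open>\<int>\<^sup>n\<close>-periodic functions \<open>v\<close> with \<open>\<bar>v\<bar> \<le> L\<close>, minimize the energy of
  \<open>u x = v x - \<omega> \<bullet> x\<close> in one unit cell.  Submodularity makes the direct method work without any
  compactness: infima of tails of a minimizing sequence are still almost minimal, and monotone limits
  are lower semicontinuous (\<open>cell_minimizer_exists\<close>).  The direction \<open>\<omega>\<close> is arbitrary here, rational or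
  not.  If \<open>\<omega> \<bullet> k = 0\<close> then \<open>u (x + k) = u x\<close>, so that every superlevel set of \<open>u\<close> has the required
  periodicity.

  Width of the strip.  Compare \<open>v\<close> with its truncation \<open>min v k\<close>.  Since \<open>\<omega> \<bullet> x\<close> has oscillation at most
  \<open>2 r\<close>, the oscillation of the excess \<open>max (v - k) 0\<close> is controlled by the measure \<open>A k\<close> of the
  \<open>r\<close>-neighbourhood of \<open>{v > k}\<close>, provided that \<open>g\<close> is small enough for its contribution to be absorbed.  A
  Poincare inequality for functions with small support gains a factor \<open>l\<close>, where \<open>l\<^sup>n\<close> bounds the measure
  of the support, and the result is \<open>h * A (k + h) \<le> C l (A k)\<close> (\<open>level_decay\<close>).  The iteration
  of De Giorgi and Stampacchia then bounds \<open>v\<close> above its median by a constant that depends on \<open>n\<close>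
  only (\<open>upper_bound\<close>); the same bound below the median follows by replacing \<open>v\<close> by \<open>- v\<close>.  Uniformity
  in \<open>r\<close> comes from measuring the neighbourhoods and not the level sets themselves: a nonempty one has
  measure at least \<open>(r / n)\<^sup>n\<close>, hence \<open>r \<le> n l\<close> as long as \<open>A k\<close> is positive.  As the width does not
  depend on \<open>L\<close>, the constraint \<open>\<bar>v\<bar> \<le> L\<close> is not active when \<open>L\<close> is large.

  From functions to sets.  Periodizing a compactly supported perturbation and dividing it by a large
  number, convexity shows that \<open>u\<close> minimizes among all compactly supported perturbations
  (\<open>cell_minimizer_locally_minimal\<close>).  By the coarea identity each slice \<open>min (max (u - s) 0) \<epsilon> / \<epsilon>\<close> is
  minimal as well.  For \<open>\<epsilon> \<rightarrow> 0\<close> the slices tend to the indicator of \<open>{u > s}\<close>, and for all but countably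
  many \<open>s\<close> the minimality passes to the limit (\<open>level_set_minimal\<close>).
\<close>

section \<open>Lebesgue density and the tube around the essential boundary\<close>

lemma lmeasurable_Int_ball: "E \<in> sets lebesgue \<Longrightarrow> E \<inter> ball x \<rho> \<in> lmeasurable"
  using fmeasurable_Int_fmeasurable[OF lmeasurable_ball, of E x \<rho>] by (simp add: Int_commute)

lemma null_sets_fmeasurable: "N \<in> null_sets M \<Longrightarrow> N \<in> fmeasurable M"
  by (auto simp: fmeasurable_def null_sets_def)

text \<open>Vitali's theorem covers almost all of \<open>A\<close> by disjoint balls in which \<open>E\<close>, and hence a measurable
  hull \<open>H \<subseteq> E\<close> of \<open>A\<close>, fills at most the fraction \<open>a\<close>.  If the balls are chosen inside an open set that
  barely exceeds \<open>H\<close>, then \<open>\<bar>H\<bar> \<le> a (\<bar>H\<bar> + e)\<close> for every \<open>e > 0\<close>.  A hull is needed because \<open>A\<close> is not known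
  to be measurable.\<close>
lemma negligible_of_partial_density:
  fixes A E :: "(real^'n) set"
  assumes E: "E \<in> lmeasurable" and AE: "A \<subseteq> E" and a: "0 < a" "a < 1"
    and dens: "\<And>x d. x \<in> A \<Longrightarrow> 0 < d \<Longrightarrow>
      \<exists>\<rho>. 0 < \<rho> \<and> \<rho> < d \<and> measure lebesgue (E \<inter> ball x \<rho>) \<le> a * measure lebesgue (ball x \<rho>)"
  shows "negligible A"
proof -
  obtain H0 where H0: "H0 \<in> sets lebesgue" "A \<subseteq> H0" "outer_measure_of lebesgue A = emeasure lebesgue H0"
    using outer_measure_of_attain[of A "lebesgue"] by auto
  define H where "H = H0 \<inter> E"
  have H: "H \<in> lmeasurable" "A \<subseteq> H" "H \<subseteq> E"
    using H0 AE fmeasurable_Int_fmeasurable[OF E H0(1)] by (auto simp: H_def Int_commute)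
  have Hmin: "measure lebesgue H \<le> measure lebesgue B" if "B \<in> lmeasurable" "A \<subseteq> B" for B
  proof -
    have "emeasure lebesgue H \<le> emeasure lebesgue H0"
      using H0 by (intro emeasure_mono) (auto simp: H_def)
    also have "\<dots> = outer_measure_of lebesgue A" using H0 by simp
    also have "\<dots> \<le> outer_measure_of lebesgue B" by (rule outer_measure_of_mono[OF that(2)])
    also have "\<dots> = emeasure lebesgue B" using that by (intro outer_measure_of_eq) auto
    finally show ?thesis using that H by (simp add: emeasure_eq_measure2)
  qed
  have key: "measure lebesgue H \<le> a * (measure lebesgue H + e)" if e: "0 < e" for e
  proof -
    obtain U where U: "open U" "H \<subseteq> U" "U \<in> lmeasurable" "measure lebesgue U < measure lebesgue H + e"
    proof -
      obtain U where U: "open U" "H \<subseteq> U" "U - H \<in> lmeasurable" "emeasure lebesgue (U - H) < ennreal e"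
        using sets_lebesgue_outer_open[OF fmeasurableD[OF H(1)] e] by metis
      have UH: "U = H \<union> (U - H)" using U by auto
      have "U \<in> lmeasurable" using fmeasurable.Un[OF H(1) U(3)] UH by simp
      moreover have "measure lebesgue U = measure lebesgue H + measure lebesgue (U - H)"
        using measure_Un2[OF H(1) \<open>U \<in> lmeasurable\<close>] UH by simp
      moreover have "measure lebesgue (U - H) < e"
        using U(3,4) e by (simp add: emeasure_eq_measure2 ennreal_less_iff)
      ultimately show ?thesis using U that by auto
    qed
    define K where "K = {(x, \<rho>). x \<in> A \<and> 0 < \<rho> \<and> ball x \<rho> \<subseteq> U \<and>
        measure lebesgue (E \<inter> ball x \<rho>) \<le> a * measure lebesgue (ball x \<rho>)}"
    have cover: "\<exists>i. i \<in> K \<and> x \<in> ball (fst i) (snd i) \<and> snd i < d" if x: "x \<in> A" and d: "0 < d" for x d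
    proof -
      obtain d' where d': "0 < d'" "ball x d' \<subseteq> U"
      proof -
        have "x \<in> U" using x U(2) H(2) by blast
        then show ?thesis using U(1) that unfolding open_contains_ball by blast
      qed
      obtain \<rho> where "0 < \<rho>" "\<rho> < min d d'" "measure lebesgue (E \<inter> ball x \<rho>) \<le> a * measure lebesgue (ball x \<rho>)"
        using dens[OF x, of "min d d'"] d d' by auto
      moreover then have "ball x \<rho> \<subseteq> U" using d' subset_ball[of \<rho> d' x] by auto
      ultimately show ?thesis using x by (intro exI[of _ "(x, \<rho>)"]) (auto simp: K_def)
    qed
    obtain C where C: "countable C" "C \<subseteq> K"
      "pairwise (\<lambda>i j. disjnt (ball (fst i) (snd i)) (ball (fst j) (snd j))) C"
      "negligible (A - (\<Union>i\<in>C. ball (fst i) (snd i)))"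
      by (rule Vitali_covering_theorem_balls[where a=fst and r=snd and S=A and K=K, OF cover]) auto
    define B where "B i = ball (fst i) (snd i)" for i :: "(real^'n) \<times> real"
    have Bl: "B i \<in> lmeasurable" for i by (simp add: B_def)
    have disj: "disjoint_family_on (\<lambda>i. H \<inter> B i) C" "disjoint_family_on B C"
      using C(3) unfolding disjoint_family_on_def pairwise_def disjnt_def B_def by blast+
    define N where "N = A - (\<Union>i\<in>C. B i)"
    have N: "N \<in> null_sets lebesgue"
      using C(4) by (simp add: N_def B_def negligible_iff_null_sets)
    define V where "V = H \<inter> (\<Union>i\<in>C. B i)"
    have V: "V \<in> lmeasurable"
      unfolding V_def B_def by (intro fmeasurable_Int_fmeasurable[OF H(1)] borel_open[THEN sets_completionI_sets[of _ lborel, simplified]] open_UN) auto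
    have "measure lebesgue H \<le> measure lebesgue (V \<union> N)"
      using H(2) by (intro Hmin fmeasurable.Un V null_sets_fmeasurable[OF N]) (auto simp: V_def N_def)
    also have "\<dots> = measure lebesgue V"
      using V N by (intro measure_Un_null_set) auto
    finally have HV: "measure lebesgue H \<le> measure lebesgue V" .
    have "emeasure lebesgue V = (\<integral>\<^sup>+i. emeasure lebesgue (H \<inter> B i) \<partial>count_space C)"
      unfolding V_def Int_UN_distrib
      using H(1) Bl C(1) disj by (intro emeasure_UN_countable) auto
    also have "\<dots> \<le> (\<integral>\<^sup>+i. ennreal a * emeasure lebesgue (B i) \<partial>count_space C)"
    proof (rule nn_integral_mono)
      fix i assume "i \<in> space (count_space C)"
      then have i: "i \<in> K" using C by auto
      have EB: "E \<inter> B i \<in> lmeasurable" using E Bl by (simp add: fmeasurable.Int)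
      have "emeasure lebesgue (H \<inter> B i) \<le> emeasure lebesgue (E \<inter> B i)"
        using H EB by (intro emeasure_mono) auto
      also have "\<dots> = ennreal (measure lebesgue (E \<inter> B i))" using EB by (simp add: emeasure_eq_measure2)
      also have "\<dots> \<le> ennreal (a * measure lebesgue (B i))"
        using i by (intro ennreal_leI) (auto simp: K_def B_def)
      also have "\<dots> = ennreal a * emeasure lebesgue (B i)"
        using Bl a by (simp add: emeasure_eq_measure2 ennreal_mult)
      finally show "emeasure lebesgue (H \<inter> B i) \<le> ennreal a * emeasure lebesgue (B i)" .
    qed
    also have "\<dots> = ennreal a * (\<integral>\<^sup>+i. emeasure lebesgue (B i) \<partial>count_space C)"
      by (rule nn_integral_cmult) auto
    also have "(\<integral>\<^sup>+i. emeasure lebesgue (B i) \<partial>count_space C) = emeasure lebesgue (\<Union>i\<in>C. B i)"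
      using Bl C(1) disj by (intro emeasure_UN_countable[symmetric]) auto
    also have "\<dots> \<le> emeasure lebesgue U"
    proof (rule emeasure_mono)
      have "B i \<subseteq> U" if "i \<in> C" for i
      proof -
        have "i \<in> K" using that C(2) by blast
        then show ?thesis by (cases i) (simp add: K_def B_def)
      qed
      then show "(\<Union>i\<in>C. B i) \<subseteq> U" by blast
    qed (use U in auto)
    finally have "ennreal (measure lebesgue V) \<le> ennreal (a * measure lebesgue U)"
      using V U a by (simp add: emeasure_eq_measure2 ennreal_mult mult_left_mono)
    then have "measure lebesgue V \<le> a * measure lebesgue U"
      using a by (subst (asm) ennreal_le_iff) auto
    also have "\<dots> \<le> a * (measure lebesgue H + e)" using U a by (intro mult_left_mono) auto
    finally show ?thesis using HV by linarith
  qed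
  have "measure lebesgue H = 0"
  proof (rule ccontr)
    assume "\<not> ?thesis"
    then have pos: "0 < measure lebesgue H" by (simp add: zero_less_measure_iff)
    let ?m = "measure lebesgue H"
    \<comment> \<open>With this choice of \<open>e\<close> the bound becomes \<open>?m (1 + a) / 2\<close>.\<close>
    have "?m \<le> a * (?m + ?m * (1 - a) / (2 * a))"
      using pos a by (intro key) auto
    also have "\<dots> = ?m * (1 + a) / 2" using a by (simp add: field_simps)
    also have "\<dots> < ?m" using pos a by (simp add: field_simps)
    finally show False by simp
  qed
  then have "H \<in> null_sets lebesgue" using H by (auto simp: null_sets_def emeasure_eq_measure2)
  then show ?thesis using H(2) negligible_iff_null_sets negligible_subset by blast
qed

text \<open>A point of \<open>E\<close> at which the density is not one lies, for some \<open>j\<close>, in arbitrarily small balls that \<open>E\<close>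
  fills at most to the fraction \<open>1 - 1 / (j + 2)\<close>.\<close>
lemma lebesgue_density:
  fixes E :: "(real^'n) set"
  assumes E: "E \<in> sets lebesgue"
  shows "E - density_one E \<in> null_sets lebesgue"
proof -
  define A where "A m j = {x \<in> E \<inter> ball 0 (real m). \<forall>d>0. \<exists>\<rho>. 0 < \<rho> \<and> \<rho> < d \<and>
      measure lebesgue (E \<inter> ball x \<rho>) \<le> (1 - 1 / real (j + 2)) * measure lebesgue (ball x \<rho>)}" for m j :: nat
  have neg: "negligible (A m j)" for m j
  proof (rule negligible_of_partial_density[where E="E \<inter> ball 0 (real m)" and a="1 - 1 / real (j + 2)"])
    show "E \<inter> ball 0 (real m) \<in> lmeasurable"
      using E by (metis fmeasurable_Int_fmeasurable inf_commute lmeasurable_ball)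
    show "A m j \<subseteq> E \<inter> ball 0 (real m)" by (auto simp: A_def)
    show "0 < 1 - 1 / real (j + 2)" "1 - 1 / real (j + 2) < 1" by (auto simp: field_simps)
    fix x d assume x: "x \<in> A m j" and "0 < (d::real)"
    then obtain \<rho> where \<rho>: "0 < \<rho>" "\<rho> < d"
      "measure lebesgue (E \<inter> ball x \<rho>) \<le> (1 - 1 / real (j + 2)) * measure lebesgue (ball x \<rho>)"
      unfolding A_def by blast
    have "measure lebesgue (E \<inter> ball 0 (real m) \<inter> ball x \<rho>) \<le> measure lebesgue (E \<inter> ball x \<rho>)"
      by (intro measure_mono_fmeasurable lmeasurable_Int_ball E fmeasurableD) (auto intro!: lmeasurable_Int_ball E)
    with \<rho> show "\<exists>\<rho>. 0 < \<rho> \<and> \<rho> < d \<and> measure lebesgue (E \<inter> ball 0 (real m) \<inter> ball x \<rho>)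
        \<le> (1 - 1 / real (j + 2)) * measure lebesgue (ball x \<rho>)"
      by (intro exI[of _ \<rho>]) auto
  qed
  have "E - density_one E \<subseteq> (\<Union>m. \<Union>j. A m j)"
  proof
    fix x assume x: "x \<in> E - density_one E"
    let ?q = "\<lambda>\<rho>. measure lebesgue (E \<inter> ball x \<rho>) / measure lebesgue (ball x \<rho>)"
    have le1: "?q \<rho> \<le> 1" for \<rho>
    proof -
      have "measure lebesgue (E \<inter> ball x \<rho>) \<le> measure lebesgue (ball x \<rho>)"
        using lmeasurable_Int_ball[OF E] by (intro measure_mono_fmeasurable) (auto simp: fmeasurableD)
      then show ?thesis using measure_nonneg[of lebesgue "ball x \<rho>"] by (simp add: divide_le_eq)
    qed
    from x have "\<not> (?q \<longlongrightarrow> 1) (at_right 0)" by (simp add: density_one_def)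
    then obtain e where e: "0 < e" "\<not> (\<forall>\<^sub>F \<rho> in at_right 0. dist (?q \<rho>) 1 < e)"
      unfolding tendsto_iff by blast
    obtain j where j: "1 / real (j + 2) < e"
    proof -
      obtain j where "inverse (real (Suc j)) < e" using reals_Archimedean[OF e(1)] by blast
      moreover have "1 / real (j + 2) \<le> inverse (real (Suc j))" by (simp add: field_simps)
      ultimately show ?thesis using that[of j] by linarith
    qed
    obtain m where m: "norm x < real m" using reals_Archimedean2 by blast
    have "\<exists>\<rho>. 0 < \<rho> \<and> \<rho> < d \<and> measure lebesgue (E \<inter> ball x \<rho>) \<le> (1 - 1 / real (j + 2)) * measure lebesgue (ball x \<rho>)"
      if d: "0 < d" for d
    proof -
      obtain \<rho> where \<rho>: "0 < \<rho>" "\<rho> < d" "\<not> dist (?q \<rho>) 1 < e"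
        using e(2) d unfolding eventually_at_right_field by blast
      then have "?q \<rho> \<le> 1 - 1 / real (j + 2)" using le1[of \<rho>] j by (auto simp: dist_real_def)
      moreover have "0 < measure lebesgue (ball x \<rho>)" using \<rho> by (simp add: content_ball_pos)
      ultimately show ?thesis using \<rho> by (auto simp: field_simps)
    qed
    then have "x \<in> A m j" using x m by (auto simp: A_def)
    then show "x \<in> (\<Union>m. \<Union>j. A m j)" by blast
  qed
  moreover have "negligible (\<Union>m. \<Union>j. A m j)"
    using neg by (intro negligible_countable_Union[of "range _"]) (auto intro!: negligible_countable_Union[of "range _"])
  ultimately show ?thesis using negligible_iff_null_sets negligible_subset by blast
qed

lemma density_one_disjoint:
  fixes E :: "(real^'n) set"
  assumes E: "E \<in> sets lebesgue"
  shows "density_one E \<inter> density_one (- E) = {}"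
proof (rule ccontr)
  assume "density_one E \<inter> density_one (- E) \<noteq> {}"
  then obtain x where x: "x \<in> density_one E" "x \<in> density_one (- E)" by blast
  let ?q = "\<lambda>E \<rho>. measure lebesgue (E \<inter> ball x \<rho>) / measure lebesgue (ball x \<rho>)"
  have "((\<lambda>\<rho>. ?q E \<rho> + ?q (- E) \<rho>) \<longlongrightarrow> 1 + 1) (at_right 0)"
    using x by (intro tendsto_add) (auto simp: density_one_def)
  moreover have "((\<lambda>\<rho>. ?q E \<rho> + ?q (- E) \<rho>) \<longlongrightarrow> 1) (at_right 0)"
  proof (rule tendsto_eventually)
    have "?q E \<rho> + ?q (- E) \<rho> = 1" if "0 < \<rho>" for \<rho>
    proof -
      have "measure lebesgue (E \<inter> ball x \<rho>) + measure lebesgue (- E \<inter> ball x \<rho>) = measure lebesgue (ball x \<rho>)"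
      proof -
        have "measure lebesgue ((E \<inter> ball x \<rho>) \<union> (- E \<inter> ball x \<rho>))
            = measure lebesgue (E \<inter> ball x \<rho>) + measure lebesgue (- E \<inter> ball x \<rho>)"
          using E by (intro measure_Un_AE lmeasurable_Int_ball) (auto simp: Compl_in_sets_lebesgue)
        moreover have "(E \<inter> ball x \<rho>) \<union> (- E \<inter> ball x \<rho>) = ball x \<rho>" by auto
        ultimately show ?thesis by simp
      qed
      moreover have "measure lebesgue (ball x \<rho>) \<noteq> 0" using content_ball_pos[OF that, of x] by simp
      ultimately show ?thesis by (simp flip: add_divide_distrib)
    qed
    then show "\<forall>\<^sub>F \<rho> in at_right 0. ?q E \<rho> + ?q (- E) \<rho> = 1"
      by (auto simp: eventually_at_right_field intro!: exI[of _ 1])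
  qed
  ultimately have "(1::real) + 1 = 1"
    using tendsto_unique trivial_limit_at_right_real by blast
  then show False by simp
qed

lemma density_one_interior:
  fixes E :: "(real^'n) set"
  assumes "E \<in> sets lebesgue" "ball x r - E \<in> null_sets lebesgue"
  shows "ball x r \<subseteq> density_one E"
proof
  fix y assume y: "y \<in> ball x r"
  obtain d where d: "0 < d" "ball y d \<subseteq> ball x r"
    using y open_contains_ball_eq[of "ball x r" y] by auto
  have "measure lebesgue (E \<inter> ball y \<rho>) / measure lebesgue (ball y \<rho>) = 1" if "0 < \<rho>" "\<rho> < d" for \<rho>
  proof -
    have "ball y \<rho> \<subseteq> ball x r" using d that subset_ball[of \<rho> d y] by auto
    then have "ball y \<rho> - E \<in> null_sets lebesgue"
      using assms by (intro null_sets_subset[OF assms(2)]) auto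
    then have "measure lebesgue ((E \<inter> ball y \<rho>) \<union> (ball y \<rho> - E)) = measure lebesgue (E \<inter> ball y \<rho>)"
      using assms by (intro measure_Un_null_set) auto
    moreover have "(E \<inter> ball y \<rho>) \<union> (ball y \<rho> - E) = ball y \<rho>" by auto
    ultimately show ?thesis using content_ball_pos[OF that(1), of y] by simp
  qed
  then show "y \<in> density_one E"
    using d(1) by (auto simp: density_one_def eventually_at_right_field intro!: tendsto_eventually exI[of _ d])
qed

text \<open>For measurable \<open>E\<close> and \<open>r > 0\<close> this is the tube of radius \<open>r\<close> around the essential boundary; see
  \<open>dilate_ess_boundary\<close> below.\<close>
definition tube :: "real \<Rightarrow> (real^'n) set \<Rightarrow> (real^'n) set" where
  "tube r E = {x. ball x r \<inter> E \<notin> null_sets lebesgue \<and> ball x r - E \<notin> null_sets lebesgue}"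

text \<open>A ball is connected, so it misses the frontier of \<open>density_one E\<close> only if it is contained in that set
  or disjoint from it.  By the density theorem these two cases mean that \<open>E\<close> has full, respectively
  zero, measure in the ball.\<close>
lemma dilate_ess_boundary:
  fixes E :: "(real^'n) set"
  assumes E: "E \<in> sets lebesgue" and r: "0 < r"
  shows "dilate (ess_boundary E) r = tube r E"
proof -
  let ?D = "density_one E"
  have iff: "x \<in> dilate (ess_boundary E) r \<longleftrightarrow> ball x r \<inter> frontier ?D \<noteq> {}" for x
    unfolding dilate_def ess_boundary_def by (auto simp: dist_commute disjoint_iff)
  have full: "ball x r \<subseteq> ?D \<longleftrightarrow> ball x r - E \<in> null_sets lebesgue" for x
  proof
    assume s: "ball x r \<subseteq> ?D"
    have "ball x r - E \<subseteq> (- E) - density_one (- E)"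
      using s density_one_disjoint[OF E] by auto
    moreover have "(- E) - density_one (- E) \<in> null_sets lebesgue"
      by (rule lebesgue_density) (use E in \<open>auto simp: Compl_in_sets_lebesgue\<close>)
    ultimately show "ball x r - E \<in> null_sets lebesgue"
      using negligible_iff_null_sets negligible_subset by blast
  qed (rule density_one_interior[OF E])
  have empty: "ball x r \<inter> ?D = {} \<longleftrightarrow> ball x r \<inter> E \<in> null_sets lebesgue" for x
  proof
    assume s: "ball x r \<inter> ?D = {}"
    then have "ball x r \<inter> E \<subseteq> E - ?D" by auto
    then show "ball x r \<inter> E \<in> null_sets lebesgue"
      using lebesgue_density[OF E] negligible_iff_null_sets negligible_subset by blast
  next
    assume "ball x r \<inter> E \<in> null_sets lebesgue"
    then have "ball x r \<subseteq> density_one (- E)"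
      using E by (intro density_one_interior) (auto simp: Diff_eq Compl_in_sets_lebesgue)
    then show "ball x r \<inter> ?D = {}" using density_one_disjoint[OF E] by auto
  qed
  have "ball x r \<inter> frontier ?D \<noteq> {} \<longleftrightarrow> \<not> (ball x r \<subseteq> ?D) \<and> ball x r \<inter> ?D \<noteq> {}" for x
  proof
    assume "ball x r \<inter> frontier ?D \<noteq> {}"
    then obtain y where y: "y \<in> ball x r" "y \<in> closure ?D" "y \<notin> interior ?D"
      by (auto simp: frontier_def)
    have "ball x r \<inter> ?D \<noteq> {}" using y(1,2) open_Int_closure_eq_empty[of "ball x r" ?D] by auto
    moreover have "\<not> ball x r \<subseteq> ?D" using y(1,3) interior_maximal[OF _ open_ball, of x r ?D] by blast
    ultimately show "\<not> (ball x r \<subseteq> ?D) \<and> ball x r \<inter> ?D \<noteq> {}" by blast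
  next
    assume "\<not> (ball x r \<subseteq> ?D) \<and> ball x r \<inter> ?D \<noteq> {}"
    then show "ball x r \<inter> frontier ?D \<noteq> {}"
      by (intro connected_Int_frontier) auto
  qed
  then show ?thesis using full empty iff by (auto simp: tube_def)
qed


section \<open>Oscillation on balls\<close>

definition tame :: "(real^'n \<Rightarrow> real) \<Rightarrow> bool" where
  "tame u \<longleftrightarrow> u \<in> borel_measurable borel \<and> (\<forall>R. \<exists>C. \<forall>x. norm x \<le> R \<longrightarrow> \<bar>u x\<bar> \<le> C)"

lemma tame_borel [measurable_dest]: "tame u \<Longrightarrow> u \<in> borel_measurable borel"
  by (simp add: tame_def)

lemma tame_bound: "tame u \<Longrightarrow> \<exists>C. \<forall>x. norm x \<le> R \<longrightarrow> \<bar>u x\<bar> \<le> C"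
  by (simp add: tame_def)

lemma tame_of_bound: "u \<in> borel_measurable borel \<Longrightarrow> (\<And>x. \<bar>u x\<bar> \<le> C) \<Longrightarrow> tame u"
  by (auto simp: tame_def)

lemma tame_const: "tame (\<lambda>x. c)"
  by (rule tame_of_bound[where C="\<bar>c\<bar>"]) auto

lemma tame_combine:
  assumes "tame u" "tame v" and m: "(\<lambda>x. h (u x) (v x)) \<in> borel_measurable borel"
    and h: "\<And>a b A B. \<bar>a\<bar> \<le> A \<Longrightarrow> \<bar>b\<bar> \<le> B \<Longrightarrow> \<bar>h a b\<bar> \<le> H A B"
  shows "tame (\<lambda>x. h (u x) (v x))"
  unfolding tame_def
proof (intro conjI m allI)
  fix R
  obtain A where A: "\<forall>x. norm x \<le> R \<longrightarrow> \<bar>u x\<bar> \<le> A" using tame_bound[OF assms(1)] by blast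
  obtain B where B: "\<forall>x. norm x \<le> R \<longrightarrow> \<bar>v x\<bar> \<le> B" using tame_bound[OF assms(2)] by blast
  show "\<exists>C. \<forall>x. norm x \<le> R \<longrightarrow> \<bar>h (u x) (v x)\<bar> \<le> C"
    using A B h by (intro exI[of _ "H A B"]) blast
qed

lemma tame_add: "tame u \<Longrightarrow> tame v \<Longrightarrow> tame (\<lambda>x. u x + v x)"
  by (rule tame_combine[where H="(+)"]) (auto dest: tame_borel)

lemma tame_diff: "tame u \<Longrightarrow> tame v \<Longrightarrow> tame (\<lambda>x. u x - v x)"
  by (rule tame_combine[where H="(+)"]) (auto dest: tame_borel)

lemma tame_mult: "tame u \<Longrightarrow> tame v \<Longrightarrow> tame (\<lambda>x. u x * v x)"
  by (rule tame_combine[where H="(*)" and h="(*)"]) (auto dest: tame_borel simp: abs_mult intro!: mult_mono)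

lemma tame_min: "tame u \<Longrightarrow> tame v \<Longrightarrow> tame (\<lambda>x. min (u x) (v x))"
  by (rule tame_combine[where H="(+)"]) (auto dest: tame_borel)

lemma tame_max: "tame u \<Longrightarrow> tame v \<Longrightarrow> tame (\<lambda>x. max (u x) (v x))"
  by (rule tame_combine[where H="(+)"]) (auto dest: tame_borel)

lemma tame_minus: "tame u \<Longrightarrow> tame (\<lambda>x. - u x)"
  using tame_diff[OF tame_const[of 0]] by simp

lemma tame_abs: "tame u \<Longrightarrow> tame (\<lambda>x. \<bar>u x\<bar>)"
  by (rule tame_combine[where H="\<lambda>x y. x" and h="\<lambda>x y. \<bar>x\<bar>" and v=u]) (auto dest: tame_borel)

lemma tame_sum: "(\<And>k. k \<in> A \<Longrightarrow> tame (u k)) \<Longrightarrow> tame (\<lambda>x. \<Sum>k\<in>A. u k x)"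
  by (induction A rule: infinite_finite_induct) (auto intro: tame_add tame_const)

lemma tame_indicator: "A \<in> sets borel \<Longrightarrow> tame (indicator A)"
  by (rule tame_of_bound[where C=1]) (auto simp: indicator_def)

lemma tame_if: "tame u \<Longrightarrow> tame v \<Longrightarrow> A \<in> sets borel \<Longrightarrow> tame (\<lambda>x. if x \<in> A then u x else v x)"
proof -
  assume "tame u" "tame v" "A \<in> sets borel"
  moreover have "(\<lambda>x. if x \<in> A then u x else v x)
      = (\<lambda>x. indicator A x * u x + (1 - indicator A x) * v x)"
    by (auto simp: indicator_def)
  ultimately show ?thesis
    by (auto intro!: tame_add tame_mult tame_diff tame_const tame_indicator)
qed

lemma tame_inner: "tame (\<lambda>x. w \<bullet> x)"
  unfolding tame_def
proof (intro conjI allI)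
  fix R show "\<exists>C. \<forall>x. norm x \<le> R \<longrightarrow> \<bar>w \<bullet> x\<bar> \<le> C"
    by (intro exI[of _ "norm w * R"]) (meson Cauchy_Schwarz_ineq2 mult_left_mono norm_ge_zero order_trans)
qed auto

lemma tame_shift:
  assumes "tame u" shows "tame (\<lambda>x. u (x + h))"
  unfolding tame_def
proof (intro conjI allI)
  show "(\<lambda>x. u (x + h)) \<in> borel_measurable borel"
    using tame_borel[OF assms] by measurable
  fix R
  obtain C where C: "\<forall>x. norm x \<le> R + norm h \<longrightarrow> \<bar>u x\<bar> \<le> C" using tame_bound[OF assms] by blast
  have "norm (x + h) \<le> R + norm h" if "norm x \<le> R" for x using that norm_triangle_ineq[of x h] by linarith
  with C show "\<exists>C. \<forall>x. norm x \<le> R \<longrightarrow> \<bar>u (x + h)\<bar> \<le> C" by blast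
qed

lemmas tame_intros = tame_add tame_diff tame_mult tame_min tame_max tame_minus tame_abs tame_const tame_inner

definition ball_sup :: "real \<Rightarrow> (real^'n \<Rightarrow> real) \<Rightarrow> real^'n \<Rightarrow> real" where
  "ball_sup r u x = (SUP y\<in>ball x r. u y)"

text \<open>The oscillation \<open>sup u - inf u\<close> on \<open>ball x r\<close>, with the infimum written as a supremum so that the
  symmetry \<open>u \<mapsto> - u\<close> is visible.  Suprema are taken over all points, not up to null sets: over open balls
  they are lower semicontinuous in \<open>x\<close>, so measurability is immediate, and no null sets have to be
  carried along.  The section on precise representatives restores the connection with measure theory.\<close>
definition osc :: "real \<Rightarrow> (real^'n \<Rightarrow> real) \<Rightarrow> real^'n \<Rightarrow> real" where
  "osc r u x = ball_sup r u x + ball_sup r (\<lambda>y. - u y) x"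

lemma tame_bdd_above: assumes "tame u" shows "bdd_above (u ` ball x r)"
proof -
  obtain C where C: "\<forall>y. norm y \<le> norm x + r \<longrightarrow> \<bar>u y\<bar> \<le> C" using tame_bound[OF assms] by blast
  have "norm y \<le> norm x + r" if "y \<in> ball x r" for y
  proof -
    have "norm y \<le> norm x + norm (x - y)"
      using norm_triangle_ineq4[of x "x - y"] by simp
    with that show ?thesis by (simp add: dist_norm)
  qed
  with C show ?thesis by (intro bdd_aboveI2[where M=C]) (meson abs_le_D1)
qed

lemma ball_sup_upper: "tame u \<Longrightarrow> y \<in> ball x r \<Longrightarrow> u y \<le> ball_sup r u x"
  unfolding ball_sup_def by (rule cSUP_upper[OF _ tame_bdd_above])

lemma ball_sup_least: "0 < r \<Longrightarrow> (\<And>y. y \<in> ball x r \<Longrightarrow> u y \<le> c) \<Longrightarrow> ball_sup r u x \<le> c"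
  unfolding ball_sup_def by (rule cSUP_least) auto

lemma ball_sup_less: "tame u \<Longrightarrow> 0 < r \<Longrightarrow> t < ball_sup r u x \<longleftrightarrow> (\<exists>y\<in>ball x r. t < u y)"
  unfolding ball_sup_def by (rule less_cSUP_iff) (auto intro: tame_bdd_above)

lemma ball_sup_mono: "tame v \<Longrightarrow> 0 < r \<Longrightarrow> (\<And>y. y \<in> ball x r \<Longrightarrow> u y \<le> v y) \<Longrightarrow> ball_sup r u x \<le> ball_sup r v x"
  using ball_sup_upper[of v _ x r] by (intro ball_sup_least) (auto intro: order_trans)

lemma ball_sup_cong: "(\<And>y. y \<in> ball x r \<Longrightarrow> u y = v y) \<Longrightarrow> ball_sup r u x = ball_sup r v x"
  unfolding ball_sup_def by (rule SUP_cong) auto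

lemma osc_cong: "(\<And>y. y \<in> ball x r \<Longrightarrow> u y = v y) \<Longrightarrow> osc r u x = osc r v x"
  unfolding osc_def by (intro arg_cong2[where f="(+)"] ball_sup_cong) auto

lemma ball_sup_superlevel_open:
  fixes u :: "real^'n \<Rightarrow> real"
  assumes "tame u" "0 < r" shows "open {x. t < ball_sup r u x}"
proof -
  have "{x. t < ball_sup r u x} = (\<Union>y\<in>{y. t < u y}. ball y r)"
    using ball_sup_less[OF assms] by (auto simp: dist_commute)
  then show ?thesis by auto
qed

lemma tame_ball_sup:
  fixes u :: "real^'n \<Rightarrow> real"
  assumes u: "tame u" and r: "0 < r" shows "tame (ball_sup r u)"
  unfolding tame_def
proof (intro conjI allI)
  show "ball_sup r u \<in> borel_measurable borel"
    by (rule borel_measurableI_greater) (simp add: ball_sup_superlevel_open[OF assms])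
  fix R
  obtain C where C: "\<forall>x. norm x \<le> R + r \<longrightarrow> \<bar>u x\<bar> \<le> C" using tame_bound[OF u] by blast
  have "\<bar>ball_sup r u x\<bar> \<le> C" if "norm x \<le> R" for x
  proof -
    have b: "\<bar>u y\<bar> \<le> C" if "y \<in> ball x r" for y
    proof -
      have "norm y \<le> norm x + norm (x - y)"
        using norm_triangle_ineq4[of x "x - y"] by simp
      with that C \<open>norm x \<le> R\<close> show ?thesis by (simp add: dist_norm)
    qed
    have "x \<in> ball x r" using r by simp
    from b[OF this] ball_sup_upper[OF u this] have "- C \<le> ball_sup r u x" by linarith
    moreover have "ball_sup r u x \<le> C" by (rule ball_sup_least[OF r]) (use b in \<open>force simp: abs_le_iff\<close>)
    ultimately show ?thesis by linarith
  qed
  then show "\<exists>C. \<forall>x. norm x \<le> R \<longrightarrow> \<bar>ball_sup r u x\<bar> \<le> C" by blast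
qed

lemma tame_osc: "tame u \<Longrightarrow> 0 < r \<Longrightarrow> tame (osc r u)"
  unfolding osc_def by (intro tame_intros tame_ball_sup)

lemma osc_minus: "osc r (\<lambda>y. - u y) x = osc r u x"
  by (simp add: osc_def)

lemma osc_le:
  assumes "0 < r" "\<And>y. y \<in> ball x r \<Longrightarrow> a \<le> u y \<and> u y \<le> b"
  shows "osc r u x \<le> b - a"
proof -
  have "ball_sup r u x \<le> b" "ball_sup r (\<lambda>y. - u y) x \<le> - a"
    using assms by (auto intro!: ball_sup_least)
  then show ?thesis by (simp add: osc_def)
qed

lemma osc_ge: "tame u \<Longrightarrow> y \<in> ball x r \<Longrightarrow> z \<in> ball x r \<Longrightarrow> u y - u z \<le> osc r u x"
  unfolding osc_def using ball_sup_upper[of u y x r] ball_sup_upper[OF tame_minus, of u z x r] by force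

lemma osc_nonneg: "tame u \<Longrightarrow> 0 < r \<Longrightarrow> 0 \<le> osc r u x"
  using osc_ge[of u x x r x] by simp

lemma ball_sup_add_le:
  "tame u \<Longrightarrow> tame v \<Longrightarrow> 0 < r \<Longrightarrow> ball_sup r (\<lambda>y. u y + v y) x \<le> ball_sup r u x + ball_sup r v x"
  by (auto intro!: ball_sup_least add_mono ball_sup_upper)

lemma osc_add_le:
  assumes "tame u" "tame v" "0 < r"
  shows "osc r (\<lambda>y. u y + v y) x \<le> osc r u x + osc r v x"
  using ball_sup_add_le[OF assms, of x] ball_sup_add_le[OF tame_minus tame_minus assms(3), OF assms(1,2), of x]
  by (simp add: osc_def)

lemma osc_sum_le:
  assumes "\<And>k. k \<in> A \<Longrightarrow> tame (u k)" "0 < r"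
  shows "osc r (\<lambda>y. \<Sum>k\<in>A. u k y) x \<le> (\<Sum>k\<in>A. osc r (u k) x)"
proof -
  have "ball_sup r (\<lambda>y. \<Sum>k\<in>A. u k y) x \<le> (\<Sum>k\<in>A. ball_sup r (u k) x)"
    using assms by (auto intro!: ball_sup_least sum_mono ball_sup_upper)
  moreover have "ball_sup r (\<lambda>y. \<Sum>k\<in>A. - u k y) x \<le> (\<Sum>k\<in>A. ball_sup r (\<lambda>y. - u k y) x)"
    using assms by (auto intro!: ball_sup_least sum_mono ball_sup_upper[of "\<lambda>y. - u _ y"] tame_minus)
  ultimately show ?thesis by (simp add: osc_def sum.distrib sum_negf)
qed

lemma ball_sup_scale:
  assumes u: "tame u" and r: "0 < r" and c: "0 < c"
  shows "ball_sup r (\<lambda>y. c * u y) x = c * ball_sup r u x"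
proof (rule antisym)
  show "ball_sup r (\<lambda>y. c * u y) x \<le> c * ball_sup r u x"
    using assms by (auto intro!: ball_sup_least ball_sup_upper)
  have "ball_sup r u x \<le> ball_sup r (\<lambda>y. c * u y) x / c"
  proof (rule ball_sup_least[OF r])
    fix y assume "y \<in> ball x r"
    then have "c * u y \<le> ball_sup r (\<lambda>y. c * u y) x" by (intro ball_sup_upper tame_intros u)
    then show "u y \<le> ball_sup r (\<lambda>y. c * u y) x / c" using c by (simp add: field_simps)
  qed
  then show "c * ball_sup r u x \<le> ball_sup r (\<lambda>y. c * u y) x" using c by (simp add: field_simps)
qed

lemma osc_scale:
  assumes "tame u" "0 < r" "0 < c"
  shows "osc r (\<lambda>y. c * u y) x = c * osc r u x"
  using ball_sup_scale[OF assms] ball_sup_scale[OF tame_minus[OF assms(1)] assms(2,3)]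
  by (simp add: osc_def algebra_simps)

lemma ball_sup_shift: "ball_sup r (\<lambda>y. u (y + h)) x = ball_sup r u (x + h)"
proof -
  have "(\<lambda>y. y + h) ` ball x r = ball (x + h) r"
    using ball_translation[of h x r] by (simp add: add.commute)
  then have "u ` ball (x + h) r = (\<lambda>y. u (y + h)) ` ball x r"
    by (metis image_image)
  then show ?thesis by (simp add: ball_sup_def)
qed

lemma osc_shift: "osc r (\<lambda>y. u (y + h)) x = osc r u (x + h)"
  by (simp add: osc_def ball_sup_shift[of r "\<lambda>z. - u z"] ball_sup_shift)

lemma ball_sup_add_const:
  assumes "tame u" "0 < r" shows "ball_sup r (\<lambda>y. u y + c) x = ball_sup r u x + c"
proof (rule antisym)
  show "ball_sup r (\<lambda>y. u y + c) x \<le> ball_sup r u x + c"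
    using assms by (auto intro!: ball_sup_least ball_sup_upper)
  have "ball_sup r u x \<le> ball_sup r (\<lambda>y. u y + c) x - c"
  proof (rule ball_sup_least[OF assms(2)])
    fix y assume "y \<in> ball x r"
    then have "u y + c \<le> ball_sup r (\<lambda>y. u y + c) x" by (intro ball_sup_upper tame_intros assms)
    then show "u y \<le> ball_sup r (\<lambda>y. u y + c) x - c" by simp
  qed
  then show "ball_sup r u x + c \<le> ball_sup r (\<lambda>y. u y + c) x" by simp
qed

lemma osc_add_const: "tame u \<Longrightarrow> 0 < r \<Longrightarrow> osc r (\<lambda>y. u y + c) x = osc r u x"
  using ball_sup_add_const[of u r c x] ball_sup_add_const[of "\<lambda>y. - u y" r "- c" x]
  by (simp add: osc_def tame_minus)

lemma ball_sup_max:
  assumes "tame u" "tame v" "0 < r"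
  shows "ball_sup r (\<lambda>y. max (u y) (v y)) x = max (ball_sup r u x) (ball_sup r v x)"
proof (rule antisym)
  show "ball_sup r (\<lambda>y. max (u y) (v y)) x \<le> max (ball_sup r u x) (ball_sup r v x)"
    using assms by (intro ball_sup_least max.mono) (auto intro: ball_sup_upper)
  show "max (ball_sup r u x) (ball_sup r v x) \<le> ball_sup r (\<lambda>y. max (u y) (v y)) x"
    using assms by (auto intro!: ball_sup_mono tame_intros)
qed

lemma ball_sup_min_le:
  assumes "tame u" "tame v" "0 < r"
  shows "ball_sup r (\<lambda>y. min (u y) (v y)) x \<le> min (ball_sup r u x) (ball_sup r v x)"
  using assms by (auto intro!: ball_sup_mono)

text \<open>The supremum of a maximum is the maximum of the suprema, while the supremum of a minimum is at most
  the minimum of the suprema.\<close>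
lemma osc_submodular:
  assumes "tame u" "tame v" "0 < r"
  shows "osc r (\<lambda>y. min (u y) (v y)) x + osc r (\<lambda>y. max (u y) (v y)) x \<le> osc r u x + osc r v x"
proof -
  have 1: "(\<lambda>y. - min (u y) (v y)) = (\<lambda>y. max (- u y) (- v y))"
    and 2: "(\<lambda>y. - max (u y) (v y)) = (\<lambda>y. min (- u y) (- v y))" by auto
  have mm: "min a b + max a b = a + b" for a b :: real by (simp add: min_def max_def)
  show ?thesis
    unfolding osc_def 1 2
    using ball_sup_max[OF assms, of x] ball_sup_min_le[OF assms, of x]
      ball_sup_max[OF tame_minus tame_minus assms(3), OF assms(1,2), of x]
      ball_sup_min_le[OF tame_minus tame_minus assms(3), OF assms(1,2), of x]
      mm[of "ball_sup r u x" "ball_sup r v x"] mm[of "ball_sup r (\<lambda>y. - u y) x" "ball_sup r (\<lambda>y. - v y) x"]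
    by linarith
qed

lemma ball_sup_min_const:
  assumes u: "tame u" and r: "0 < r"
  shows "ball_sup r (\<lambda>y. min (u y) k) x = min (ball_sup r u x) k"
proof (rule antisym)
  show "ball_sup r (\<lambda>y. min (u y) k) x \<le> min (ball_sup r u x) k"
    using assms by (intro ball_sup_least min.mono) (auto intro: ball_sup_upper)
  show "min (ball_sup r u x) k \<le> ball_sup r (\<lambda>y. min (u y) k) x"
  proof (rule ccontr)
    assume "\<not> ?thesis"
    then have l: "ball_sup r (\<lambda>y. min (u y) k) x < ball_sup r u x" "ball_sup r (\<lambda>y. min (u y) k) x < k" by auto
    from l(1) obtain y where y: "y \<in> ball x r" "ball_sup r (\<lambda>y. min (u y) k) x < u y"
      using ball_sup_less[OF u r] by blast
    have "min (u y) k \<le> ball_sup r (\<lambda>y. min (u y) k) x"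
      using y by (intro ball_sup_upper[of "\<lambda>y. min (u y) k"] tame_intros u)
    with y l show False by (auto simp: min_def split: if_splits)
  qed
qed

lemma ball_sup_max_const:
  assumes u: "tame u" and r: "0 < r"
  shows "ball_sup r (\<lambda>y. max (u y) k) x = max (ball_sup r u x) k"
proof -
  have "ball_sup r (\<lambda>y. k) x = k" using r by (simp add: ball_sup_def)
  then show ?thesis using ball_sup_max[OF u tame_const r, of k x] by simp
qed

text \<open>Cutting \<open>u\<close> at height \<open>k\<close> splits its range on each ball into the part below and the part above \<open>k\<close>, and
  the lengths of the two parts add up.\<close>
lemma osc_coarea:
  assumes u: "tame u" and r: "0 < r"
  shows "osc r u x = osc r (\<lambda>y. min (u y) k) x + osc r (\<lambda>y. max (u y - k) 0) x"
proof -
  have "ball_sup r (\<lambda>y. max (u y - k) 0) x = max (ball_sup r u x - k) 0"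
    using ball_sup_max_const[OF tame_add[OF u tame_const] r, of "-k" 0 x] ball_sup_add_const[OF u r, of "-k" x] by simp
  moreover have "ball_sup r (\<lambda>y. - min (u y) k) x = max (ball_sup r (\<lambda>y. - u y) x) (- k)"
  proof -
    have "(\<lambda>y. - min (u y) k) = (\<lambda>y. max (- u y) (- k))" by auto
    then show ?thesis using ball_sup_max_const[OF tame_minus[OF u] r, of "-k" x] by simp
  qed
  moreover have "ball_sup r (\<lambda>y. - max (u y - k) 0) x = min (ball_sup r (\<lambda>y. - u y) x + k) 0"
  proof -
    have "(\<lambda>y. - max (u y - k) 0) = (\<lambda>y. min (- u y + k) 0)" by auto
    then show ?thesis
      using ball_sup_min_const[OF tame_add[OF tame_minus[OF u] tame_const] r, of k 0 x]
        ball_sup_add_const[OF tame_minus[OF u] r, of k x] by simp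
  qed
  ultimately show ?thesis
    unfolding osc_def ball_sup_min_const[OF u r] by (simp add: min_def max_def)
qed

lemma osc_inner_le:
  fixes w :: "real^'n"
  assumes w: "norm w = 1" and r: "0 < r"
  shows "osc r (\<lambda>y. w \<bullet> y) x \<le> 2 * r"
proof -
  have "w \<bullet> x - r \<le> w \<bullet> y \<and> w \<bullet> y \<le> w \<bullet> x + r" if "y \<in> ball x r" for y
  proof -
    have "\<bar>w \<bullet> (y - x)\<bar> \<le> norm w * norm (y - x)" by (rule Cauchy_Schwarz_ineq2)
    with that w show ?thesis by (simp add: inner_diff_right dist_norm norm_minus_commute abs_le_iff)
  qed
  from osc_le[OF r this] show ?thesis by simp
qed


section \<open>Integration over the unit cell\<close>

definition cell :: "(real^'n) set" where "cell = {x. \<forall>i. 0 \<le> x $ i \<and> x $ i < 1}"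

definition int_part :: "real^'n \<Rightarrow> real^'n" where "int_part x = (\<chi> i. of_int \<lfloor>x $ i\<rfloor>)"

lemma int_vecs_add: "j \<in> int_vecs \<Longrightarrow> k \<in> int_vecs \<Longrightarrow> j + k \<in> int_vecs"
  by (simp add: int_vecs_def)

lemma int_vecs_minus: "k \<in> int_vecs \<Longrightarrow> - k \<in> int_vecs"
  by (simp add: int_vecs_def)

lemma int_part_int_vecs: "int_part x \<in> int_vecs"
  by (simp add: int_part_def int_vecs_def)

lemma diff_in_cell_iff:
  assumes "k \<in> int_vecs" shows "x - k \<in> cell \<longleftrightarrow> k = int_part x"
proof -
  have "0 \<le> x $ i - k $ i \<and> x $ i - k $ i < 1 \<longleftrightarrow> k $ i = of_int \<lfloor>x $ i\<rfloor>" for i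
  proof -
    obtain z where z: "k $ i = of_int z" using assms by (auto simp: int_vecs_def elim: Ints_cases)
    have "0 \<le> x $ i - of_int z \<and> x $ i - of_int z < 1 \<longleftrightarrow> \<lfloor>x $ i\<rfloor> = z"
      by (auto simp: floor_eq_iff)
    then show ?thesis using z by auto
  qed
  then show ?thesis by (simp add: cell_def int_part_def vec_eq_iff)
qed

lemma norm_less_box:
  fixes x :: "real^'n"
  assumes "\<And>i. 0 \<le> x $ i" "\<And>i. x $ i < l"
  shows "norm x < real CARD('n) * l"
proof -
  have "norm x \<le> (\<Sum>i\<in>UNIV. \<bar>x $ i\<bar>)" by (rule norm_le_l1_cart)
  also have "\<dots> < (\<Sum>i\<in>(UNIV::'n set). l)" using assms by (intro sum_strict_mono) auto
  finally show ?thesis by simp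
qed

lemma norm_cell: "x \<in> cell \<Longrightarrow> norm (x::real^'n) \<le> real CARD('n)"
  using norm_less_box[of x 1] by (auto simp: cell_def)

lemma norm_int_part: "norm (int_part x) \<le> norm x + real CARD('n)" for x :: "real^'n"
proof -
  have "x - int_part x \<in> cell" by (simp add: diff_in_cell_iff int_part_int_vecs)
  from norm_cell[OF this] norm_triangle_ineq4[of x "x - int_part x"] show ?thesis by simp
qed

lemma half_open_cube_borel: "{x::real^'n. \<forall>i. 0 \<le> x $ i \<and> x $ i < l} \<in> sets borel"
proof -
  have "{x::real^'n. \<forall>i. 0 \<le> x $ i \<and> x $ i < l} = (\<Inter>i. {x. 0 \<le> x $ i} \<inter> {x. x $ i < l})" by auto
  also have "\<dots> \<in> sets borel" by (intro sets.finite_INT) (auto intro!: sets.Int)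
  finally show ?thesis .
qed

lemma cell_borel [measurable]: "(cell :: (real^'n) set) \<in> sets borel"
  unfolding cell_def by (rule half_open_cube_borel)

lemma bounded_cell: "bounded cell"
  unfolding bounded_iff using norm_cell by blast

lemma finite_int_vecs: "finite (int_vecs \<inter> cball 0 R :: (real^'n) set)"
proof -
  let ?Z = "(of_int ` {-\<lceil>R\<rceil>..\<lceil>R\<rceil>}) :: real set"
  have "int_vecs \<inter> cball 0 R \<subseteq> vec_lambda ` (PiE (UNIV::'n set) (\<lambda>_. ?Z))"
  proof
    fix x :: "real^'n" assume x: "x \<in> int_vecs \<inter> cball 0 R"
    have "x $ i \<in> ?Z" for i
    proof -
      obtain z where z: "x $ i = of_int z" using x by (auto simp: int_vecs_def elim: Ints_cases)
      have "\<bar>x $ i\<bar> \<le> R" using x component_le_norm_cart[of x i] by auto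
      then have "\<bar>z\<bar> \<le> \<lceil>R\<rceil>" using z by linarith
      then have "z \<in> {-\<lceil>R\<rceil>..\<lceil>R\<rceil>}" by (auto simp: abs_le_iff)
      then show ?thesis unfolding z by (rule imageI)
    qed
    then show "x \<in> vec_lambda ` (PiE (UNIV::'n set) (\<lambda>_. ?Z))"
      by (intro image_eqI[of _ _ "\<lambda>i. x $ i"]) auto
  qed
  moreover have "finite (vec_lambda ` (PiE (UNIV::'n set) (\<lambda>_. ?Z)) :: (real^'n) set)"
    by (intro finite_imageI finite_PiE) auto
  ultimately show ?thesis by (rule finite_subset)
qed

lemma emeasure_half_open_cube:
  assumes "0 \<le> l"
  shows "emeasure lborel {x::real^'n. \<forall>i. 0 \<le> x $ i \<and> x $ i < l} = ennreal (l ^ CARD('n))"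
proof (rule antisym)
  let ?a = "0 :: real^'n" and ?b = "(\<chi> i. l) :: real^'n"
  let ?C = "{x::real^'n. \<forall>i. 0 \<le> x $ i \<and> x $ i < l}"
  have C: "?C \<in> sets borel" by (rule half_open_cube_borel)
  have m: "measure lborel (cbox ?a ?b) = l ^ CARD('n)"
    using assms by (subst content_cbox_cart) (auto simp: interval_ne_empty_cart)
  have "emeasure lborel ?C \<le> emeasure lborel (cbox ?a ?b)"
    using C by (intro emeasure_mono) (auto simp: mem_box_cart less_imp_le)
  also have "\<dots> = ennreal (l ^ CARD('n))"
    using m emeasure_lborel_cbox_finite[of ?a ?b] by (subst emeasure_eq_ennreal_measure) auto
  finally show "emeasure lborel ?C \<le> ennreal (l ^ CARD('n))" .
  have "measure lborel (box ?a ?b) = l ^ CARD('n)"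
    using m measure_lborel_cbox_eq[of ?a ?b] measure_lborel_box_eq[of ?a ?b] by (simp add: content_def)
  then have "ennreal (l ^ CARD('n)) = emeasure lborel (box ?a ?b)"
    using emeasure_lborel_box_finite[of ?a ?b] by (subst emeasure_eq_ennreal_measure) auto
  also have "\<dots> \<le> emeasure lborel ?C"
    using C by (intro emeasure_mono) (auto simp: mem_box_cart less_imp_le)
  finally show "ennreal (l ^ CARD('n)) \<le> emeasure lborel ?C" .
qed

lemma emeasure_cell: "emeasure lborel (cell :: (real^'n) set) = 1"
  using emeasure_half_open_cube[of 1] by (simp add: cell_def)

lemma integrable_tame:
  assumes f: "tame f" and A: "A \<in> sets borel" "bounded A"
  shows "set_integrable lborel A f"
proof -
  obtain R where R: "\<forall>x\<in>A. norm x \<le> R" using A(2) by (auto simp: bounded_iff)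
  obtain C where C: "\<forall>x. norm x \<le> R \<longrightarrow> \<bar>f x\<bar> \<le> C" using tame_bound[OF f] by blast
  show ?thesis unfolding set_integrable_def
    using A R C tame_borel[OF f] emeasure_bounded_finite[OF A(2)]
    by (intro integrableI_bounded_set_indicator[where B=C]) auto
qed

definition cell_int :: "(real^'n \<Rightarrow> real) \<Rightarrow> real" where
  "cell_int f = set_lebesgue_integral lborel cell f"

lemma cell_integrable: "tame f \<Longrightarrow> set_integrable lborel cell f"
  by (rule integrable_tame[OF _ cell_borel bounded_cell])

lemma cell_int_add: "tame f \<Longrightarrow> tame g \<Longrightarrow> cell_int (\<lambda>x. f x + g x) = cell_int f + cell_int g"
  unfolding cell_int_def by (rule set_integral_add) (auto intro: cell_integrable)

lemma cell_int_diff: "tame f \<Longrightarrow> tame g \<Longrightarrow> cell_int (\<lambda>x. f x - g x) = cell_int f - cell_int g"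
  unfolding cell_int_def by (rule set_integral_diff) (auto intro: cell_integrable)

lemma cell_int_cmult: "cell_int (\<lambda>x. c * f x) = c * cell_int f"
  unfolding cell_int_def by simp

lemma cell_int_mono: "tame f \<Longrightarrow> tame g \<Longrightarrow> (\<And>x. x \<in> cell \<Longrightarrow> f x \<le> g x) \<Longrightarrow> cell_int f \<le> cell_int g"
  unfolding cell_int_def by (rule set_integral_mono) (auto intro: cell_integrable)

lemma cell_int_const: "cell_int (\<lambda>x::real^'n. c) = c"
proof -
  have "measure lborel (cell :: (real^'n) set) = 1" using emeasure_cell by (simp add: measure_def)
  moreover have "emeasure lborel (cell :: (real^'n) set) \<noteq> \<infinity>" by (simp add: emeasure_cell)
  ultimately show ?thesis unfolding cell_int_def by (subst set_integral_const) auto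
qed

lemma cell_int_sum: "finite A \<Longrightarrow> (\<And>k. k \<in> A \<Longrightarrow> tame (f k)) \<Longrightarrow> cell_int (\<lambda>x. \<Sum>k\<in>A. f k x) = (\<Sum>k\<in>A. cell_int (f k))"
proof (induction A rule: finite_induct)
  case empty then show ?case by (simp add: cell_int_const)
next
  case (insert k A) then show ?case by (simp add: cell_int_add tame_sum)
qed

lemma cell_int_cong: "(\<And>x. x \<in> cell \<Longrightarrow> f x = g x) \<Longrightarrow> cell_int f = cell_int g"
  unfolding cell_int_def set_lebesgue_integral_def by (rule Bochner_Integration.integral_cong) (auto simp: indicator_def)

lemma cell_int_nonneg: "(\<And>x. x \<in> cell \<Longrightarrow> 0 \<le> f x) \<Longrightarrow> 0 \<le> cell_int f"
  unfolding cell_int_def set_lebesgue_integral_def by (rule Bochner_Integration.integral_nonneg) (auto simp: indicator_def)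

lemma lborel_integral_shift:
  fixes f :: "real^'n \<Rightarrow> real"
  assumes "f \<in> borel_measurable borel"
  shows "(\<integral>x. f (x + h) \<partial>lborel) = (\<integral>x. f x \<partial>lborel)"
proof -
  have "(\<integral>x. f x \<partial>lborel) = (\<integral>x. f x \<partial>distr lborel borel ((+) h))"
    by (simp add: lborel_distr_plus)
  also have "\<dots> = (\<integral>x. f (h + x) \<partial>lborel)"
    using assms by (intro integral_distr) auto
  finally show ?thesis by (simp add: add.commute)
qed

lemma translate_cell_eq: "(\<lambda>x. x + k) ` cell = (\<lambda>x. x - k) -` cell"
  by (auto simp: image_iff) (metis diff_add_cancel)

text \<open>Every point has exactly one representative in the half-open unit cell, so the translates of the cell
  by integer vectors tile the space.\<close>
lemma integral_unfold_cells:
  fixes \<psi> :: "real^'n \<Rightarrow> real"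
  assumes \<psi>: "tame \<psi>" and S: "finite S" "S \<subseteq> int_vecs" and supp: "\<And>x. \<psi> x \<noteq> 0 \<Longrightarrow> int_part x \<in> S"
  shows "(\<integral>x. \<psi> x \<partial>lborel) = (\<Sum>k\<in>S. cell_int (\<lambda>x. \<psi> (x + k)))"
proof -
  have "\<psi> x = (\<Sum>k\<in>S. indicator cell (x - k) * \<psi> x)" for x
  proof (cases "\<psi> x = 0")
    case False
    have "(\<Sum>k\<in>S. indicator cell (x - k) * \<psi> x) = (\<Sum>k\<in>S. if k = int_part x then \<psi> x else 0)"
      using S by (intro sum.cong) (auto simp: diff_in_cell_iff indicator_def)
    then show ?thesis using S supp[OF False] by simp
  qed simp
  then have "(\<integral>x. \<psi> x \<partial>lborel) = (\<integral>x. (\<Sum>k\<in>S. indicator cell (x - k) * \<psi> x) \<partial>lborel)"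
    by presburger
  also have "\<dots> = (\<Sum>k\<in>S. (\<integral>x. indicator cell (x - k) * \<psi> x \<partial>lborel))"
  proof (rule Bochner_Integration.integral_sum)
    fix k
    have eq: "(\<lambda>x. indicator cell (x - k) * \<psi> x) = (\<lambda>x. indicator ((\<lambda>x. x + k) ` cell) x *\<^sub>R \<psi> x)"
      unfolding translate_cell_eq by (auto simp: indicator_def)
    have "set_integrable lborel ((\<lambda>x. x + k) ` cell) \<psi>"
    proof (rule integrable_tame[OF \<psi>])
      show "(\<lambda>x. x + k) ` cell \<in> sets borel"
        unfolding translate_cell_eq using measurable_sets_borel[of "\<lambda>x. x - k" borel cell] by simp
      show "bounded ((\<lambda>x. x + k) ` cell)"
        using bounded_translation[OF bounded_cell, of k] by (simp add: add.commute)
    qed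
    then show "integrable lborel (\<lambda>x. indicator cell (x - k) * \<psi> x)"
      unfolding eq set_integrable_def .
  qed
  also have "\<dots> = (\<Sum>k\<in>S. cell_int (\<lambda>x. \<psi> (x + k)))"
  proof (rule sum.cong[OF refl])
    fix k
    have "(\<integral>x. indicator cell (x - k) * \<psi> x \<partial>lborel) = (\<integral>x. indicator cell (x + k - k) * \<psi> (x + k) \<partial>lborel)"
      using tame_borel[OF \<psi>] by (intro lborel_integral_shift[symmetric]) measurable
    then show "(\<integral>x. indicator cell (x - k) * \<psi> x \<partial>lborel) = cell_int (\<lambda>x. \<psi> (x + k))"
      by (simp add: cell_int_def set_lebesgue_integral_def)
  qed
  finally show ?thesis .
qed

lemma int_periodic_add: "int_periodic f \<Longrightarrow> k \<in> int_vecs \<Longrightarrow> f (x + k) = f x"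
  by (simp add: int_periodic_def)

text \<open>Unfold the integral over the translated cell into the tiles: for each \<open>x\<close> in the cell exactly one
  integer translate of \<open>x\<close> lies in the translated cell.\<close>
lemma cell_int_shift:
  fixes f :: "real^'n \<Rightarrow> real"
  assumes f: "tame f" "int_periodic f"
  shows "cell_int (\<lambda>x. f (x + h)) = cell_int f"
proof -
  define n where "n = real CARD('n)"
  define S where "S = int_vecs \<inter> cball (0::real^'n) (2 * n + norm h)"
  have S: "finite S" "S \<subseteq> int_vecs" by (auto simp: S_def finite_int_vecs)
  let ?\<psi> = "\<lambda>x. indicator cell (x - h) * f x"
  have c: "tame (\<lambda>x. indicator cell (x - h))"
    using tame_shift[OF tame_indicator[OF cell_borel], of "- h"] by simp
  have "(\<integral>x. ?\<psi> x \<partial>lborel) = (\<Sum>k\<in>S. cell_int (\<lambda>x. ?\<psi> (x + k)))"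
  proof (rule integral_unfold_cells[OF _ S])
    show "tame ?\<psi>" by (intro tame_mult c f)
    fix x assume "?\<psi> x \<noteq> 0"
    then have "x - h \<in> cell" by (auto simp: indicator_def split: if_splits)
    then have "norm (x - h) \<le> n" by (simp add: n_def norm_cell)
    moreover have "norm x \<le> norm (x - h) + norm h" using norm_triangle_ineq[of "x - h" h] by simp
    ultimately show "int_part x \<in> S"
      using norm_int_part[of x] by (auto simp: S_def n_def int_part_int_vecs)
  qed
  also have "\<dots> = (\<Sum>k\<in>S. cell_int (\<lambda>x. indicator cell (x + k - h) * f x))"
    using f(2) S by (intro sum.cong cell_int_cong) (auto simp: int_periodic_def)
  also have "\<dots> = cell_int (\<lambda>x. \<Sum>k\<in>S. indicator cell (x + k - h) * f x)"
  proof (rule cell_int_sum[symmetric, OF S(1)])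
    fix k show "tame (\<lambda>x. indicator cell (x + k - h) * f x)"
      using tame_shift[OF tame_indicator[OF cell_borel], of "k - h"] f by (auto intro!: tame_mult simp: algebra_simps)
  qed
  also have "\<dots> = cell_int f"
  proof (rule cell_int_cong)
    fix x :: "real^'n" assume x: "x \<in> cell"
    let ?k = "- int_part (x - h)"
    have "norm (x - h) \<le> n + norm h" using norm_cell[OF x] norm_triangle_ineq4[of x h] by (simp add: n_def)
    then have k: "?k \<in> S"
      using norm_int_part[of "x - h"] int_vecs_minus[OF int_part_int_vecs[of "x - h"]] by (simp add: S_def n_def)
    have "indicator cell (x + k - h) = (if k = ?k then 1 else 0 :: real)" if "k \<in> S" for k
    proof -
      have e: "x + k - h = (x - h) - (- k)" by simp
      have "(x - h) - (- k) \<in> cell \<longleftrightarrow> - k = int_part (x - h)"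
        using that S int_vecs_minus by (intro diff_in_cell_iff) auto
      moreover have "- k = int_part (x - h) \<longleftrightarrow> k = ?k" by (metis minus_minus)
      ultimately show ?thesis unfolding e indicator_def by simp
    qed
    then have "(\<Sum>k\<in>S. indicator cell (x + k - h) * f x) = (\<Sum>k\<in>S. if k = ?k then f x else 0)"
      by (intro sum.cong) auto
    then show "(\<Sum>k\<in>S. indicator cell (x + k - h) * f x) = f x" using S k by simp
  qed
  finally have "(\<integral>x. ?\<psi> x \<partial>lborel) = cell_int f" .
  moreover have "(\<integral>x. ?\<psi> x \<partial>lborel) = (\<integral>x. ?\<psi> (x + h) \<partial>lborel)"
    using tame_borel[OF f(1)] by (intro lborel_integral_shift[symmetric]) measurable
  ultimately show ?thesis by (simp add: cell_int_def set_lebesgue_integral_def)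
qed


section \<open>A Poincare inequality for functions with small support\<close>

lemma int_periodic_osc:
  fixes u :: "real^'n \<Rightarrow> real"
  assumes "int_periodic u" shows "int_periodic (osc r u)"
  unfolding int_periodic_def
proof (intro allI ballI)
  fix x k :: "real^'n" assume "k \<in> int_vecs"
  then have "(\<lambda>y. u (y + k)) = u" using assms by (auto simp: int_periodic_def)
  then show "osc r u (x + k) = osc r u x" using osc_shift[of r u k x] by simp
qed

text \<open>Walk from \<open>x\<close> to \<open>x + h\<close> in \<open>m\<close> steps of length less than \<open>r\<close>.  Each increment is bounded by the
  oscillation on a ball of radius \<open>r\<close>, whose integral does not depend on the starting point.\<close>
lemma cell_int_increment_le:
  fixes w :: "real^'n \<Rightarrow> real"
  assumes w: "tame w" "int_periodic w" and r: "0 < r" and m: "0 < m" and h: "norm h < real m * r"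
  shows "cell_int (\<lambda>x. \<bar>w x - w (x + h)\<bar>) \<le> real m * cell_int (osc r w)"
proof -
  let ?h = "\<lambda>j::nat. (real j / real m) *\<^sub>R h"
  have step: "\<bar>w (x + ?h j) - w (x + ?h (Suc j))\<bar> \<le> osc r w (x + ?h j)" for x j
  proof -
    have "?h (Suc j) = ?h j + (1 / real m) *\<^sub>R h" by (simp add: add_divide_distrib flip: scaleR_add_left)
    then have "dist (x + ?h j) (x + ?h (Suc j)) = norm h / real m" by (simp add: dist_norm)
    also have "\<dots> < r" using h m by (simp add: field_simps)
    finally have "x + ?h (Suc j) \<in> ball (x + ?h j) r" by simp
    moreover have "x + ?h j \<in> ball (x + ?h j) r" using r by simp
    ultimately show ?thesis using osc_ge[OF w(1), of _ "x + ?h j" r] by (auto simp: abs_le_iff)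
  qed
  have "\<bar>w x - w (x + h)\<bar> \<le> (\<Sum>j<m. osc r w (x + ?h j))" for x
  proof -
    have "w x - w (x + h) = (\<Sum>j<m. w (x + ?h j) - w (x + ?h (Suc j)))"
      using m by (subst sum_lessThan_telescope') simp
    also have "\<bar>\<dots>\<bar> \<le> (\<Sum>j<m. \<bar>w (x + ?h j) - w (x + ?h (Suc j))\<bar>)" by (rule sum_abs)
    also have "\<dots> \<le> (\<Sum>j<m. osc r w (x + ?h j))" by (intro sum_mono step)
    finally show ?thesis .
  qed
  then have "cell_int (\<lambda>x. \<bar>w x - w (x + h)\<bar>) \<le> cell_int (\<lambda>x. \<Sum>j<m. osc r w (x + ?h j))"
    by (intro cell_int_mono tame_intros tame_sum tame_shift tame_osc w r) auto
  also have "\<dots> = (\<Sum>j<m. cell_int (\<lambda>x. osc r w (x + ?h j)))"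
    by (intro cell_int_sum tame_shift tame_osc w r) auto
  also have "\<dots> = (\<Sum>j<m. cell_int (osc r w))"
    by (intro sum.cong refl cell_int_shift tame_osc int_periodic_osc w r)
  finally show ?thesis by simp
qed

lemma nn_integral_cell:
  assumes "tame f" "\<And>x. 0 \<le> f x"
  shows "(\<integral>\<^sup>+x. ennreal (indicator cell x * f x) \<partial>lborel) = ennreal (cell_int f)"
proof -
  have "integrable lborel (\<lambda>x. indicator cell x * f x)"
    using cell_integrable[OF assms(1)] by (simp add: set_integrable_def)
  then show ?thesis
    unfolding cell_int_def set_lebesgue_integral_def using assms(2)
    by (subst nn_integral_eq_integral) auto
qed

lemma emeasure_cell_Int: 
  assumes "A \<in> sets borel"
  shows "emeasure lborel (cell \<inter> A) = ennreal (cell_int (indicator A))"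
proof -
  have "emeasure lborel (cell \<inter> A) = (\<integral>\<^sup>+x. indicator (cell \<inter> A) x \<partial>lborel)"
    using assms by (intro nn_integral_indicator[symmetric]) auto
  also have "\<dots> = (\<integral>\<^sup>+x. ennreal (indicator cell x * indicator A x) \<partial>lborel)"
    by (intro nn_integral_cong) (auto simp: indicator_def)
  also have "\<dots> = ennreal (cell_int (indicator A))"
    by (rule nn_integral_cell) (auto intro: tame_indicator assms)
  finally show ?thesis .
qed

text \<open>Within any translate of the cell, the support of \<open>w\<close> has at most half the measure of a cube of side
  \<open>l\<close>.  Hence, for each \<open>x\<close>, at least half of the
  displacements \<open>h\<close> in the cube \<open>C\<close> lead to a zero of \<open>w\<close>, where the increment equals \<open>w x\<close>.  Averaging
  \<open>cell_int_increment_le\<close> over \<open>h \<in> C\<close> gives the claim.\<close>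
lemma poincare_small_support:
  fixes w :: "real^'n \<Rightarrow> real"
  assumes w: "tame w" "int_periodic w" "\<And>x. 0 \<le> w x" and r: "0 < r" and l: "0 < l" "l \<le> 1"
    and m: "0 < m" "real CARD('n) * l \<le> real m * r"
    and supp: "2 * cell_int (indicator {x. 0 < w x}) \<le> l ^ CARD('n)"
  shows "cell_int w \<le> 2 * real m * cell_int (osc r w)"
proof -
  define C where "C = {x::real^'n. \<forall>i. 0 \<le> x $ i \<and> x $ i < l}"
  define L where "L = l ^ CARD('n)"
  have L: "0 < L" using l by (simp add: L_def)
  have Cb: "C \<in> sets borel" unfolding C_def by (rule half_open_cube_borel)
  have eC: "emeasure lborel C = ennreal L"
    unfolding C_def L_def by (rule emeasure_half_open_cube) (use l in simp)
  have [measurable]: "w \<in> borel_measurable borel" using w(1) by (rule tame_borel)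
  note [measurable] = Cb
  let ?P = "{x. 0 < w x}"
  have Pb [measurable]: "?P \<in> sets borel" by measurable
  have free: "ennreal (L / 2) \<le> emeasure lborel {h \<in> C. w (x + h) = 0}" for x
  proof -
    have "emeasure lborel {h \<in> C. 0 < w (x + h)} \<le> emeasure lborel (cell \<inter> {h. 0 < w (x + h)})"
      by (intro emeasure_mono) (use l in \<open>auto simp: C_def cell_def intro: less_le_trans\<close>)
    also have "\<dots> = ennreal (cell_int (indicator {h. 0 < w (x + h)}))"
      by (intro emeasure_cell_Int) measurable
    also have "cell_int (indicator {h. 0 < w (x + h)}) = cell_int (\<lambda>h. indicator ?P (h + x))"
      by (intro cell_int_cong) (auto simp: indicator_def add.commute)
    also have "\<dots> = cell_int (indicator ?P)"
      using w(2) by (intro cell_int_shift tame_indicator Pb) (auto simp: int_periodic_def indicator_def)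
    also have "ennreal \<dots> \<le> ennreal (L / 2)" using supp by (intro ennreal_leI) (simp add: L_def)
    finally have 1: "emeasure lborel {h \<in> C. 0 < w (x + h)} \<le> ennreal (L / 2)" .
    have eq: "{h \<in> C. w (x + h) = 0} = C - {h \<in> C. 0 < w (x + h)}"
      using w(3) by (auto simp: order.order_iff_strict)
    have "emeasure lborel {h \<in> C. w (x + h) = 0} = ennreal L - emeasure lborel {h \<in> C. 0 < w (x + h)}"
      unfolding eq eC[symmetric] using 1 by (intro emeasure_Diff) (auto simp: top_unique)
    also have "\<dots> \<ge> ennreal L - ennreal (L / 2)" using 1 by (rule ennreal_minus_mono[OF order_refl])
    also have "ennreal L - ennreal (L / 2) = ennreal (L / 2)" using L by (subst ennreal_minus) auto
    finally show ?thesis .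
  qed
  have "ennreal (L / 2) * ennreal (cell_int w) = (\<integral>\<^sup>+x. ennreal (L / 2) * ennreal (indicator cell x * w x) \<partial>lborel)"
    by (subst nn_integral_cmult) (auto simp: nn_integral_cell w)
  also have "\<dots> \<le> (\<integral>\<^sup>+x. (\<integral>\<^sup>+h. indicator C h * ennreal (indicator cell x * \<bar>w x - w (x + h)\<bar>) \<partial>lborel) \<partial>lborel)"
  proof (rule nn_integral_mono)
    fix x :: "real^'n"
    have "ennreal (L / 2) * ennreal (indicator cell x * w x)
        \<le> emeasure lborel {h \<in> C. w (x + h) = 0} * ennreal (indicator cell x * w x)"
      by (intro mult_right_mono free) auto
    also have "\<dots> = (\<integral>\<^sup>+h. ennreal (indicator cell x * w x) * indicator {h \<in> C. w (x + h) = 0} h \<partial>lborel)"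
      by (subst nn_integral_cmult_indicator) (auto simp: mult.commute)
    also have "\<dots> \<le> (\<integral>\<^sup>+h. indicator C h * ennreal (indicator cell x * \<bar>w x - w (x + h)\<bar>) \<partial>lborel)"
      using w(3) by (intro nn_integral_mono) (auto simp: indicator_def)
    finally show "ennreal (L / 2) * ennreal (indicator cell x * w x)
        \<le> (\<integral>\<^sup>+h. indicator C h * ennreal (indicator cell x * \<bar>w x - w (x + h)\<bar>) \<partial>lborel)" .
  qed
  also have "\<dots> = (\<integral>\<^sup>+h. (\<integral>\<^sup>+x. indicator C h * ennreal (indicator cell x * \<bar>w x - w (x + h)\<bar>) \<partial>lborel) \<partial>lborel)"
    by (rule lborel_pair.Fubini') measurable
  also have "\<dots> \<le> (\<integral>\<^sup>+h. ennreal (real m * cell_int (osc r w)) * indicator C h \<partial>lborel)"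
  proof (rule nn_integral_mono)
    fix h :: "real^'n"
    have "(\<integral>\<^sup>+x. indicator C h * ennreal (indicator cell x * \<bar>w x - w (x + h)\<bar>) \<partial>lborel)
        = indicator C h * ennreal (cell_int (\<lambda>x. \<bar>w x - w (x + h)\<bar>))"
      by (subst nn_integral_cmult)
        (auto intro!: arg_cong2[where f="(*)"] nn_integral_cell tame_intros tame_shift w)
    also have "\<dots> \<le> ennreal (real m * cell_int (osc r w)) * indicator C h"
    proof (cases "h \<in> C")
      case True
      then have "norm h < real CARD('n) * l" by (intro norm_less_box) (auto simp: C_def)
      then have "cell_int (\<lambda>x. \<bar>w x - w (x + h)\<bar>) \<le> real m * cell_int (osc r w)"
        using m by (intro cell_int_increment_le w r) auto
      then show ?thesis using True by (simp add: ennreal_leI)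
    qed simp
    finally show "(\<integral>\<^sup>+x. indicator C h * ennreal (indicator cell x * \<bar>w x - w (x + h)\<bar>) \<partial>lborel)
        \<le> ennreal (real m * cell_int (osc r w)) * indicator C h" .
  qed
  also have "\<dots> = ennreal (real m * cell_int (osc r w)) * ennreal L"
    using eC by (subst nn_integral_cmult_indicator) auto
  finally have "ennreal (L / 2) * ennreal (cell_int w) \<le> ennreal (real m * cell_int (osc r w)) * ennreal L" .
  moreover have "ennreal (L / 2) * ennreal (cell_int w) = ennreal (L / 2 * cell_int w)"
    using L by (intro ennreal_mult'[symmetric]) simp
  moreover have "ennreal (real m * cell_int (osc r w)) * ennreal L = ennreal (real m * cell_int (osc r w) * L)"
    using L by (intro ennreal_mult''[symmetric]) simp
  ultimately have "ennreal (L / 2 * cell_int w) \<le> ennreal (real m * cell_int (osc r w) * L)" by simp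
  then have "L / 2 * cell_int w \<le> real m * cell_int (osc r w) * L"
    using L cell_int_nonneg[of "osc r w"] osc_nonneg[OF w(1) r] by (subst (asm) ennreal_le_iff) auto
  then show ?thesis using L by (simp add: field_simps)
qed


section \<open>The cell problem\<close>

lemma cell_int_dominated_convergence:
  fixes f :: "nat \<Rightarrow> real^'n \<Rightarrow> real"
  assumes "\<And>j. tame (f j)" "tame f'" "tame h" "\<And>x. (\<lambda>j. f j x) \<longlonglongrightarrow> f' x" "\<And>j x. \<bar>f j x\<bar> \<le> h x"
  shows "(\<lambda>j. cell_int (f j)) \<longlonglongrightarrow> cell_int f'"
  unfolding cell_int_def set_lebesgue_integral_def
proof (rule integral_dominated_convergence[where w="\<lambda>x. indicator cell x *\<^sub>R h x"])
  show "integrable lborel (\<lambda>x. indicator cell x *\<^sub>R h x)"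
    using cell_integrable[OF assms(3)] by (simp add: set_integrable_def)
  show "(\<lambda>x. indicator cell x *\<^sub>R f' x) \<in> borel_measurable lborel"
    "\<And>i. (\<lambda>x. indicator cell x *\<^sub>R f i x) \<in> borel_measurable lborel"
    using assms(1,2)[THEN tame_borel] by measurable
  show "AE x in lborel. (\<lambda>i. indicator cell x *\<^sub>R f i x) \<longlonglongrightarrow> indicator cell x *\<^sub>R f' x"
    using assms(4) by (auto intro!: tendsto_intros)
  show "\<And>i. AE x in lborel. norm (indicator cell x *\<^sub>R f i x) \<le> indicator cell x *\<^sub>R h x"
    using assms(5) by (auto simp: indicator_def)
qed

definition cell_energy :: "real \<Rightarrow> (real^'n \<Rightarrow> real) \<Rightarrow> real^'n \<Rightarrow> (real^'n \<Rightarrow> real) \<Rightarrow> real" where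
  "cell_energy r g \<omega> v = cell_int (osc r (\<lambda>x. v x - \<omega> \<bullet> x)) / (2 * r) + cell_int (\<lambda>x. g x * v x)"

text \<open>The bound \<open>L\<close> makes the class stable under countable infima and suprema.  It is removed later,
  since the minimizer turns out to stay away from it.\<close>
definition admissible :: "real \<Rightarrow> (real^'n \<Rightarrow> real) \<Rightarrow> bool" where
  "admissible L v \<longleftrightarrow> tame v \<and> int_periodic v \<and> (\<forall>x. \<bar>v x\<bar> \<le> L)"

text \<open>Upper bounds for minimizers turn into lower bounds through this symmetry, and likewise decreasing
  limits turn into increasing ones.\<close>
lemma cell_energy_minus: "cell_energy r (\<lambda>x. - g x) (- \<omega>) (\<lambda>x. - v x) = cell_energy r g \<omega> v"
  using osc_minus[of r "\<lambda>x. v x - \<omega> \<bullet> x"] by (simp add: cell_energy_def fun_eq_iff[symmetric] cong: cell_int_cong)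

lemma admissible_minus: "admissible L v \<Longrightarrow> admissible L (\<lambda>x. - v x)"
  by (auto simp: admissible_def int_periodic_def intro: tame_minus)

lemma admissible_min: "admissible L v \<Longrightarrow> admissible L w \<Longrightarrow> admissible L (\<lambda>x. min (v x) (w x))"
  by (auto simp: admissible_def int_periodic_def min_def intro: tame_min[unfolded min_def])

lemma admissible_max: "admissible L v \<Longrightarrow> admissible L w \<Longrightarrow> admissible L (\<lambda>x. max (v x) (w x))"
  by (auto simp: admissible_def int_periodic_def max_def intro: tame_max[unfolded max_def])

lemma cell_energy_submodular:
  assumes g: "tame g" and v: "tame v" and w: "tame w" and r: "0 < r"
  shows "cell_energy r g \<omega> (\<lambda>x. min (v x) (w x)) + cell_energy r g \<omega> (\<lambda>x. max (v x) (w x))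
    \<le> cell_energy r g \<omega> v + cell_energy r g \<omega> w"
proof -
  let ?p = "\<lambda>v x. v x - \<omega> \<bullet> x"
  have p: "tame (?p v)" "tame (?p w)" by (intro tame_intros v w)+
  have mm: "?p (\<lambda>x. min (v x) (w x)) = (\<lambda>x. min (?p v x) (?p w x))"
    "?p (\<lambda>x. max (v x) (w x)) = (\<lambda>x. max (?p v x) (?p w x))" by (auto simp: min_def max_def)
  have "cell_int (osc r (?p (\<lambda>x. min (v x) (w x)))) + cell_int (osc r (?p (\<lambda>x. max (v x) (w x))))
      = cell_int (\<lambda>x. osc r (?p (\<lambda>x. min (v x) (w x))) x + osc r (?p (\<lambda>x. max (v x) (w x))) x)"
    by (intro cell_int_add[symmetric] tame_osc tame_intros v w r)
  also have "\<dots> \<le> cell_int (\<lambda>x. osc r (?p v) x + osc r (?p w) x)"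
    unfolding mm by (intro cell_int_mono osc_submodular[OF p r] tame_osc tame_intros v w r)
  also have "\<dots> = cell_int (osc r (?p v)) + cell_int (osc r (?p w))"
    by (intro cell_int_add tame_osc tame_intros v w r)
  finally have 1: "cell_int (osc r (?p (\<lambda>x. min (v x) (w x)))) + cell_int (osc r (?p (\<lambda>x. max (v x) (w x))))
      \<le> cell_int (osc r (?p v)) + cell_int (osc r (?p w))" .
  have "cell_int (\<lambda>x. g x * min (v x) (w x)) + cell_int (\<lambda>x. g x * max (v x) (w x))
      = cell_int (\<lambda>x. g x * min (v x) (w x) + g x * max (v x) (w x))"
    by (intro cell_int_add[symmetric] tame_intros g v w)
  also have "\<dots> = cell_int (\<lambda>x. g x * v x + g x * w x)"
    by (intro cell_int_cong) (auto simp: min_def max_def)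
  also have "\<dots> = cell_int (\<lambda>x. g x * v x) + cell_int (\<lambda>x. g x * w x)"
    by (intro cell_int_add tame_intros g v w)
  finally show ?thesis
    using divide_right_mono[OF 1, of "2 * r"] r by (simp add: cell_energy_def add_divide_distrib)
qed

lemma cell_energy_ge:
  assumes g: "tame g" and v: "admissible L v" and r: "0 < r"
  shows "- (cell_int (\<lambda>x. \<bar>g x\<bar>) * L) \<le> cell_energy r g \<omega> v"
proof -
  have lv: "tame v" using v by (simp add: admissible_def)
  have "0 \<le> cell_int (osc r (\<lambda>x. v x - \<omega> \<bullet> x))"
    by (intro cell_int_nonneg osc_nonneg tame_intros lv r)
  moreover have "cell_int (\<lambda>x. - L * \<bar>g x\<bar>) \<le> cell_int (\<lambda>x. g x * v x)"
  proof (intro cell_int_mono tame_intros g lv)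
    fix x
    have "\<bar>g x * v x\<bar> \<le> \<bar>g x\<bar> * L"
      using v by (auto simp: abs_mult admissible_def intro!: mult_left_mono)
    then show "- L * \<bar>g x\<bar> \<le> g x * v x" by (simp add: mult.commute)
  qed
  moreover have "cell_int (\<lambda>x. - L * \<bar>g x\<bar>) = - L * cell_int (\<lambda>x. \<bar>g x\<bar>)" by (rule cell_int_cmult)
  ultimately show ?thesis using r by (simp add: cell_energy_def add_increasing mult.commute)
qed

lemma ball_sup_increasing_limit:
  assumes b: "\<And>j. tame (b j)" "tame u" and r: "0 < r"
    and le: "\<And>j y. b j y \<le> u y" and lim: "\<And>y. (\<lambda>j. b j y) \<longlonglongrightarrow> u y"
  shows "(\<lambda>j. ball_sup r (b j) x) \<longlonglongrightarrow> ball_sup r u x"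
proof (rule order_tendstoI)
  fix t assume "t < ball_sup r u x"
  then obtain y where y: "y \<in> ball x r" "t < u y" using ball_sup_less[OF b(2) r] by blast
  have "\<forall>\<^sub>F j in sequentially. t < b j y" using order_tendstoD(1)[OF lim y(2)] .
  then show "\<forall>\<^sub>F j in sequentially. t < ball_sup r (b j) x"
    by eventually_elim (use ball_sup_upper[OF b(1) y(1)] in \<open>auto intro: less_le_trans\<close>)
next
  fix t assume "ball_sup r u x < t"
  moreover have "ball_sup r (b j) x \<le> ball_sup r u x" for j by (intro ball_sup_mono b r le)
  ultimately have "ball_sup r (b j) x < t" for j by (meson le_less_trans)
  then show "\<forall>\<^sub>F j in sequentially. ball_sup r (b j) x < t" by simp
qed

text \<open>Along a decreasing sequence the suprema on balls decrease, at least to the supremum of the limit,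
  whereas infima commute with infima and therefore converge.\<close>
lemma cell_energy_decreasing_limit:
  assumes g: "tame g" and r: "0 < r" and b: "\<And>j. admissible L (b j)"
    and dec: "\<And>x. decseq (\<lambda>j. b j x)" and lim: "\<And>x. (\<lambda>j. b j x) \<longlonglongrightarrow> v x"
    and c: "\<And>j. cell_energy r g \<omega> (b j) \<le> c j" and cl: "c \<longlonglongrightarrow> c'"
  shows "admissible L v \<and> cell_energy r g \<omega> v \<le> c'"
proof -
  have lb: "tame (b j)" for j using b by (simp add: admissible_def)
  have vL: "\<bar>v x\<bar> \<le> L" for x
    using b by (intro LIMSEQ_le_const2[OF tendsto_rabs[OF lim]]) (auto simp: admissible_def)
  have vb: "v \<in> borel_measurable borel"
    by (rule borel_measurable_LIMSEQ_real[OF lim]) (use tame_borel[OF lb] in auto)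
  have lv: "tame v" using vb vL by (rule tame_of_bound)
  have vp: "int_periodic v"
    unfolding int_periodic_def
  proof (intro allI ballI)
    fix x k :: "real^'a" assume k: "k \<in> int_vecs"
    have "(\<lambda>j. b j (x + k)) = (\<lambda>j. b j x)" using b k by (auto simp: admissible_def int_periodic_def)
    then show "v (x + k) = v x" using LIMSEQ_unique[OF lim[of "x + k"]] lim[of x] by simp
  qed
  have vle: "v x \<le> b j x" for x j using decseq_ge[OF dec lim] .
  have ble: "b j x \<le> b 0 x" for x j using dec[of x] by (simp add: decseq_def)
  let ?p = "\<lambda>v x. v x - \<omega> \<bullet> x" and ?q = "\<lambda>v x. - (v x - \<omega> \<bullet> x)"
  have lp: "tame (?p v)" "tame (?q v)" "\<And>j. tame (?p (b j))" "\<And>j. tame (?q (b j))"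
    by (intro tame_intros lv lb)+
  have split: "cell_int (osc r (?p w)) = cell_int (ball_sup r (?p w)) + cell_int (ball_sup r (?q w))" if "tame w" for w
    unfolding osc_def by (intro cell_int_add tame_ball_sup tame_intros that r)
  have "(\<lambda>j. cell_int (ball_sup r (?q (b j)))) \<longlonglongrightarrow> cell_int (ball_sup r (?q v))"
  proof (rule cell_int_dominated_convergence[where h="\<lambda>x. \<bar>ball_sup r (?q v) x\<bar> + \<bar>ball_sup r (?q (b 0)) x\<bar>"])
    show "(\<lambda>j. ball_sup r (?q (b j)) x) \<longlonglongrightarrow> ball_sup r (?q v) x" for x
      by (intro ball_sup_increasing_limit lp r) (auto intro!: tendsto_intros lim vle)
    show "\<bar>ball_sup r (?q (b j)) x\<bar> \<le> \<bar>ball_sup r (?q v) x\<bar> + \<bar>ball_sup r (?q (b 0)) x\<bar>" for j x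
    proof -
      have "ball_sup r (?q (b j)) x \<le> ball_sup r (?q v) x" by (intro ball_sup_mono lp r) (auto intro: vle)
      moreover have "ball_sup r (?q (b 0)) x \<le> ball_sup r (?q (b j)) x" by (intro ball_sup_mono lp r) (auto intro: ble)
      ultimately show ?thesis by linarith
    qed
  qed (intro tame_intros tame_ball_sup lp r)+
  moreover have "(\<lambda>j. cell_int (\<lambda>x. g x * b j x)) \<longlonglongrightarrow> cell_int (\<lambda>x. g x * v x)"
  proof (rule cell_int_dominated_convergence[where h="\<lambda>x. \<bar>g x\<bar> * L"])
    show "(\<lambda>j. g x * b j x) \<longlonglongrightarrow> g x * v x" for x by (intro tendsto_intros lim)
    show "\<bar>g x * b j x\<bar> \<le> \<bar>g x\<bar> * L" for j x
      using b by (auto simp: abs_mult admissible_def intro!: mult_left_mono)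
  qed (intro tame_intros g lv lb)+
  ultimately have "(\<lambda>j. (cell_int (ball_sup r (?p v)) + cell_int (ball_sup r (?q (b j)))) / (2 * r) + cell_int (\<lambda>x. g x * b j x))
      \<longlonglongrightarrow> (cell_int (ball_sup r (?p v)) + cell_int (ball_sup r (?q v))) / (2 * r) + cell_int (\<lambda>x. g x * v x)"
    using r by (intro tendsto_intros) auto
  moreover have "(cell_int (ball_sup r (?p v)) + cell_int (ball_sup r (?q (b j)))) / (2 * r) + cell_int (\<lambda>x. g x * b j x) \<le> c j" for j
  proof -
    have "cell_int (ball_sup r (?p v)) \<le> cell_int (ball_sup r (?p (b j)))"
      by (intro cell_int_mono ball_sup_mono tame_ball_sup lp r) (auto intro: vle)
    then have "(cell_int (ball_sup r (?p v)) + cell_int (ball_sup r (?q (b j)))) / (2 * r) \<le> cell_int (osc r (?p (b j))) / (2 * r)"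
      using r by (simp add: split[OF lb] divide_right_mono)
    then show ?thesis using c[of j] by (simp add: cell_energy_def)
  qed
  ultimately have "(cell_int (ball_sup r (?p v)) + cell_int (ball_sup r (?q v))) / (2 * r) + cell_int (\<lambda>x. g x * v x) \<le> c'"
    by (intro LIMSEQ_le[OF _ cl]) auto
  then show ?thesis
    using lv vp vL by (simp add: cell_energy_def split[OF lv] admissible_def)
qed

text \<open>By submodularity the minimum of two functions exceeds the minimal energy by at most the sum of the
  two excesses.  So for a minimizing sequence with excesses \<open>(1/2)^k\<close> the infimum of the tail from \<open>k\<close> on
  has excess at most \<open>2 (1/2)^k\<close>, and the increasing limit of these infima, the lower limit of the
  sequence, is minimal.\<close>
lemma cell_minimizer_exists:
  fixes g :: "real^'n \<Rightarrow> real"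
  assumes g: "tame g" and r: "0 < r" and L: "0 \<le> L"
  shows "\<exists>v. admissible L v \<and> (\<forall>w. admissible L w \<longrightarrow> cell_energy r g \<omega> v \<le> cell_energy r g \<omega> w)"
proof -
  let ?E = "cell_energy r g \<omega>"
  define m where "m = (INF w\<in>Collect (admissible L). ?E w)"
  have bdd: "bdd_below (?E ` Collect (admissible L))"
    using cell_energy_ge[OF g _ r] by (intro bdd_belowI2) auto
  have m: "m \<le> ?E w" if "admissible L w" for w
    unfolding m_def using that by (intro cINF_lower[OF bdd]) auto
  have "admissible L (\<lambda>x::real^'n. 0)"
    using L by (auto simp: admissible_def int_periodic_def intro: tame_const)
  then have ne: "Collect (admissible L :: (real^'n \<Rightarrow> real) \<Rightarrow> bool) \<noteq> {}" by blast
  have "\<exists>w. admissible L w \<and> ?E w < m + (1/2)^k" for k :: nat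
  proof (rule ccontr)
    assume "\<not> ?thesis"
    then have "m + (1/2)^k \<le> m"
      unfolding m_def[symmetric] by (subst m_def) (intro cINF_greatest ne, auto simp: not_less)
    moreover have "0 < (1/2::real)^k" by simp
    ultimately show False by linarith
  qed
  then obtain w where w: "\<And>k. admissible L (w k)" "\<And>k. ?E (w k) < m + (1/2)^k" by metis
  \<comment> \<open>\<open>a k j\<close> is the minimum of \<open>w k, \<dots>, w (k + j)\<close>.\<close>
  define a where "a k = rec_nat (w k) (\<lambda>j b x. min (b x) (w (k + Suc j) x))" for k
  have a0: "a k 0 = w k" and aS: "a k (Suc j) = (\<lambda>x. min (a k j x) (w (k + Suc j) x))" for k j
    by (simp_all add: a_def)
  have adm: "admissible L (a k j)" for k j
    by (induction j) (auto simp: a0 aS w intro!: admissible_min)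
  have en: "?E (a k j) \<le> m + 2 * (1/2)^k - (1/2)^(k+j)" for k j
  proof (induction j)
    case 0 show ?case using w(2)[of k] by (simp add: a0)
  next
    case (Suc j)
    have "?E (a k (Suc j)) + m \<le> ?E (a k (Suc j)) + ?E (\<lambda>x. max (a k j x) (w (k + Suc j) x))"
      using m[OF admissible_max[OF adm w(1)]] by simp
    also have "\<dots> \<le> ?E (a k j) + ?E (w (k + Suc j))"
      unfolding aS using adm w(1) by (intro cell_energy_submodular g r) (auto simp: admissible_def)
    finally show ?case using Suc w(2)[of "k + Suc j"] by simp
  qed
  have en': "?E (a k j) \<le> m + 2 * (1/2)^k" for k j
    using en[of k j] zero_le_power[of "1/2::real" "k+j"] by linarith
  have dec: "decseq (\<lambda>j. a k j x)" for k x
    by (rule decseq_SucI) (simp add: aS)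
  have "\<exists>l. (\<lambda>j. a k j x) \<longlonglongrightarrow> l" for k x
  proof -
    have "\<bar>a k j x\<bar> \<le> L" for j using adm by (simp add: admissible_def)
    then have "- L \<le> a k j x" for j by (simp add: abs_le_iff minus_le_iff)
    then show ?thesis using decseq_convergent[OF dec] by metis
  qed
  then obtain b where b: "\<And>k x. (\<lambda>j. a k j x) \<longlonglongrightarrow> b k x" by metis
  have bk: "admissible L (b k) \<and> ?E (b k) \<le> m + 2 * (1/2)^k" for k
    by (rule cell_energy_decreasing_limit[OF g r adm dec b en' tendsto_const])
  have inc: "b k x \<le> b (Suc k) x" for k x
  proof (rule LIMSEQ_le[OF LIMSEQ_Suc[OF b[of k x]] b[of "Suc k" x]])
    have "a k (Suc j) x \<le> a (Suc k) j x" for j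
      by (induction j) (auto simp: a0 aS)
    then show "\<exists>N. \<forall>n\<ge>N. a k (Suc n) x \<le> a (Suc k) n x" by blast
  qed
  then have dec': "decseq (\<lambda>k. - b k x)" for x by (intro decseq_SucI) auto
  have bL: "\<bar>b k x\<bar> \<le> L" for k x using bk by (simp add: admissible_def)
  have "\<exists>l. (\<lambda>k. - b k x) \<longlonglongrightarrow> l" for x
  proof -
    have "- L \<le> - b k x" for k using bL[of k x] by (simp add: abs_le_iff)
    then show ?thesis using decseq_convergent[OF dec'] by metis
  qed
  then obtain v where v: "\<And>x. (\<lambda>k. - b k x) \<longlonglongrightarrow> v x" by metis
  have "(\<lambda>k. m + 2 * (1/2)^k) \<longlonglongrightarrow> m + 2 * 0"
    by (intro tendsto_intros LIMSEQ_power_zero) auto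
  then have "admissible L v \<and> cell_energy r (\<lambda>x. - g x) (- \<omega>) v \<le> m"
    using bk admissible_minus cell_energy_minus[of r g \<omega>]
    by (intro cell_energy_decreasing_limit[OF tame_minus[OF g] r _ dec' v, where c="\<lambda>k. m + 2 * (1/2)^k"]) auto
  then have "admissible L (\<lambda>x. - v x)" "?E (\<lambda>x. - v x) \<le> m"
    using admissible_minus cell_energy_minus[of r g \<omega> "\<lambda>x. - v x"] by auto
  then show ?thesis using m by (meson order_trans)
qed


section \<open>The universal bound on the oscillation of minimizers\<close>

lemma cell_int_indicator_mono: "A \<in> sets borel \<Longrightarrow> B \<in> sets borel \<Longrightarrow> A \<subseteq> B \<Longrightarrow> cell_int (indicator A) \<le> cell_int (indicator B)"
  by (intro cell_int_mono tame_indicator) (auto simp: indicator_def)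

text \<open>The superlevel set of \<open>ball_sup r v\<close> contains a whole ball of radius \<open>r\<close>, hence a cube of side
  \<open>r / n\<close>, which has side at most one and therefore does not overlap itself modulo the integer lattice.\<close>
lemma ball_sup_superlevel_volume:
  fixes v :: "real^'n \<Rightarrow> real"
  assumes v: "tame v" "int_periodic v" and r: "0 < r" "r < 1" and y: "k < v y"
  shows "(r / real CARD('n)) ^ CARD('n) \<le> cell_int (indicator {x. k < ball_sup r v x})"
proof -
  define l where "l = r / real CARD('n)"
  have n: "1 \<le> real CARD('n)" using zero_less_card_finite[where 'a='n] by (simp add: Suc_le_eq)
  have "r / real CARD('n) \<le> 1 / 1" using r n by (intro frac_le) linarith+
  moreover have "0 < r / real CARD('n)" using r n by (intro divide_pos_pos) linarith+
  ultimately have l: "0 < l" "l \<le> 1" by (simp_all add: l_def)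
  let ?A = "{x. k < ball_sup r v x}"
  have A: "?A \<in> sets borel" using ball_sup_superlevel_open[OF v(1) r(1)] by (rule borel_open)
  have per: "ball_sup r v (x + j) = ball_sup r v x" if "j \<in> int_vecs" for x j
  proof -
    have "(\<lambda>z. v (z + j)) = v" using v(2) that by (auto simp: int_periodic_def)
    then show ?thesis using ball_sup_shift[of r v j x] by simp
  qed
  have "cell_int (indicator ?A) = cell_int (\<lambda>x. indicator ?A (x + y))"
    using per by (intro cell_int_shift[symmetric] tame_indicator A) (auto simp: int_periodic_def indicator_def)
  also have "\<dots> = cell_int (indicator {x. x + y \<in> ?A})" by (intro cell_int_cong) (auto simp: indicator_def)
  finally have 1: "ennreal (cell_int (indicator ?A)) = emeasure lborel (cell \<inter> {x. x + y \<in> ?A})"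
    using emeasure_cell_Int[of "{x. x + y \<in> ?A}"] measurable_sets_borel[OF _ A, of "\<lambda>x. x + y"]
    by (simp add: vimage_def)
  have "ennreal (l ^ CARD('n)) = emeasure lborel {x::real^'n. \<forall>i. 0 \<le> x $ i \<and> x $ i < l}"
    using l by (intro emeasure_half_open_cube[symmetric]) simp
  also have "\<dots> \<le> emeasure lborel (cell \<inter> {x. x + y \<in> ?A})"
  proof (rule emeasure_mono)
    show "{x::real^'n. \<forall>i. 0 \<le> x $ i \<and> x $ i < l} \<subseteq> cell \<inter> {x. x + y \<in> ?A}"
    proof
      fix x :: "real^'n" assume x: "x \<in> {x. \<forall>i. 0 \<le> x $ i \<and> x $ i < l}"
      have "norm x < real CARD('n) * l" using x by (intro norm_less_box) auto
      then have "norm x < r" using n by (simp add: l_def)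
      then have "y \<in> ball (x + y) r" by (simp add: dist_norm)
      then have "x + y \<in> ?A" using ball_sup_upper[OF v(1), of y "x + y" r] y by auto
      then show "x \<in> cell \<inter> {x. x + y \<in> ?A}" using x l by (auto simp: cell_def intro: less_le_trans)
    qed
    show "cell \<inter> {x. x + y \<in> ?A} \<in> sets lborel"
      using measurable_sets_borel[OF _ A, of "\<lambda>x. x + y"] by (simp add: vimage_def)
  qed
  also have "\<dots> = ennreal (cell_int (indicator ?A))" by (rule 1[symmetric])
  finally show ?thesis
    unfolding l_def[symmetric] by (subst (asm) ennreal_le_iff) (auto intro!: cell_int_nonneg)
qed

text \<open>The value of \<open>\<eta>\<close> is what \<open>level_decay\<close> needs: there the contribution of \<open>g\<close> is at most
  \<open>8 n \<eta>\<close> times the energy of the excess over the level, and half of that energy has to survive.\<close>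
locale bounded_cell_minimizer =
  fixes r \<eta> L :: real and g :: "real^'n \<Rightarrow> real" and \<omega> :: "real^'n" and v :: "real^'n \<Rightarrow> real"
  assumes r: "0 < r" "r < 1" and eta: "\<eta> = 1 / (16 * real CARD('n))"
    and g: "g \<in> borel_measurable borel" "\<And>x. \<bar>g x\<bar> \<le> \<eta>" and \<omega>: "norm \<omega> = 1"
    and adm: "admissible L v"
    and minimal: "\<And>w. admissible L w \<Longrightarrow> cell_energy r g \<omega> v \<le> cell_energy r g \<omega> w"
begin

lemma lv: "tame v" and pv: "int_periodic v" and vL: "\<bar>v x\<bar> \<le> L"
  using adm by (auto simp: admissible_def)

lemma lg: "tame g" using g by (rule tame_of_bound)

lemma n1: "1 \<le> real CARD('n)"
  using zero_less_card_finite[where 'a='n] by (simp add: Suc_le_eq)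

definition level_vol :: "real \<Rightarrow> real" where "level_vol k = cell_int (indicator {x. k < ball_sup r v x})"

lemma superlevel_borel: "{x. k < ball_sup r v x} \<in> sets borel"
  using ball_sup_superlevel_open[OF lv r(1)] by (rule borel_open)

lemma superlevel_v_borel: "{x. k < v x} \<in> sets borel"
  using tame_borel[OF lv] by measurable

text \<open>Where \<open>v\<close> exceeds \<open>k\<close> somewhere on \<open>ball x r\<close>, the plane \<open>\<omega> \<bullet> x\<close> costs at most \<open>2 r\<close> of oscillation for
  \<open>v\<close> and again at most \<open>2 r\<close> for \<open>min v k\<close>; elsewhere the two functions agree on the ball.  Minimality of
  \<open>v\<close> bounds the gain in oscillation by the loss \<open>\<integral> g w\<close>.\<close>
lemma truncation_energy:
  assumes k: "- L \<le> k"
  defines "w \<equiv> \<lambda>x. max (v x - k) 0"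
  shows "cell_int (osc r w) / (2 * r) \<le> 2 * level_vol k + \<eta> * cell_int w"
proof -
  let ?t = "\<lambda>x. min (v x) k"
  have L: "0 \<le> L" using vL[of 0] by simp
  have lw: "tame w" unfolding w_def by (intro tame_intros lv)
  have w0: "0 \<le> w x" for x by (simp add: w_def)
  have "admissible L ?t"
    using k vL lv pv by (auto simp: admissible_def int_periodic_def abs_le_iff min_def intro!: tame_min[unfolded min_def] tame_const)
      (metis order_trans linear)+
  from minimal[OF this]
  have "cell_int (osc r (\<lambda>x. v x - \<omega> \<bullet> x)) / (2 * r) - cell_int (osc r (\<lambda>x. ?t x - \<omega> \<bullet> x)) / (2 * r)
      \<le> cell_int (\<lambda>x. g x * ?t x) - cell_int (\<lambda>x. g x * v x)"
    by (simp add: cell_energy_def)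
  also have "\<dots> = cell_int (\<lambda>x. g x * ?t x - g x * v x)"
    by (intro cell_int_diff[symmetric] tame_intros lv lg)
  also have "\<dots> \<le> cell_int (\<lambda>x. \<eta> * w x)"
  proof (intro cell_int_mono tame_intros lv lg lw)
    fix x
    have "g x * ?t x - g x * v x = - g x * w x" by (simp add: w_def min_def max_def algebra_simps)
    also have "\<dots> \<le> \<eta> * w x" using g(2)[of x] w0[of x] by (intro mult_right_mono) auto
    finally show "g x * ?t x - g x * v x \<le> \<eta> * w x" .
  qed
  also have "\<dots> = \<eta> * cell_int w" by (rule cell_int_cmult)
  finally have 1: "cell_int (osc r (\<lambda>x. v x - \<omega> \<bullet> x)) / (2 * r) - cell_int (osc r (\<lambda>x. ?t x - \<omega> \<bullet> x)) / (2 * r) \<le> \<eta> * cell_int w" .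
  let ?I = "indicator {x. k < ball_sup r v x} :: real^'n \<Rightarrow> real"
  have pt: "osc r w x \<le> osc r (\<lambda>x. v x - \<omega> \<bullet> x) x - osc r (\<lambda>x. ?t x - \<omega> \<bullet> x) x + 4 * r * ?I x" for x
  proof (cases "k < ball_sup r v x")
    case True
    have i: "tame (\<lambda>x. - (\<omega> \<bullet> x))" by (intro tame_intros)
    have io: "osc r (\<lambda>x. - (\<omega> \<bullet> x)) x \<le> 2 * r" "osc r (\<lambda>x. \<omega> \<bullet> x) x \<le> 2 * r"
      using osc_inner_le[OF \<omega> r(1)] osc_minus[of r "\<lambda>x. \<omega> \<bullet> x" x] by auto
    have "osc r v x \<le> osc r (\<lambda>x. v x - \<omega> \<bullet> x) x + osc r (\<lambda>x. \<omega> \<bullet> x) x"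
      using osc_add_le[OF tame_diff[OF lv tame_inner] tame_inner r(1), of \<omega> \<omega> x] by simp
    moreover have "osc r (\<lambda>x. ?t x - \<omega> \<bullet> x) x \<le> osc r ?t x + osc r (\<lambda>x. - (\<omega> \<bullet> x)) x"
      using osc_add_le[OF tame_min[OF lv tame_const] i r(1), of k x] by simp
    moreover have "osc r v x = osc r ?t x + osc r w x"
      unfolding w_def by (rule osc_coarea[OF lv r(1)])
    ultimately show ?thesis using io True by simp
  next
    case False
    then have le: "v y \<le> k" if "y \<in> ball x r" for y using ball_sup_upper[OF lv that] by linarith
    have "osc r w x = osc r (\<lambda>_. 0) x" by (rule osc_cong) (use le in \<open>auto simp: w_def\<close>)
    also have "\<dots> = 0" using osc_le[OF r(1), of x 0 "\<lambda>_. 0" 0] osc_nonneg[OF tame_const r(1), of 0 x] by auto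
    finally have "osc r w x = 0" .
    moreover have "osc r (\<lambda>x. v x - \<omega> \<bullet> x) x = osc r (\<lambda>x. ?t x - \<omega> \<bullet> x) x"
      by (rule osc_cong) (use le in \<open>auto simp: min_def\<close>)
    ultimately show ?thesis using False by simp
  qed
  have "cell_int (osc r w) \<le> cell_int (\<lambda>x. osc r (\<lambda>x. v x - \<omega> \<bullet> x) x - osc r (\<lambda>x. ?t x - \<omega> \<bullet> x) x + 4 * r * ?I x)"
    by (intro cell_int_mono pt tame_intros tame_osc lw lv r tame_indicator superlevel_borel)
  also have "\<dots> = cell_int (\<lambda>x. osc r (\<lambda>x. v x - \<omega> \<bullet> x) x - osc r (\<lambda>x. ?t x - \<omega> \<bullet> x) x) + cell_int (\<lambda>x. 4 * r * ?I x)"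
    by (intro cell_int_add tame_intros tame_osc lv r tame_indicator superlevel_borel)
  also have "cell_int (\<lambda>x. osc r (\<lambda>x. v x - \<omega> \<bullet> x) x - osc r (\<lambda>x. ?t x - \<omega> \<bullet> x) x)
      = cell_int (osc r (\<lambda>x. v x - \<omega> \<bullet> x)) - cell_int (osc r (\<lambda>x. ?t x - \<omega> \<bullet> x))"
    by (intro cell_int_diff tame_intros tame_osc lv r)
  also have "cell_int (\<lambda>x. 4 * r * ?I x) = 4 * r * level_vol k" by (simp add: cell_int_cmult level_vol_def)
  finally have "cell_int (osc r w) / (2 * r) \<le> (cell_int (osc r (\<lambda>x. v x - \<omega> \<bullet> x)) - cell_int (osc r (\<lambda>x. ?t x - \<omega> \<bullet> x)) + 4 * r * level_vol k) / (2 * r)"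
    using r by (intro divide_right_mono) auto
  also have "\<dots> = cell_int (osc r (\<lambda>x. v x - \<omega> \<bullet> x)) / (2 * r) - cell_int (osc r (\<lambda>x. ?t x - \<omega> \<bullet> x)) / (2 * r) + 2 * level_vol k"
    using r by (simp add: add_divide_distrib diff_divide_distrib)
  finally show ?thesis using 1 by linarith
qed

text \<open>With \<open>T\<close> the energy of the excess \<open>w\<close>, the Poincare inequality gives \<open>\<integral> w \<le> 8 n l T\<close>.  Since \<open>\<eta>\<close> is small,
  \<open>truncation_energy\<close> then yields \<open>T \<le> 4 A\<close> for the measure \<open>A\<close> of the tube at level \<open>k\<close>.  Where the
  supremum of \<open>v\<close> exceeds \<open>k + h\<close>, the sum of \<open>w\<close> and its oscillation is at least \<open>h\<close>.\<close>
lemma level_decay: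
  assumes k: "- L \<le> k" and l: "0 < l" "l \<le> 1" "r \<le> real CARD('n) * l"
    and supp: "2 * cell_int (indicator {x. k < v x}) \<le> l ^ CARD('n)" and h: "0 < h"
  shows "h * level_vol (k + h) \<le> 40 * real CARD('n) * l * level_vol k"
proof -
  define n where "n = real CARD('n)"
  have n: "1 \<le> n" using n1 by (simp add: n_def)
  define w where "w = (\<lambda>x. max (v x - k) 0)"
  have lw: "tame w" unfolding w_def by (intro tame_intros lv)
  have pw: "int_periodic w" using pv by (auto simp: w_def int_periodic_def)
  have w0: "0 \<le> w x" for x by (simp add: w_def)
  \<comment> \<open>The smallest number of steps of length at most \<open>r\<close> that covers the distance \<open>n l\<close>.\<close>
  define m where "m = nat \<lceil>n * l / r\<rceil>"
  have nl: "0 < n * l / r" using n l r by simp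
  have m: "0 < m" "n * l / r \<le> real m" "real m \<le> n * l / r + 1"
    using nl unfolding m_def by linarith+
  have mr: "n * l \<le> real m * r" "real m * r \<le> n * l + r"
    using m(2,3) r by (auto simp: field_simps)
  define T where "T = cell_int (osc r w) / (2 * r)"
  have T0: "0 \<le> T" unfolding T_def using r by (intro divide_nonneg_pos cell_int_nonneg osc_nonneg lw) auto
  have osc: "cell_int (osc r w) = 2 * r * T" using r by (simp add: T_def)
  have "cell_int w \<le> 2 * real m * cell_int (osc r w)"
    by (rule poincare_small_support[OF lw pw w0 r(1) l(1,2) m(1)])
      (use mr supp in \<open>auto simp: n_def w_def less_max_iff_disj\<close>)
  also have "\<dots> = 4 * (real m * r) * T" by (simp add: osc)
  also have "\<dots> \<le> 4 * (2 * n * l) * T"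
  proof (intro mult_right_mono mult_left_mono)
    show "real m * r \<le> 2 * n * l" using mr(2) l(3) by (simp add: n_def mult.assoc)
  qed (use T0 in auto)
  finally have wT: "cell_int w \<le> 8 * n * l * T" by simp
  have "\<eta> * cell_int w \<le> \<eta> * (8 * n * l * T)"
    using wT eta by (intro mult_left_mono) auto
  also have "\<dots> = l * T / 2" using n eta by (simp add: n_def)
  also have "\<dots> \<le> T / 2" using l T0 mult_right_mono[of l 1 T] by simp
  finally have "\<eta> * cell_int w \<le> T / 2" .
  then have T: "T \<le> 4 * level_vol k"
    using truncation_energy[OF k] by (simp add: w_def[symmetric] T_def[symmetric])
  have "h * level_vol (k + h) = cell_int (\<lambda>x. h * indicator {x. k + h < ball_sup r v x} x)"
    by (simp add: cell_int_cmult level_vol_def)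
  also have "\<dots> \<le> cell_int (\<lambda>x. w x + osc r w x)"
  proof (intro cell_int_mono tame_intros tame_indicator superlevel_borel lw tame_osc r)
    fix x
    show "h * indicator {x. k + h < ball_sup r v x} x \<le> w x + osc r w x"
    proof (cases "k + h < ball_sup r v x")
      case True
      then obtain y where y: "y \<in> ball x r" "k + h < v y" using ball_sup_less[OF lv r(1)] by blast
      then have "h \<le> w y" by (simp add: w_def)
      moreover have "w y - w x \<le> osc r w x" using y r by (intro osc_ge lw) auto
      ultimately show ?thesis using True by simp
    qed (use w0[of x] osc_nonneg[OF lw r(1), of x] in simp)
  qed
  also have "\<dots> = cell_int w + 2 * r * T" unfolding osc[symmetric] by (intro cell_int_add lw tame_osc r)
  also have "\<dots> \<le> 8 * n * l * T + 2 * (n * l) * T"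
    using wT l T0 by (intro add_mono mult_right_mono) (auto simp: n_def)
  also have "\<dots> = 10 * n * l * T" by simp
  also have "\<dots> \<le> 10 * n * l * (4 * level_vol k)" using T n l by (intro mult_left_mono) auto
  finally show ?thesis by (simp add: n_def)
qed

text \<open>Use \<open>level_decay\<close> at the levels \<open>k0 + d (1 - 2^(-j))\<close> with \<open>l = 2^(-j)\<close>.  The value of \<open>d\<close> makes each step
  reduce the measure by the factor \<open>q = 2^(-n) / 2\<close>, which keeps the supports small enough for the next
  step.  The measures tend to zero, yet \<open>ball_sup_superlevel_volume\<close> bounds them below as long as \<open>v\<close>
  exceeds \<open>k0 + d\<close> somewhere.\<close>
lemma upper_bound:
  assumes half: "2 * cell_int (indicator {x. k0 < v x}) \<le> 1"
  shows "v y \<le> k0 + 160 * real CARD('n) * 2 ^ CARD('n)"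
proof (rule ccontr)
  define n where "n = CARD('n)"
  have n: "1 \<le> n" "1 \<le> real n" using n1 by (auto simp: n_def)
  define d where "d = 160 * real n * 2 ^ n"
  have d: "0 < d" using n by (simp add: d_def)
  assume "\<not> ?thesis"
  then have y: "k0 + d < v y" by (simp add: d_def n_def)
  define q :: real where "q = 1 / 2 ^ n / 2"
  have q: "0 < q" "q \<le> 1 / 2" "q = 80 * real n / d" using n by (auto simp: q_def d_def field_simps)
  define K where "K j = k0 + d * (1 - (1/2) ^ j)" for j :: nat
  have Kd: "K j < k0 + d" for j using d by (simp add: K_def algebra_simps)
  have KS: "K (Suc j) = K j + d * (1/2) ^ j / 2" for j by (simp add: K_def field_simps)
  have k0: "- L \<le> k0"
  proof (rule ccontr)
    assume "\<not> ?thesis"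
    then have lt: "k0 < v x" for x using vL[of x] by (auto simp: abs_le_iff)
    have "cell_int (indicator {x. k0 < v x}) = cell_int (\<lambda>x::real^'n. 1)"
      by (rule cell_int_cong) (simp add: lt)
    with half show False by (simp add: cell_int_const)
  qed
  have KL: "- L \<le> K j" for j
  proof -
    have "(1/2::real) ^ j \<le> 1" by (simp add: power_le_one)
    then have "0 \<le> d * (1 - (1/2) ^ j)" using d by simp
    then show ?thesis using k0 by (simp add: K_def)
  qed
  have pos: "(r / real n) ^ n \<le> level_vol (K j)" for j
    unfolding level_vol_def n_def using y Kd[of j] by (intro ball_sup_superlevel_volume[where y=y] lv pv r) simp
  have qj: "2 * q ^ Suc j \<le> ((1/2) ^ Suc j) ^ n" for j
  proof -
    have "q ^ Suc j = (1 / 2 ^ n) ^ Suc j * (1/2) ^ Suc j" unfolding q_def by (subst power_mult_distrib[symmetric]) simp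
    also have "\<dots> \<le> (1 / 2 ^ n) ^ Suc j * (1 / 2)"
      by (intro mult_left_mono) (auto simp: power_le_one)
    finally have "2 * q ^ Suc j \<le> (1 / 2 ^ n) ^ Suc j" by simp
    also have "\<dots> = ((1/2) ^ Suc j) ^ n" by (simp add: power_divide power_mult[symmetric] mult.commute del: power_Suc)
    finally show ?thesis .
  qed
  have step: "level_vol (K (Suc j)) \<le> q * level_vol (K j)"
    if rj: "r \<le> real n * (1/2) ^ j" and supp: "2 * cell_int (indicator {x. K j < v x}) \<le> ((1/2) ^ j) ^ n" for j
  proof -
    have "d * (1/2) ^ j / 2 * level_vol (K j + d * (1/2) ^ j / 2) \<le> 40 * real n * (1/2) ^ j * level_vol (K j)"
      unfolding n_def by (rule level_decay[OF KL]) (use rj supp d in \<open>auto simp: n_def power_le_one\<close>)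
    then have "d * level_vol (K (Suc j)) \<le> 80 * real n * level_vol (K j)" by (simp add: KS)
    then show ?thesis using d by (simp add: q(3) field_simps)
  qed
  have sup_v: "cell_int (indicator {x. k < v x}) \<le> level_vol k" for k
    unfolding level_vol_def
  proof (intro cell_int_indicator_mono superlevel_borel superlevel_v_borel)
    show "{x. k < v x} \<subseteq> {x. k < ball_sup r v x}"
      using ball_sup_upper[OF lv, of _ _ r] r by (auto intro: less_le_trans)
  qed
  have lev1: "level_vol k \<le> 1" for k
  proof -
    have "level_vol k \<le> cell_int (\<lambda>x::real^'n. 1)"
      unfolding level_vol_def by (intro cell_int_mono tame_indicator tame_const superlevel_borel) (auto simp: indicator_def)
    then show ?thesis by (simp add: cell_int_const)
  qed
  have decay: "level_vol (K (Suc j)) \<le> q ^ Suc j" for j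
  proof (induction j)
    case 0
    have "level_vol (K 1) \<le> q * level_vol (K 0)"
      using step[of 0] r n half by (simp add: K_def)
    also have "\<dots> \<le> q * 1" using q lev1 by (intro mult_left_mono) auto
    finally show ?case by simp
  next
    case (Suc j)
    have s: "2 * level_vol (K (Suc j)) \<le> ((1/2) ^ Suc j) ^ n" using Suc qj[of j] by linarith
    \<comment> \<open>Otherwise the lower bound on the measure of a nonempty neighbourhood would contradict the decay so far.\<close>
    have "r \<le> real n * (1/2) ^ Suc j"
    proof (rule ccontr)
      assume "\<not> ?thesis"
      then have "(1/2) ^ Suc j \<le> r / real n" using n by (simp add: field_simps)
      then have "((1/2) ^ Suc j) ^ n \<le> (r / real n) ^ n" by (intro power_mono) auto
      with s pos[of "Suc j"] have "2 * level_vol (K (Suc j)) \<le> level_vol (K (Suc j))" by linarith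
      moreover have "0 < level_vol (K (Suc j))" using pos[of "Suc j"] r n by (intro less_le_trans[OF _ pos]) simp
      ultimately show False by simp
    qed
    then have "level_vol (K (Suc (Suc j))) \<le> q * level_vol (K (Suc j))"
      using s sup_v[of "K (Suc j)"] by (intro step) auto
    also have "\<dots> \<le> q * q ^ Suc j" using q Suc by (intro mult_left_mono) auto
    finally show ?case by simp
  qed
  have p: "0 < (r / real n) ^ n" using r n by simp
  obtain j where j: "q ^ j < (r / real n) ^ n" using real_arch_pow_inv[OF p, of q] q by auto
  have "q ^ Suc j \<le> q ^ j" using q by (intro power_decreasing) auto
  then show False using j decay[of j] pos[of "Suc j"] by linarith
qed

end

text \<open>The level \<open>k\<close> is a median of \<open>v0\<close> up to an error of at most one.  Adding constants does not change the
  energy, as \<open>g\<close> has zero average, so \<open>v0\<close> may be centered.  The gap between \<open>d + 1\<close> and \<open>d + 2\<close> leaves room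
  for small perturbations in all directions.\<close>
lemma centered_minimizer_exists:
  fixes g :: "real^'n \<Rightarrow> real" and \<omega> :: "real^'n"
  defines "d \<equiv> 160 * real CARD('n) * 2 ^ CARD('n)"
  assumes r: "0 < r" "r < 1" and eta: "\<eta> = 1 / (16 * real CARD('n))"
    and g: "g \<in> borel_measurable borel" "\<And>x. \<bar>g x\<bar> \<le> \<eta>" "cell_int g = 0" and \<omega>: "norm \<omega> = 1"
  shows "\<exists>v. admissible (d + 1) v \<and> (\<forall>w. admissible (d + 2) w \<longrightarrow> cell_energy r g \<omega> v \<le> cell_energy r g \<omega> w)"
proof -
  have d: "0 \<le> d" by (simp add: d_def)
  have lg: "tame g" using g(1,2) by (rule tame_of_bound)
  obtain v0 where v0: "admissible (d + 2) v0"
    "\<And>w. admissible (d + 2) w \<Longrightarrow> cell_energy r g \<omega> v0 \<le> cell_energy r g \<omega> w"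
    using cell_minimizer_exists[OF lg r(1), of "d + 2" \<omega>] d by auto
  interpret P: bounded_cell_minimizer r \<eta> "d + 2" g \<omega> v0
    by unfold_locales (use r eta g \<omega> v0 in auto)
  \<comment> \<open>The reflected problem yields the lower bound.\<close>
  interpret N: bounded_cell_minimizer r \<eta> "d + 2" "\<lambda>x. - g x" "- \<omega>" "\<lambda>x. - v0 x"
  proof unfold_locales
    show "cell_energy r (\<lambda>x. - g x) (- \<omega>) (\<lambda>x. - v0 x) \<le> cell_energy r (\<lambda>x. - g x) (- \<omega>) w"
      if "admissible (d + 2) w" for w
      using v0(2)[OF admissible_minus[OF that]] cell_energy_minus[of r g \<omega>]
        cell_energy_minus[of r g \<omega> "\<lambda>x. - w x"] by simp
  qed (use r eta g \<omega> v0 admissible_minus in auto)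
  have lv: "tame v0" and pv: "int_periodic v0" by (rule P.lv P.pv)+
  obtain R :: nat where R: "d + 3 \<le> real R" using real_arch_simple by blast
  \<comment> \<open>\<open>Q\<close> fails at the height \<open>- R\<close> and holds at \<open>R\<close>; the least \<open>j\<close> with \<open>Q j\<close> gives the approximate median.\<close>
  define Q where "Q j \<longleftrightarrow> 2 * cell_int (indicator {x. real j - real R < v0 x}) \<le> 1" for j :: nat
  have v0L: "- real R < v0 x" "v0 x < real R" for x using P.vL[of x] R by (auto simp: abs_le_iff)
  have "cell_int (indicator {x. real (2 * R) - real R < v0 x}) = cell_int (\<lambda>x::real^'n. 0)"
    by (rule cell_int_cong) (use v0L in \<open>auto simp: indicator_def not_less less_imp_le\<close>)
  then have "Q (2 * R)" by (simp add: Q_def cell_int_const)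
  then have QL: "Q (LEAST j. Q j)" by (rule LeastI)
  define j where "j = (LEAST j. Q j)"
  have "cell_int (indicator {x. real 0 - real R < v0 x}) = cell_int (\<lambda>x::real^'n. 1)"
    by (rule cell_int_cong) (use v0L in auto)
  then have "\<not> Q 0" by (simp add: Q_def cell_int_const)
  then obtain i where i: "j = Suc i" using QL by (cases j) (auto simp: j_def)
  have nQ: "\<not> Q i" using not_less_Least[of i Q] i by (simp add: j_def)
  define k where "k = real j - real R"
  have up: "v0 x \<le> k + d" for x
    using P.upper_bound[of k x] QL by (simp add: k_def Q_def j_def d_def)
  have "cell_int (indicator {x. k - 1 < v0 x}) + cell_int (indicator {x. - (k - 1) < - v0 x})
      = cell_int (\<lambda>x. indicator {x. k - 1 < v0 x} x + indicator {x. - (k - 1) < - v0 x} x)"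
    using P.superlevel_v_borel N.superlevel_v_borel by (intro cell_int_add[symmetric] tame_indicator) auto
  also have "\<dots> \<le> cell_int (\<lambda>x::real^'n. 1)"
    using P.superlevel_v_borel N.superlevel_v_borel
    by (intro cell_int_mono tame_add tame_indicator tame_const) (auto simp: indicator_def)
  finally have "cell_int (indicator {x. k - 1 < v0 x}) + cell_int (indicator {x. - (k - 1) < - v0 x}) \<le> 1"
    by (simp add: cell_int_const)
  moreover have "1 < 2 * cell_int (indicator {x. k - 1 < v0 x})"
    using nQ i by (simp add: Q_def k_def not_le algebra_simps)
  ultimately have "2 * cell_int (indicator {x. - (k - 1) < - v0 x}) \<le> 1" by linarith
  then have down: "k - 1 - d \<le> v0 x" for x
    using N.upper_bound[of "- (k - 1)" x] by (simp add: d_def)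
  let ?v = "\<lambda>x. v0 x - k"
  have "admissible (d + 1) ?v"
    using lv pv up down d by (auto simp: admissible_def int_periodic_def abs_le_iff intro!: tame_intros)
      (smt (verit) up down)+
  moreover have "cell_energy r g \<omega> ?v = cell_energy r g \<omega> v0"
  proof -
    have "osc r (\<lambda>x. v0 x - k - \<omega> \<bullet> x) = osc r (\<lambda>x. v0 x - \<omega> \<bullet> x)"
      using osc_add_const[OF tame_diff[OF lv tame_inner] r(1), of \<omega> "- k"]
      by (auto simp: algebra_simps)
    moreover have "cell_int (\<lambda>x. g x * (v0 x - k)) = cell_int (\<lambda>x. g x * v0 x) - cell_int (\<lambda>x. k * g x)"
      by (subst cell_int_diff[symmetric]) (auto intro!: tame_intros lg lv simp: algebra_simps)
    ultimately show ?thesis by (simp add: cell_energy_def cell_int_cmult g(3))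
  qed
  ultimately show ?thesis using v0(2) by (intro exI[of _ ?v]) auto
qed


section \<open>Minimality under compactly supported perturbations\<close>

text \<open>The energies themselves are infinite in general, but their difference under a compactly supported
  perturbation is an integral of functions with bounded support.\<close>
definition locally_minimal :: "real \<Rightarrow> (real^'n \<Rightarrow> real) \<Rightarrow> (real^'n \<Rightarrow> real) \<Rightarrow> bool" where
  "locally_minimal r g u \<longleftrightarrow> tame u \<and> (\<forall>\<phi> N. tame \<phi> \<and> (\<forall>x. N < norm x \<longrightarrow> \<phi> x = 0) \<longrightarrow>
     0 \<le> (\<integral>x. osc r (\<lambda>y. u y + \<phi> y) x - osc r u x \<partial>lborel) / (2 * r) + (\<integral>x. g x * \<phi> x \<partial>lborel))"

lemma norm_ball_le: "y \<in> ball x r \<Longrightarrow> norm x < norm y + r"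
  using norm_triangle_ineq2[of x y] by (simp add: dist_norm)

lemma osc_perturb_outside:
  assumes "0 < r" "\<And>x. N < norm x \<Longrightarrow> \<phi> x = 0" "N + r < norm x"
  shows "osc r (\<lambda>y. u y + \<phi> y) x = osc r u x"
proof (rule osc_cong)
  fix y assume "y \<in> ball x r"
  from norm_ball_le[OF this] assms show "u y + \<phi> y = u y" by simp
qed

lemma integrable_compact_support:
  assumes "tame \<psi>" "\<And>x. R < norm x \<Longrightarrow> \<psi> x = 0"
  shows "integrable lborel \<psi>"
proof -
  have "set_integrable lborel (cball 0 R) \<psi>" using assms(1) by (intro integrable_tame) auto
  moreover have "(\<lambda>x. indicator (cball 0 R) x *\<^sub>R \<psi> x) = \<psi>"
    using assms(2) by (auto simp: indicator_def fun_eq_iff)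
  ultimately show ?thesis by (simp add: set_integrable_def)
qed

text \<open>The sum of \<open>\<phi>\<close> over all integer translates, as a finite sum when \<open>\<phi>\<close> vanishes where the norm
  exceeds \<open>N\<close>.\<close>
definition periodize :: "real \<Rightarrow> (real^'n \<Rightarrow> real) \<Rightarrow> real^'n \<Rightarrow> real" where
  "periodize N \<phi> x = (\<Sum>k\<in>{k \<in> int_vecs. norm (x + k) \<le> N}. \<phi> (x + k))"

lemma periodize_eq:
  fixes \<phi> :: "real^'n \<Rightarrow> real"
  assumes "\<And>x. N < norm x \<Longrightarrow> \<phi> x = 0" "norm x + N \<le> R"
  shows "periodize N \<phi> x = (\<Sum>k\<in>int_vecs \<inter> cball 0 R. \<phi> (x + k))"
  unfolding periodize_def
proof (rule sum.mono_neutral_left)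
  show "{k \<in> int_vecs. norm (x + k) \<le> N} \<subseteq> int_vecs \<inter> cball 0 R"
  proof
    fix k assume k: "k \<in> {k \<in> int_vecs. norm (x + k) \<le> N}"
    have "norm k \<le> norm (x + k) + norm x" using norm_triangle_ineq4[of "x + k" x] by simp
    with k assms(2) show "k \<in> int_vecs \<inter> cball 0 R" by simp
  qed
  show "\<forall>i\<in>int_vecs \<inter> cball 0 R - {k \<in> int_vecs. norm (x + k) \<le> N}. \<phi> (x + i) = 0"
    by (auto intro!: assms(1) simp: not_le)
qed (rule finite_int_vecs)

lemma int_periodic_periodize: "int_periodic (periodize N \<phi>)"
  unfolding int_periodic_def periodize_def
proof (intro allI ballI)
  fix x j :: "real^'a" assume j: "j \<in> int_vecs"
  have add_j: "a + j \<in> int_vecs" if "a \<in> int_vecs" for a using int_vecs_add[OF that j] .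
  have diff_j: "a - j \<in> int_vecs" if "a \<in> int_vecs" for a
    using int_vecs_add[OF that int_vecs_minus[OF j]] by simp
  show "(\<Sum>k\<in>{k \<in> int_vecs. norm (x + j + k) \<le> N}. \<phi> (x + j + k)) = (\<Sum>k\<in>{k \<in> int_vecs. norm (x + k) \<le> N}. \<phi> (x + k))"
    by (rule sum.reindex_bij_witness[where j="\<lambda>k. j + k" and i="\<lambda>k. - j + k"])
      (auto simp: algebra_simps add_j diff_j)
qed

lemma borel_periodize:
  fixes \<phi> :: "real^'n \<Rightarrow> real"
  assumes \<phi>: "tame \<phi>" and supp: "\<And>x. N < norm x \<Longrightarrow> \<phi> x = 0"
  shows "periodize N \<phi> \<in> borel_measurable borel"
proof (rule borel_measurable_LIMSEQ_real)
  show "(\<lambda>m. \<Sum>k\<in>int_vecs \<inter> cball 0 (real m). \<phi> (x + k)) \<longlonglongrightarrow> periodize N \<phi> x" for x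
  proof (rule tendsto_eventually)
    obtain m0 where m0: "norm x + N \<le> real m0" using real_arch_simple by blast
    show "\<forall>\<^sub>F m in sequentially. (\<Sum>k\<in>int_vecs \<inter> cball 0 (real m). \<phi> (x + k)) = periodize N \<phi> x"
      using eventually_ge_at_top[of m0]
    proof eventually_elim
      case (elim m)
      with m0 show ?case by (intro periodize_eq[symmetric] supp) auto
    qed
  qed
  show "(\<lambda>x. \<Sum>k\<in>int_vecs \<inter> cball 0 (real m). \<phi> (x + k)) \<in> borel_measurable borel" for m
    by (intro borel_measurable_sum tame_borel tame_shift \<phi>)
qed

text \<open>Let \<open>P\<close> be the periodization of \<open>\<phi>\<close> and \<open>S\<close> the set of integer vectors that matter near the cell.  On
  balls with center in the cell, \<open>u + P / K\<close> is the average of \<open>K\<close> functions, namely \<open>u + \<phi> (\<cdot> + k)\<close> for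
  \<open>k \<in> S\<close> and \<open>u\<close> with the remaining weight.  By convexity its oscillation exceeds that of \<open>u\<close> by at most
  the average of the excesses, and integrating these over the cell adds up the excess of \<open>u + \<phi>\<close> over
  the whole space.\<close>
lemma cell_minimizer_locally_minimal:
  fixes g :: "real^'n \<Rightarrow> real" and \<omega> :: "real^'n"
  assumes r: "0 < r" "r < 1" and g: "tame g" "int_periodic g"
    and v: "admissible (L - 1) v" and min: "\<And>w. admissible L w \<Longrightarrow> cell_energy r g \<omega> v \<le> cell_energy r g \<omega> w"
  shows "locally_minimal r g (\<lambda>x. v x - \<omega> \<bullet> x)"
  unfolding locally_minimal_def
proof (intro conjI allI impI)
  have lv: "tame v" and pv: "int_periodic v" and vL: "\<And>x. \<bar>v x\<bar> \<le> L - 1" using v by (auto simp: admissible_def)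
  define u where "u = (\<lambda>x. v x - \<omega> \<bullet> x)"
  show lu: "tame (\<lambda>x. v x - \<omega> \<bullet> x)" by (intro tame_intros lv)
  then have lu: "tame u" by (simp add: u_def)
  fix \<phi> :: "real^'n \<Rightarrow> real" and N0 :: real
  assume "tame \<phi> \<and> (\<forall>x. N0 < norm x \<longrightarrow> \<phi> x = 0)"
  then have \<phi>: "tame \<phi>" and supp0: "\<And>x. N0 < norm x \<Longrightarrow> \<phi> x = 0" by auto
  define N where "N = max N0 0"
  have N: "0 \<le> N" and supp: "\<And>x. N < norm x \<Longrightarrow> \<phi> x = 0" using supp0 by (auto simp: N_def)
  define n where "n = real CARD('n)"
  define S where "S = int_vecs \<inter> cball (0::real^'n) (N + n + 1)"
  have S: "finite S" "S \<subseteq> int_vecs" by (auto simp: S_def finite_int_vecs)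
  define P where "P = periodize N \<phi>"
  have PS: "P x = (\<Sum>k\<in>S. \<phi> (x + k))" if "norm x \<le> n + 1" for x
    unfolding P_def S_def using that by (intro periodize_eq supp) auto
  obtain C where C: "\<And>x. norm x \<le> N \<Longrightarrow> \<bar>\<phi> x\<bar> \<le> C" using tame_bound[OF \<phi>] by blast
  have C0: "0 \<le> C" using C[of 0] N by auto
  have \<phi>C: "\<bar>\<phi> x\<bar> \<le> C" for x using C[of x] supp[of x] C0 by (cases "norm x \<le> N") auto
  \<comment> \<open>\<open>K > card S\<close> gives \<open>u\<close> itself a positive weight in the average, and \<open>K \<ge> card S * C\<close> makes \<open>\<bar>P / K\<bar>\<close> at most one.\<close>
  define K where "K = real (card S) + 1 + real (card S) * C"
  have K: "0 < K" "real (card S) < K" "real (card S) * C \<le> K" using C0 by (auto simp: K_def add_pos_nonneg)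
  have PK: "\<bar>P x\<bar> \<le> K" for x
  proof -
    let ?y = "x - int_part x"
    have yc: "?y \<in> cell" by (simp add: diff_in_cell_iff int_part_int_vecs)
    have "P x = P (x + - int_part x)"
      unfolding P_def using int_periodic_add[OF int_periodic_periodize int_vecs_minus[OF int_part_int_vecs], of N \<phi> x] by simp
    then have "P x = (\<Sum>k\<in>S. \<phi> (?y + k))" using PS[of ?y] norm_cell[OF yc] by (simp add: n_def)
    also have "\<bar>\<dots>\<bar> \<le> (\<Sum>k\<in>S. \<bar>\<phi> (?y + k)\<bar>)" by (rule sum_abs)
    also have "\<dots> \<le> (\<Sum>k\<in>S. C)" by (intro sum_mono \<phi>C)
    finally show ?thesis using K by simp
  qed
  have lP: "tame P"
    using borel_periodize[OF \<phi> supp] PK by (intro tame_of_bound) (auto simp: P_def)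
  let ?w = "\<lambda>x. v x + (1 / K) * P x"
  have "admissible L ?w"
    unfolding admissible_def
  proof (intro conjI allI)
    show "tame ?w" by (intro tame_intros lv lP)
    show "int_periodic ?w" using pv int_periodic_periodize[of N \<phi>] by (simp add: int_periodic_def P_def)
    fix x
    have "\<bar>(1 / K) * P x\<bar> \<le> 1" using PK[of x] K by (simp add: abs_mult)
    then show "\<bar>?w x\<bar> \<le> L" using vL[of x] by linarith
  qed
  note en = min[OF this]
  let ?\<psi> = "\<lambda>x. osc r (\<lambda>y. u y + \<phi> y) x - osc r u x"
  have l\<psi>: "tame ?\<psi>" by (intro tame_intros tame_osc lu \<phi> r)
  have u_shift: "u y = u (y + k) + \<omega> \<bullet> k" if "k \<in> S" for y k
    using int_periodic_add[OF pv, of k y] that S by (simp add: u_def inner_add_right subset_iff)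
  have sh0: "osc r u x = osc r u (x + k)" if "k \<in> S" for x k
  proof -
    have "osc r u x = osc r (\<lambda>y. u (y + k) + \<omega> \<bullet> k) x"
      by (intro osc_cong u_shift[OF that])
    then show ?thesis using osc_add_const[OF tame_shift[OF lu] r(1)] by (simp add: osc_shift)
  qed
  have sh: "osc r (\<lambda>y. u y + \<phi> (y + k)) x = osc r (\<lambda>y. u y + \<phi> y) (x + k)" if "k \<in> S" for x k
  proof -
    have "osc r (\<lambda>y. u y + \<phi> (y + k)) x = osc r (\<lambda>y. (u (y + k) + \<phi> (y + k)) + \<omega> \<bullet> k) x"
    proof (rule osc_cong)
      fix y show "u y + \<phi> (y + k) = u (y + k) + \<phi> (y + k) + \<omega> \<bullet> k" using u_shift[OF that, of y] by linarith
    qed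
    also have "\<dots> = osc r (\<lambda>y. u (y + k) + \<phi> (y + k)) x"
      by (intro osc_add_const tame_add tame_shift lu \<phi> r)
    also have "\<dots> = osc r (\<lambda>y. u y + \<phi> y) (x + k)"
      by (rule osc_shift[of r "\<lambda>y. u y + \<phi> y"])
    finally show ?thesis .
  qed
  have osc: "osc r (\<lambda>y. ?w y - \<omega> \<bullet> y) x \<le> osc r u x + (1 / K) * (\<Sum>k\<in>S. ?\<psi> (x + k))" if x: "x \<in> cell" for x
  proof -
    let ?c = "K - real (card S)"
    have c: "0 < ?c" using K by simp
    have "osc r (\<lambda>y. ?w y - \<omega> \<bullet> y) x
        = osc r (\<lambda>y. (1 / K) * ((\<Sum>k\<in>S. u y + \<phi> (y + k)) + ?c * u y)) x"
    proof (rule osc_cong)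
      fix y assume y: "y \<in> ball x r"
      have "norm y < norm x + r" using norm_ball_le[of x y r] y by (simp add: dist_commute)
      then have "P y = (\<Sum>k\<in>S. \<phi> (y + k))" using norm_cell[OF x] r by (intro PS) (simp add: n_def)
      then have "(\<Sum>k\<in>S. u y + \<phi> (y + k)) + ?c * u y = K * u y + P y"
        by (simp only: sum.distrib sum_constant) (simp add: algebra_simps)
      moreover have "(1 / K) * (K * u y + P y) = u y + (1 / K) * P y"
        using K by (simp add: field_simps)
      ultimately show "?w y - \<omega> \<bullet> y = (1 / K) * ((\<Sum>k\<in>S. u y + \<phi> (y + k)) + ?c * u y)"
        by (simp add: u_def)
    qed
    also have "\<dots> = (1 / K) * osc r (\<lambda>y. (\<Sum>k\<in>S. u y + \<phi> (y + k)) + ?c * u y) x"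
      using K by (intro osc_scale tame_intros tame_sum tame_shift lu \<phi> r) simp
    also have "\<dots> \<le> (1 / K) * ((\<Sum>k\<in>S. osc r (\<lambda>y. u y + \<phi> (y + k)) x) + ?c * osc r u x)"
    proof (rule mult_left_mono)
      have "osc r (\<lambda>y. (\<Sum>k\<in>S. u y + \<phi> (y + k)) + ?c * u y) x
          \<le> osc r (\<lambda>y. \<Sum>k\<in>S. u y + \<phi> (y + k)) x + osc r (\<lambda>y. ?c * u y) x"
        by (intro osc_add_le tame_intros tame_sum tame_shift lu \<phi> r)
      also have "osc r (\<lambda>y. ?c * u y) x = ?c * osc r u x" by (rule osc_scale[OF lu r(1) c])
      also have "osc r (\<lambda>y. \<Sum>k\<in>S. u y + \<phi> (y + k)) x \<le> (\<Sum>k\<in>S. osc r (\<lambda>y. u y + \<phi> (y + k)) x)"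
        by (intro osc_sum_le tame_intros tame_shift lu \<phi> r)
      finally show "osc r (\<lambda>y. (\<Sum>k\<in>S. u y + \<phi> (y + k)) + ?c * u y) x
          \<le> (\<Sum>k\<in>S. osc r (\<lambda>y. u y + \<phi> (y + k)) x) + ?c * osc r u x" by simp
    qed (use K in simp)
    also have "(\<Sum>k\<in>S. osc r (\<lambda>y. u y + \<phi> (y + k)) x) = (\<Sum>k\<in>S. ?\<psi> (x + k) + osc r u x)"
    proof (rule sum.cong[OF refl])
      fix k assume k: "k \<in> S"
      show "osc r (\<lambda>y. u y + \<phi> (y + k)) x = ?\<psi> (x + k) + osc r u x"
        using sh[OF k, of x] sh0[OF k, of x] by simp
    qed
    also have "(1 / K) * ((\<Sum>k\<in>S. ?\<psi> (x + k) + osc r u x) + ?c * osc r u x)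
        = osc r u x + (1 / K) * (\<Sum>k\<in>S. ?\<psi> (x + k))"
    proof -
      have "(1 / K) * ((\<Sum>k\<in>S. f k + a) + ?c * a) = a + (1 / K) * (\<Sum>k\<in>S. f k)" for f a
        using K by (simp add: sum.distrib field_simps)
      then show ?thesis .
    qed
    finally show ?thesis .
  qed
  have part: "int_part x \<in> S" if "norm x \<le> N + 1" for x
    using norm_int_part[of x] that by (simp add: S_def n_def int_part_int_vecs)
  have I\<psi>: "(\<integral>x. ?\<psi> x \<partial>lborel) = (\<Sum>k\<in>S. cell_int (\<lambda>x. ?\<psi> (x + k)))"
  proof (rule integral_unfold_cells[OF l\<psi> S])
    fix x assume "?\<psi> x \<noteq> 0"
    then have "norm x \<le> N + r" using osc_perturb_outside[OF r(1) supp, where x=x and u=u] by (cases "norm x \<le> N + r") auto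
    then show "int_part x \<in> S" using r by (intro part) simp
  qed
  have I\<phi>: "(\<integral>x. g x * \<phi> x \<partial>lborel) = (\<Sum>k\<in>S. cell_int (\<lambda>x. g (x + k) * \<phi> (x + k)))"
  proof (rule integral_unfold_cells[OF _ S])
    show "tame (\<lambda>x. g x * \<phi> x)" by (intro tame_intros g \<phi>)
    fix x assume "g x * \<phi> x \<noteq> 0"
    then have "norm x \<le> N" using supp[of x] by (cases "norm x \<le> N") auto
    then show "int_part x \<in> S" by (intro part) simp
  qed
  have "cell_int (osc r (\<lambda>y. ?w y - \<omega> \<bullet> y)) \<le> cell_int (\<lambda>x. osc r u x + (1 / K) * (\<Sum>k\<in>S. ?\<psi> (x + k)))"
    by (intro cell_int_mono osc tame_osc tame_intros tame_sum tame_shift[OF l\<psi>] lv lP lu r)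
  also have "\<dots> = cell_int (osc r u) + (1 / K) * (\<integral>x. ?\<psi> x \<partial>lborel)"
    unfolding I\<psi>
    by (subst cell_int_add) (auto intro!: tame_osc lu r tame_intros tame_sum tame_shift[OF l\<psi>] cell_int_sum S simp: cell_int_cmult simp del: times_divide_eq_left)
  finally have 1: "cell_int (osc r (\<lambda>y. ?w y - \<omega> \<bullet> y)) \<le> cell_int (osc r u) + (1 / K) * (\<integral>x. ?\<psi> x \<partial>lborel)" .
  have "cell_int (\<lambda>x. g x * ?w x) = cell_int (\<lambda>x. g x * v x + (1 / K) * (\<Sum>k\<in>S. g (x + k) * \<phi> (x + k)))"
  proof (rule cell_int_cong)
    fix x :: "real^'n" assume x: "x \<in> cell"
    have "P x = (\<Sum>k\<in>S. \<phi> (x + k))" using norm_cell[OF x] by (intro PS) (simp add: n_def)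
    moreover have "(\<Sum>k\<in>S. g (x + k) * \<phi> (x + k)) = g x * (\<Sum>k\<in>S. \<phi> (x + k))"
      unfolding sum_distrib_left using S(2) int_periodic_add[OF g(2)] by (intro sum.cong) auto
    ultimately show "g x * ?w x = g x * v x + (1 / K) * (\<Sum>k\<in>S. g (x + k) * \<phi> (x + k))"
      by (simp add: algebra_simps)
  qed
  also have "\<dots> = cell_int (\<lambda>x. g x * v x) + (1 / K) * (\<integral>x. g x * \<phi> x \<partial>lborel)"
    unfolding I\<phi>
    by (subst cell_int_add) (auto intro!: g lv \<phi> tame_intros tame_sum tame_shift cell_int_sum S simp: cell_int_cmult simp del: times_divide_eq_left)
  finally have 2: "cell_int (\<lambda>x. g x * ?w x) = cell_int (\<lambda>x. g x * v x) + (1 / K) * (\<integral>x. g x * \<phi> x \<partial>lborel)" .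
  have "cell_int (osc r u) / (2 * r) + cell_int (\<lambda>x. g x * v x)
      \<le> (cell_int (osc r u) + (1 / K) * (\<integral>x. ?\<psi> x \<partial>lborel)) / (2 * r) + (cell_int (\<lambda>x. g x * v x) + (1 / K) * (\<integral>x. g x * \<phi> x \<partial>lborel))"
    using en divide_right_mono[OF 1, of "2 * r"] r 2 by (simp add: cell_energy_def u_def[symmetric])
  then have "0 \<le> (1 / K) * ((\<integral>x. ?\<psi> x \<partial>lborel) / (2 * r) + (\<integral>x. g x * \<phi> x \<partial>lborel))"
    by (simp add: add_divide_distrib distrib_left)
  then have "0 \<le> (\<integral>x. ?\<psi> x \<partial>lborel) / (2 * r) + (\<integral>x. g x * \<phi> x \<partial>lborel)"
    using K mult_le_cancel_left_pos[of "1 / K" 0] by simp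
  then show "0 \<le> (\<integral>x. osc r (\<lambda>y. v y - \<omega> \<bullet> y + \<phi> y) x - osc r (\<lambda>x. v x - \<omega> \<bullet> x) x \<partial>lborel) / (2 * r)
      + (\<integral>x. g x * \<phi> x \<partial>lborel)" by (simp add: u_def)
qed

lemma locally_minimal_scale:
  fixes u :: "real^'n \<Rightarrow> real"
  assumes u: "locally_minimal r g u" and c: "0 < c" and r: "0 < r"
  shows "locally_minimal r g (\<lambda>x. c * u x)"
  unfolding locally_minimal_def
proof (intro conjI allI impI)
  have lu: "tame u" using u by (simp add: locally_minimal_def)
  show "tame (\<lambda>x. c * u x)" by (intro tame_intros lu)
  fix \<phi> :: "real^'n \<Rightarrow> real" and N :: real
  assume "tame \<phi> \<and> (\<forall>x. N < norm x \<longrightarrow> \<phi> x = 0)"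
  then have \<phi>: "tame \<phi>" "\<forall>x. N < norm x \<longrightarrow> (1 / c) * \<phi> x = 0" by auto
  have l: "tame (\<lambda>x. (1 / c) * \<phi> x)" by (intro tame_intros \<phi>)
  have eq: "osc r (\<lambda>y. c * u y + \<phi> y) x = c * osc r (\<lambda>y. u y + (1 / c) * \<phi> y) x" for x
  proof -
    have "osc r (\<lambda>y. c * u y + \<phi> y) x = osc r (\<lambda>y. c * (u y + (1 / c) * \<phi> y)) x"
      using c by (intro osc_cong) (auto simp: field_simps)
    also have "\<dots> = c * osc r (\<lambda>y. u y + (1 / c) * \<phi> y) x" by (intro osc_scale tame_add lu l r c)
    finally show ?thesis .
  qed
  have 0: "0 \<le> (\<integral>x. osc r (\<lambda>y. u y + (1 / c) * \<phi> y) x - osc r u x \<partial>lborel) / (2 * r) + (\<integral>x. g x * ((1 / c) * \<phi> x) \<partial>lborel)"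
    using u l \<phi>(2) unfolding locally_minimal_def by blast
  have 1: "(\<integral>x. osc r (\<lambda>y. c * u y + \<phi> y) x - osc r (\<lambda>x. c * u x) x \<partial>lborel)
      = c * (\<integral>x. osc r (\<lambda>y. u y + (1 / c) * \<phi> y) x - osc r u x \<partial>lborel)"
    unfolding eq osc_scale[OF lu r c] right_diff_distrib[symmetric] by simp
  have 2: "(\<integral>x. g x * \<phi> x \<partial>lborel) = c * (\<integral>x. g x * ((1 / c) * \<phi> x) \<partial>lborel)"
    using c by simp
  show "0 \<le> (\<integral>x. osc r (\<lambda>y. c * u y + \<phi> y) x - osc r (\<lambda>x. c * u x) x \<partial>lborel) / (2 * r) + (\<integral>x. g x * \<phi> x \<partial>lborel)"
    using mult_nonneg_nonneg[OF less_imp_le[OF c] 0] unfolding 1 2 by (simp add: distrib_left)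
qed

text \<open>The coarea identity splits the oscillation of \<open>u\<close> exactly into those of the slice \<open>T\<close> and of the parts
  below and above.  For \<open>u + \<phi>\<close> the same decomposition, with \<open>\<phi>\<close> added to \<open>T\<close>, is subadditive.  So \<open>\<phi>\<close>
  raises the energy of \<open>T\<close> at least as much as that of \<open>u\<close>.\<close>
lemma locally_minimal_slice:
  fixes u :: "real^'n \<Rightarrow> real"
  assumes u: "locally_minimal r g u" and \<epsilon>: "0 < \<epsilon>" and r: "0 < r"
  shows "locally_minimal r g (\<lambda>x. min (max (u x - s) 0) \<epsilon>)"
  unfolding locally_minimal_def
proof (intro conjI allI impI)
  have lu: "tame u" using u by (simp add: locally_minimal_def)
  let ?T = "\<lambda>x. min (max (u x - s) 0) \<epsilon>" and ?m = "\<lambda>x. max (u x - s) 0"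
  let ?a = "\<lambda>x. min (u x) s" and ?b = "\<lambda>x. max (?m x - \<epsilon>) 0"
  show lT: "tame ?T" by (intro tame_intros lu)
  have lm: "tame ?m" by (intro tame_intros lu)
  have la: "tame ?a" "tame ?b" by (intro tame_intros lu)+
  fix \<phi> :: "real^'n \<Rightarrow> real" and N :: real
  assume a: "tame \<phi> \<and> (\<forall>x. N < norm x \<longrightarrow> \<phi> x = 0)"
  then have \<phi>: "tame \<phi>" and supp: "\<And>x. N < norm x \<Longrightarrow> \<phi> x = 0" by auto
  have "osc r (\<lambda>y. u y + \<phi> y) x - osc r u x \<le> osc r (\<lambda>y. ?T y + \<phi> y) x - osc r ?T x" for x
  proof -
    have "osc r u x = osc r ?a x + (osc r ?T x + osc r ?b x)"
      using osc_coarea[OF lu r, of x s] osc_coarea[OF lm r, of x \<epsilon>] by simp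
    moreover have "osc r (\<lambda>y. u y + \<phi> y) x \<le> osc r ?a x + (osc r (\<lambda>y. ?T y + \<phi> y) x + osc r ?b x)"
    proof -
      have "osc r (\<lambda>y. u y + \<phi> y) x = osc r (\<lambda>y. ?a y + ((?T y + \<phi> y) + ?b y)) x"
        by (rule osc_cong) (auto simp: min_def max_def)
      also have "\<dots> \<le> osc r ?a x + osc r (\<lambda>y. (?T y + \<phi> y) + ?b y) x"
        by (intro osc_add_le tame_add la lT \<phi> r)
      also have "osc r (\<lambda>y. (?T y + \<phi> y) + ?b y) x \<le> osc r (\<lambda>y. ?T y + \<phi> y) x + osc r ?b x"
        by (intro osc_add_le tame_add la lT \<phi> r)
      finally show ?thesis by simp
    qed
    ultimately show ?thesis by linarith
  qed
  then have "(\<integral>x. osc r (\<lambda>y. u y + \<phi> y) x - osc r u x \<partial>lborel) \<le> (\<integral>x. osc r (\<lambda>y. ?T y + \<phi> y) x - osc r ?T x \<partial>lborel)"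
    by (intro integral_mono integrable_compact_support[where R="N + r"] tame_diff tame_osc tame_add lu lT \<phi> r)
      (auto simp: osc_perturb_outside[OF r supp])
  then have "(\<integral>x. osc r (\<lambda>y. u y + \<phi> y) x - osc r u x \<partial>lborel) / (2 * r)
      \<le> (\<integral>x. osc r (\<lambda>y. ?T y + \<phi> y) x - osc r ?T x \<partial>lborel) / (2 * r)"
    using r by (intro divide_right_mono) auto
  moreover have "0 \<le> (\<integral>x. osc r (\<lambda>y. u y + \<phi> y) x - osc r u x \<partial>lborel) / (2 * r) + (\<integral>x. g x * \<phi> x \<partial>lborel)"
    using u a unfolding locally_minimal_def by blast
  ultimately show "0 \<le> (\<integral>x. osc r (\<lambda>y. ?T y + \<phi> y) x - osc r ?T x \<partial>lborel) / (2 * r) + (\<integral>x. g x * \<phi> x \<partial>lborel)"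
    by linarith
qed


section \<open>Precise representatives\<close>

text \<open>Every value of a precise function is approached on sets of positive measure.  Consequently suprema
  and infima over open sets agree with the essential ones.\<close>
definition precise :: "(real^'n \<Rightarrow> real) \<Rightarrow> bool" where
  "precise u \<longleftrightarrow> (\<forall>x t \<rho>. 0 < \<rho> \<longrightarrow>
     (t < u x \<longrightarrow> \<not> negligible {y \<in> ball x \<rho>. t < u y}) \<and>
     (u x < t \<longrightarrow> \<not> negligible {y \<in> ball x \<rho>. u y < t}))"

lemma precise_le:
  assumes u: "precise u" and G: "open G" "negligible {y \<in> G. t < u y}" and y: "y \<in> G"
  shows "u y \<le> t"
proof (rule ccontr)
  assume "\<not> ?thesis"
  then have t: "t < u y" by simp
  obtain \<rho> where \<rho>: "0 < \<rho>" "ball y \<rho> \<subseteq> G" using G(1) y open_contains_ball by blast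
  have "negligible {z \<in> ball y \<rho>. t < u z}" by (rule negligible_subset[OF G(2)]) (use \<rho> in auto)
  with u t \<rho>(1) show False unfolding precise_def by blast
qed

lemma precise_minus: "precise u \<Longrightarrow> precise (\<lambda>x. - u x)"
  unfolding precise_def less_minus_iff[of _ "u _"] minus_less_iff[of "u _"] by blast

lemma precise_ge:
  assumes u: "precise u" and G: "open G" "negligible {y \<in> G. u y < t}" and y: "y \<in> G"
  shows "t \<le> u y"
  using precise_le[OF precise_minus[OF u] G(1) _ y, of "- t"] G(2) by simp

text \<open>Together with the next lemma this makes the exceptional set of a representative a Borel null set.\<close>
lemma open_locally_null: "open {x. \<exists>\<rho>>0. negligible {y \<in> ball x \<rho>. Q y}}"
  unfolding open_contains_ball
proof
  fix x assume "x \<in> {x. \<exists>\<rho>>0. negligible {y \<in> ball x \<rho>. Q y}}"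
  then obtain \<rho> where \<rho>: "0 < \<rho>" "negligible {y \<in> ball x \<rho>. Q y}" by auto
  have "ball x \<rho> \<subseteq> {x. \<exists>\<rho>>0. negligible {y \<in> ball x \<rho>. Q y}}"
  proof
    fix y assume y: "y \<in> ball x \<rho>"
    then obtain \<delta> where \<delta>: "0 < \<delta>" "ball y \<delta> \<subseteq> ball x \<rho>" using open_ball open_contains_ball by blast
    have "negligible {z \<in> ball y \<delta>. Q z}" by (rule negligible_subset[OF \<rho>(2)]) (use \<delta> in auto)
    then show "y \<in> {x. \<exists>\<rho>>0. negligible {y \<in> ball x \<rho>. Q y}}" using \<delta>(1) by blast
  qed
  then show "\<exists>e>0. ball x e \<subseteq> {x. \<exists>\<rho>>0. negligible {y \<in> ball x \<rho>. Q y}}" using \<rho> by blast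
qed

lemma negligible_locally_null: "negligible ({x. Q x} \<inter> {x. \<exists>\<rho>>0. negligible {y \<in> ball x \<rho>. Q y}})"
  (is "negligible ?S")
  unfolding locally_negligible_alt[of ?S]
proof
  fix x assume x: "x \<in> ?S"
  then obtain \<rho> where \<rho>: "0 < \<rho>" "negligible {y \<in> ball x \<rho>. Q y}" by auto
  have "negligible (?S \<inter> ball x \<rho>)" by (rule negligible_subset[OF \<rho>(2)]) auto
  with x \<rho>(1) show "\<exists>V. openin (top_of_set ?S) V \<and> x \<in> V \<and> negligible V"
    by (intro exI[of _ "?S \<inter> ball x \<rho>"]) (auto simp: openin_open_Int)
qed

lemma negligible_translate_iff: "negligible {y. P (y + k)} \<longleftrightarrow> negligible {y::real^'n. P y}"
proof -
  have "(+) k ` {y. P (y + k)} = {y. P y}"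
    by (auto simp: image_iff add.commute) (metis add.commute diff_add_cancel)
  then show ?thesis using negligible_translation[of "{y. P (y + k)}" k] negligible_translation_rev[of k "{y. P (y + k)}"]
    by metis
qed

text \<open>The values to be changed are those outside the interval between the approximate lower and upper
  limits at the point; testing rational heights shows that they form a null set \<open>Z\<close>.  On \<open>Z\<close> the essential
  upper limit \<open>V\<close> is used instead.\<close>
lemma precise_representative:
  fixes v :: "real^'n \<Rightarrow> real"
  assumes v: "v \<in> borel_measurable borel" and ab: "\<And>x. a \<le> v x \<and> v x \<le> b"
  shows "\<exists>u. u \<in> borel_measurable borel \<and> precise u \<and> negligible {x. u x \<noteq> v x} \<and>
    (\<forall>x. a \<le> u x \<and> u x \<le> b) \<and> (int_periodic v \<longrightarrow> int_periodic u)"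
proof -
  note [measurable] = v
  define U where "U t = {x. \<exists>\<rho>>0. negligible {y \<in> ball x \<rho>. t < v y}}" for t
  define D where "D t = {x. \<exists>\<rho>>0. negligible {y \<in> ball x \<rho>. v y < t}}" for t
  have oU: "open (U t)" and oD: "open (D t)" for t unfolding U_def D_def by (rule open_locally_null)+
  have nU: "negligible ({x. t < v x} \<inter> U t)" and nD: "negligible ({x. v x < t} \<inter> D t)" for t
    unfolding U_def D_def by (rule negligible_locally_null)+
  define Z where "Z = (\<Union>t\<in>\<rat>. ({x. t < v x} \<inter> U t) \<union> ({x. v x < t} \<inter> D t))"
  have nZ: "negligible Z"
    unfolding Z_def using countable_rat nU nD
    by (intro negligible_countable_Union) (auto intro: negligible_Un)
  have bZ: "Z \<in> sets borel"
  proof -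
    have "{x. t < v x} \<in> sets borel" "{x. v x < t} \<in> sets borel" for t by measurable
    then show ?thesis
      unfolding Z_def using countable_rat oU oD by (intro sets.countable_UN'' sets.Un sets.Int) auto
  qed
  have Ub: "U t = UNIV" if "b \<le> t" for t
  proof -
    have e: "{y \<in> ball x 1. t < v y} = {}" for x using ab that by (auto simp: not_less intro: order_trans)
    have "x \<in> U t" for x unfolding U_def mem_Collect_eq by (intro exI[of _ 1]) (simp only: e, simp)
    then show ?thesis by blast
  qed
  have nball: "\<not> negligible (ball x \<rho>)" if "0 < \<rho>" for x :: "real^'n" and \<rho>
    using that open_not_negligible[of "ball x \<rho>"] by auto
  have Ua: "U t = {}" if "t < a" for t
  proof -
    have "{y \<in> ball x \<rho>. t < v y} = ball x \<rho>" for x \<rho> using ab that by (auto intro: less_le_trans)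
    then show ?thesis using nball by (auto simp: U_def)
  qed
  define V where "V x = Inf {t. x \<in> U t}" for x
  have ne: "b \<in> {t. x \<in> U t}" for x using Ub[of b] by simp
  have lb: "a \<le> t" if "x \<in> U t" for x t using Ua[of t] that by (cases "t < a") auto
  have bdd: "bdd_below {t. x \<in> U t}" for x using lb by (intro bdd_belowI) auto
  have V_less: "V x < t \<longleftrightarrow> (\<exists>s<t. x \<in> U s)" for x t
    unfolding V_def using cInf_less_iff[OF _ bdd, of x t] ne[of x] by auto
  have Vb: "V \<in> borel_measurable borel"
  proof (rule borel_measurableI_less)
    fix t
    have "{x. V x < t} = (\<Union>s\<in>{..<t}. U s)" using V_less by auto
    then show "{x \<in> space borel. V x < t} \<in> sets borel" using oU by (auto intro!: borel_open)
  qed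
  define u where "u x = (if x \<in> Z then V x else v x)" for x
  have ub: "u \<in> borel_measurable borel"
    unfolding u_def[abs_def] using bZ Vb v by (intro measurable_If_set) auto
  have nuv: "negligible {x. u x \<noteq> v x}"
    by (rule negligible_subset[OF nZ]) (auto simp: u_def)
  have transfer: "negligible {y \<in> A. Q (u y)} \<longleftrightarrow> negligible {y \<in> A. Q (v y)}" for A Q
  proof
    assume "negligible {y \<in> A. Q (u y)}"
    then show "negligible {y \<in> A. Q (v y)}"
      by (rule negligible_subset[OF negligible_Un[OF _ nuv]]) auto
  next
    assume "negligible {y \<in> A. Q (v y)}"
    then show "negligible {y \<in> A. Q (u y)}"
      by (rule negligible_subset[OF negligible_Un[OF _ nuv]]) auto
  qed
  have pr: "precise u"
    unfolding precise_def
  proof (intro allI impI conjI)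
    fix x t and \<rho> :: real assume \<rho>: "0 < \<rho>"
    show "\<not> negligible {y \<in> ball x \<rho>. t < u y}" if t: "t < u x"
    proof
      assume "negligible {y \<in> ball x \<rho>. t < u y}"
      then have n: "negligible {y \<in> ball x \<rho>. t < v y}" using transfer[of "ball x \<rho>" "\<lambda>z. t < z"] by simp
      obtain q where q: "q \<in> \<rat>" "t < q" "q < u x" using Rats_dense_in_real[OF t] by auto
      have "negligible {y \<in> ball x \<rho>. q < v y}" by (rule negligible_subset[OF n]) (use q in auto)
      then have "x \<in> U q" using \<rho> by (auto simp: U_def)
      have "x \<in> Z"
      proof (rule ccontr)
        assume "x \<notin> Z"
        then have "q < v x" using q by (simp add: u_def)
        with \<open>x \<in> U q\<close> q \<open>x \<notin> Z\<close> show False by (auto simp: Z_def)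
      qed
      then have "q < V x" using q by (simp add: u_def)
      moreover have "V x \<le> q" unfolding V_def using \<open>x \<in> U q\<close> by (intro cInf_lower bdd) auto
      ultimately show False by simp
    qed
    show "\<not> negligible {y \<in> ball x \<rho>. u y < t}" if t: "u x < t"
    proof
      assume "negligible {y \<in> ball x \<rho>. u y < t}"
      then have n: "negligible {y \<in> ball x \<rho>. v y < t}" using transfer[of "ball x \<rho>" "\<lambda>z. z < t"] by simp
      obtain q where q: "q \<in> \<rat>" "u x < q" "q < t" using Rats_dense_in_real[OF t] by auto
      have "negligible {y \<in> ball x \<rho>. v y < q}" by (rule negligible_subset[OF n]) (use q in auto)
      then have "x \<in> D q" using \<rho> by (auto simp: D_def)
      have "x \<in> Z"
      proof (rule ccontr)
        assume "x \<notin> Z"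
        then have "v x < q" using q by (simp add: u_def)
        with \<open>x \<in> D q\<close> q \<open>x \<notin> Z\<close> show False by (auto simp: Z_def)
      qed
      then have "V x < q" using q by (simp add: u_def)
      then obtain s where s: "s < q" "x \<in> U s" using V_less by blast
      then obtain \<rho>' where \<rho>': "0 < \<rho>'" "negligible {y \<in> ball x \<rho>'. s < v y}" by (auto simp: U_def)
      have "negligible (ball x (min \<rho> \<rho>'))"
        by (rule negligible_subset[OF negligible_Un[OF n \<rho>'(2)]]) (use s q in auto)
      then show False using nball \<rho> \<rho>' by auto
    qed
  qed
  have bnd: "a \<le> u x \<and> u x \<le> b" for x
  proof (cases "x \<in> Z")
    case True
    then show ?thesis unfolding u_def V_def using lb ne[of x]
      by (auto intro!: cInf_greatest cInf_lower bdd)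
  qed (use ab in \<open>simp add: u_def\<close>)
  have per: "int_periodic u" if vp: "int_periodic v"
    unfolding int_periodic_def
  proof (intro allI ballI)
    fix x k :: "real^'n" assume k: "k \<in> int_vecs"
    have vk: "v (y + k) = v y" for y using vp k by (simp add: int_periodic_def)
    have b: "y + k \<in> ball (x + k) \<rho> \<longleftrightarrow> y \<in> ball x \<rho>" for x y and \<rho> :: real by (simp add: dist_norm)
    have "negligible {y \<in> ball (x + k) \<rho>. Q (v y)} \<longleftrightarrow> negligible {y \<in> ball x \<rho>. Q (v y)}" for x \<rho> Q
      using negligible_translate_iff[of "\<lambda>y. y \<in> ball (x + k) \<rho> \<and> Q (v y)" k] unfolding b vk by simp
    from this[of _ _ "\<lambda>z. _ < z"] this[of _ _ "\<lambda>z. z < _"]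
    have UD: "x + k \<in> U t \<longleftrightarrow> x \<in> U t" "x + k \<in> D t \<longleftrightarrow> x \<in> D t" for x t
      by (simp_all add: U_def D_def)
    have "x + k \<in> Z \<longleftrightarrow> x \<in> Z" by (simp add: Z_def UD vk)
    moreover have "V (x + k) = V x" by (simp add: V_def UD)
    ultimately show "u (x + k) = u x" by (simp add: u_def vk)
  qed
  show ?thesis using ub pr nuv bnd per by (intro exI[of _ u]) blast
qed

lemma precise_add_continuous:
  fixes u c :: "real^'n \<Rightarrow> real"
  assumes u: "precise u" and c: "continuous_on UNIV c"
  shows "precise (\<lambda>x. u x + c x)"
proof -
  have up: "\<not> negligible {y \<in> ball x \<rho>. t < u y + c y}"
    if u: "precise u" and c: "continuous_on UNIV c" and \<rho>: "0 < \<rho>" and t: "t < u x + c x"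
    for u c :: "real^'n \<Rightarrow> real" and x t \<rho>
  proof
    assume n: "negligible {y \<in> ball x \<rho>. t < u y + c y}"
    define e where "e = (u x + c x - t) / 2"
    have e: "0 < e" using t by (simp add: e_def)
    obtain \<delta>' where \<delta>': "0 < \<delta>'" "\<forall>y. dist y x < \<delta>' \<longrightarrow> dist (c y) (c x) < e"
      using c e unfolding continuous_on_iff by (metis UNIV_I)
    define \<delta> where "\<delta> = min \<delta>' \<rho>"
    have \<delta>: "0 < \<delta>" "\<delta> \<le> \<rho>" "\<forall>y\<in>ball x \<delta>. \<bar>c y - c x\<bar> < e"
      using \<delta>' \<rho> by (auto simp: \<delta>_def dist_commute dist_real_def)
    have "negligible {y \<in> ball x \<delta>. u x - e < u y}"
    proof (rule negligible_subset[OF n], rule subsetI)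
      fix y assume y: "y \<in> {y \<in> ball x \<delta>. u x - e < u y}"
      then have "\<bar>c y - c x\<bar> < e" using \<delta> by blast
      moreover have "2 * e = u x + c x - t" "u x - e < u y" using y by (auto simp: e_def)
      ultimately have "t < u y + c y" by linarith
      then show "y \<in> {y \<in> ball x \<rho>. t < u y + c y}" using y \<delta> by auto
    qed
    moreover have "u x - e < u x" using e by simp
    ultimately show False using u \<delta>(1) unfolding precise_def by blast
  qed
  have "\<not> negligible {y \<in> ball x \<rho>. u y + c y < t}" if "0 < \<rho>" "u x + c x < t" for x t and \<rho> :: real
  proof -
    have "{y \<in> ball x \<rho>. - t < - u y + - c y} = {y \<in> ball x \<rho>. u y + c y < t}" by auto
    then show ?thesis
      using up[OF precise_minus[OF u] continuous_on_minus[OF c] that(1), of "- t" x] that(2) by simp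
  qed
  with up[OF u c] show ?thesis unfolding precise_def by blast
qed

lemma osc_precise_le:
  assumes u: "precise u" "tame u" and w: "tame w" and eq: "negligible {x. u x \<noteq> w x}" and r: "0 < r"
  shows "osc r u x \<le> osc r w x"
proof -
  have "u y \<le> ball_sup r w x" if y: "y \<in> ball x r" for y
  proof (rule precise_le[OF u(1) open_ball _ y])
    show "negligible {y \<in> ball x r. ball_sup r w x < u y}"
      by (rule negligible_subset[OF eq]) (use ball_sup_upper[OF w] in \<open>force\<close>)
  qed
  moreover have "- ball_sup r (\<lambda>y. - w y) x \<le> u y" if y: "y \<in> ball x r" for y
  proof (rule precise_ge[OF u(1) open_ball _ y])
    show "negligible {y \<in> ball x r. u y < - ball_sup r (\<lambda>y. - w y) x}"
      by (rule negligible_subset[OF eq]) (use ball_sup_upper[OF tame_minus[OF w], of _ x r] in \<open>force\<close>)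
  qed
  ultimately have "osc r u x \<le> ball_sup r w x - (- ball_sup r (\<lambda>y. - w y) x)" by (intro osc_le r) auto
  then show ?thesis by (simp add: osc_def)
qed


section \<open>Minimality of level sets\<close>

lemma negligible_borel_null: "S \<in> sets borel \<Longrightarrow> negligible S \<Longrightarrow> S \<in> null_sets lborel"
  by (auto simp: negligible_iff_null_sets null_sets_def)

lemma tube_cong:
  assumes "negligible {y \<in> ball x r. y \<in> F \<longleftrightarrow> y \<notin> G}"
  shows "x \<in> tube r F \<longleftrightarrow> x \<in> tube r G"
proof -
  have "negligible (ball x r \<inter> F) \<longleftrightarrow> negligible (ball x r \<inter> G)" "negligible (ball x r - F) \<longleftrightarrow> negligible (ball x r - G)"
    by (safe; rule negligible_subset[OF negligible_Un[OF assms]], assumption, blast)+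
  then show ?thesis by (simp add: tube_def negligible_iff_null_sets)
qed

text \<open>This identifies the tube of a set, up to the factor \<open>1 / (2 r)\<close> the density of its perimeter, with
  the oscillation of a precise version of its indicator.\<close>
lemma osc_precise_indicator:
  fixes f :: "real^'n \<Rightarrow> real"
  assumes f: "precise f" "tame f" "\<And>x. 0 \<le> f x \<and> f x \<le> 1" and F: "negligible {x. f x \<noteq> indicator F x}" and r: "0 < r"
  shows "osc r f x = indicator (tube r F) x"
proof (cases "x \<in> tube r F")
  case True
  have "\<not> ball x r \<inter> F \<subseteq> {x. f x \<noteq> indicator F x}" "\<not> ball x r - F \<subseteq> {x. f x \<noteq> indicator F x}"
    using True negligible_subset[OF F] by (auto simp: tube_def negligible_iff_null_sets)
  then obtain y z where "y \<in> ball x r" "f y = 1" "z \<in> ball x r" "f z = 0" by (auto simp: indicator_def split: if_splits)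
  then have "1 \<le> osc r f x" using osc_ge[OF f(2), of y x r z] by simp
  moreover have "osc r f x \<le> 1 - 0" using f(3) by (intro osc_le r) auto
  ultimately show ?thesis using True by simp
next
  case False
  have "osc r f x \<le> 0"
  proof (cases "negligible (ball x r \<inter> F)")
    case True
    have "f y \<le> 0" if "y \<in> ball x r" for y
      by (rule precise_le[OF f(1) open_ball _ that], rule negligible_subset[OF negligible_Un[OF True F]])
        (auto simp: indicator_def)
    then have "osc r f x \<le> 0 - 0" using f(3) by (intro osc_le r) auto
    then show ?thesis by simp
  next
    case nF: False
    then have n: "negligible (ball x r - F)" using False by (auto simp: tube_def negligible_iff_null_sets)
    have "1 \<le> f y" if "y \<in> ball x r" for y
      by (rule precise_ge[OF f(1) open_ball _ that], rule negligible_subset[OF negligible_Un[OF n F]])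
        (auto simp: indicator_def)
    then have "osc r f x \<le> 1 - 1" using f(3) by (intro osc_le r) auto
    then show ?thesis by simp
  qed
  moreover have "0 \<le> osc r f x" by (rule osc_nonneg[OF f(2) r])
  ultimately show ?thesis using False by simp
qed

lemma precise_indicator_exists:
  fixes F :: "(real^'n) set"
  assumes "F \<in> sets borel"
  shows "\<exists>f. precise f \<and> tame f \<and> (\<forall>x. 0 \<le> f x \<and> f x \<le> 1) \<and> negligible {x. f x \<noteq> indicator F x}"
proof -
  obtain f where f: "f \<in> borel_measurable borel" "precise f" "negligible {x. f x \<noteq> indicator F x}" "\<And>x. 0 \<le> f x \<and> f x \<le> 1"
    using precise_representative[of "indicator F" 0 1] assms by (auto simp: indicator_def)
  moreover have "tame f" using f(1,4) by (intro tame_of_bound[where C=1]) (auto simp: abs_le_iff intro: order_trans[of _ 0])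
  ultimately show ?thesis by blast
qed

lemma tame_tube:
  fixes F :: "(real^'n) set"
  assumes "F \<in> sets borel" "0 < r" shows "tame (indicator (tube r F))"
proof -
  obtain f where f: "precise f" "tame f" "\<And>x. 0 \<le> f x \<and> f x \<le> 1" "negligible {x. f x \<noteq> indicator F x}"
    using precise_indicator_exists[OF assms(1)] by blast
  have "osc r f = indicator (tube r F)" using osc_precise_indicator[OF f assms(2)] by auto
  then show ?thesis using tame_osc[OF f(2) assms(2)] by simp
qed

text \<open>The slices \<open>H j\<close> increase to the indicator of \<open>E\<close>.  The competitor \<open>W j\<close> equals a precise version of the
  indicator of \<open>F\<close> in the ball \<open>?K\<close> and \<open>H j\<close> outside.  In the limit the oscillation of \<open>H j\<close> is at least
  that of the indicator of \<open>E\<close>, and the oscillation of \<open>W j\<close> must be at most that of the indicator of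
  \<open>F\<close>.  The latter could fail only at a point \<open>x\<close> where \<open>F\<close> fills \<open>ball x r\<close> while the infimum of \<open>u\<close>
  on the part of the ball outside \<open>?K\<close> is exactly \<open>s\<close>, so that no slice reaches the value one there.
  The last hypothesis excludes this for almost every \<open>x\<close>; giving \<open>u\<close> a value \<open>c > s\<close> on \<open>?K\<close> makes the
  infimum ignore \<open>?K\<close>.\<close>
lemma level_set_minimal:
  fixes u g :: "real^'n \<Rightarrow> real" and N s c :: real
  assumes u: "locally_minimal r g u" "precise u" and r: "0 < r" "r < 1" and g: "tame g" and F: "F \<in> sets borel"
  defines "E \<equiv> {x. s < u x}"
  assumes FE: "negligible {x. N < norm x \<and> (x \<in> F \<longleftrightarrow> x \<notin> E)}"
    and s: "s < c" "AE x in lborel. ball_sup r (\<lambda>y. - (if y \<in> cball 0 N then c else u y)) x \<noteq> - s"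
  shows "0 \<le> (\<integral>x. indicator (tube r F) x - indicator (tube r E) x \<partial>lborel) / (2 * r)
    + (\<integral>x. indicator (cball 0 N) x * (g x * (indicator F x - indicator E x)) \<partial>lborel)"
proof -
  let ?B = "{x. N < norm x \<and> (x \<in> F \<longleftrightarrow> x \<notin> E)}" and ?K = "cball (0::real^'n) N"
  have lu: "tame u" using u(1) by (simp add: locally_minimal_def)
  have Eb: "E \<in> sets borel" unfolding E_def using tame_borel[OF lu] by measurable
  obtain f where f: "precise f" "tame f" "\<And>x. 0 \<le> f x \<and> f x \<le> 1" "negligible {x. f x \<noteq> indicator F x}"
    using precise_indicator_exists[OF F] by blast
  define H where "H j x = real (Suc j) * min (max (u x - s) 0) (1 / real (Suc j))" for j x
  have H01: "0 \<le> H j x" "H j x \<le> 1" for j x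
  proof -
    show "0 \<le> H j x" by (simp add: H_def)
    have "H j x \<le> real (Suc j) * (1 / real (Suc j))" unfolding H_def by (intro mult_left_mono) auto
    then show "H j x \<le> 1" by simp
  qed
  have H1: "H j x = 1" if "1 / real (Suc j) \<le> u x - s" for j x
  proof -
    have "min (max (u x - s) 0) (1 / real (Suc j)) = 1 / real (Suc j)"
      by (rule min.absorb2) (use that in \<open>auto simp: le_max_iff_disj\<close>)
    then show ?thesis by (simp add: H_def)
  qed
  have H0: "H j x = 0" if "u x \<le> s" for j x using that by (simp add: H_def)
  have locH: "locally_minimal r g (H j)" for j
    unfolding H_def[abs_def] by (intro locally_minimal_scale locally_minimal_slice u r) auto
  have lH: "tame (H j)" for j using locH by (simp add: locally_minimal_def)
  define \<phi> where "\<phi> j x = (if x \<in> ?K then f x - H j x else 0)" for j x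
  have l\<phi>: "tame (\<phi> j)" for j
    unfolding \<phi>_def[abs_def] by (intro tame_if tame_intros f lH) auto
  have \<phi>0: "\<phi> j x = 0" if "N < norm x" for j x using that by (simp add: \<phi>_def)
  have \<phi>1: "\<bar>\<phi> j x\<bar> \<le> indicator ?K x" for j x
    using f(3)[of x] H01[of j x] by (auto simp: \<phi>_def indicator_def abs_le_iff)
  define W where "W j x = H j x + \<phi> j x" for j x
  have WK: "W j x = f x" if "x \<in> ?K" for j x using that by (simp add: W_def \<phi>_def)
  have WH: "W j x = H j x" if "x \<notin> ?K" for j x using that by (simp add: W_def \<phi>_def)
  have W01: "0 \<le> W j x \<and> W j x \<le> 1" for j x
    using f(3)[of x] H01[of j x] WK[of x j] WH[of x j] by (cases "x \<in> ?K") auto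
  have lW: "tame (W j)" for j unfolding W_def[abs_def] by (intro tame_intros lH l\<phi>)
  define \<psi> where "\<psi> j x = osc r (W j) x - osc r (H j) x" for j x
  have l\<psi>: "tame (\<psi> j)" for j unfolding \<psi>_def[abs_def] by (intro tame_intros tame_osc lW lH r)
  have min: "0 \<le> (\<integral>x. \<psi> j x \<partial>lborel) / (2 * r) + (\<integral>x. g x * \<phi> j x \<partial>lborel)" for j
    using locH[of j] l\<phi>[of j] \<phi>0 unfolding locally_minimal_def \<psi>_def W_def[abs_def] by blast
  let ?cF = "indicator (tube r F) :: real^'n \<Rightarrow> real" and ?cE = "indicator (tube r E) :: real^'n \<Rightarrow> real"
  have lc: "tame (\<lambda>x. ?cF x - ?cE x)" by (intro tame_diff tame_tube F Eb r)
  \<comment> \<open>Only an asymptotic upper bound on \<open>\<psi>\<close> is available, so dominated convergence is applied to this majorant.\<close>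
  define q where "q j x = max (\<psi> j x) (?cF x - ?cE x)" for j x
  have lq: "tame (q j)" for j unfolding q_def[abs_def] by (intro tame_max l\<psi> lc)
  have out: "\<psi> j x = 0" "?cF x - ?cE x = 0" if x: "N + r < norm x" for j x
  proof -
    show "\<psi> j x = 0"
      unfolding \<psi>_def W_def[abs_def] using osc_perturb_outside[OF r(1) \<phi>0[of _ j] x] by simp
    have "negligible {y \<in> ball x r. y \<in> F \<longleftrightarrow> y \<notin> E}"
    proof (rule negligible_subset[OF FE], rule subsetI)
      fix y assume "y \<in> {y \<in> ball x r. y \<in> F \<longleftrightarrow> y \<notin> E}"
      then show "y \<in> ?B" using norm_ball_le[of y x r] x by auto
    qed
    from tube_cong[OF this] show "?cF x - ?cE x = 0" by (simp add: indicator_def)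
  qed
  have osc01: "0 \<le> osc r (W j) x" "osc r (W j) x \<le> 1" "0 \<le> osc r (H j) x" "osc r (H j) x \<le> 1" for j x
  proof -
    have "osc r (W j) x \<le> 1 - 0" by (rule osc_le[OF r(1)]) (rule W01)
    moreover have "osc r (H j) x \<le> 1 - 0" by (rule osc_le[OF r(1)]) (simp add: H01)
    ultimately show "osc r (W j) x \<le> 1" "osc r (H j) x \<le> 1" by simp_all
  qed (intro osc_nonneg lW lH r)+
  have q1: "\<bar>q j x\<bar> \<le> indicator (cball 0 (N + r)) x" for j x
  proof (cases "norm x \<le> N + r")
    case True
    have "\<bar>\<psi> j x\<bar> \<le> 1" using osc01[of j x] by (auto simp: \<psi>_def abs_le_iff)
    moreover have "\<bar>?cF x - ?cE x\<bar> \<le> 1" by (auto simp: indicator_def)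
    ultimately show ?thesis using True by (auto simp: q_def max_def)
  next
    case False
    then show ?thesis using out(1)[of x j] out(2)[of x] by (simp add: q_def)
  qed
  have small: "\<forall>\<^sub>F j in sequentially. 1 / real (Suc j) \<le> e" if "0 < e" for e
    using order_tendstoD(2)[OF LIMSEQ_inverse_real_of_nat that]
    by eventually_elim (simp add: inverse_eq_divide)
  have evE: "\<forall>\<^sub>F j in sequentially. ?cE x \<le> osc r (H j) x" for x
  proof (cases "x \<in> tube r E")
    case True
    then have "ball x r \<inter> E \<notin> null_sets lebesgue" "ball x r - E \<notin> null_sets lebesgue" by (simp_all add: tube_def)
    then have "ball x r \<inter> E \<noteq> {}" "ball x r - E \<noteq> {}" by (metis null_sets.empty_sets)+
    then obtain y z where y: "y \<in> ball x r" "s < u y" and z: "z \<in> ball x r" "u z \<le> s" by (auto simp: E_def not_less)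
    have "\<forall>\<^sub>F j in sequentially. 1 / real (Suc j) \<le> u y - s" using y by (intro small) simp
    then show ?thesis
    proof eventually_elim
      case (elim j)
      then show ?case using osc_ge[OF lH y(1) z(1), of j] H1[OF elim] H0[OF z(2)] True by simp
    qed
  qed (use osc01 in simp)
  have evF: "\<forall>\<^sub>F j in sequentially. osc r (W j) x \<le> ?cF x"
    if bad: "ball_sup r (\<lambda>y. - (if y \<in> ?K then c else u y)) x \<noteq> - s" for x
  proof -
    have oG: "open (ball x r - ?K)" by (intro open_Diff) auto
    consider "x \<in> tube r F" | "negligible (ball x r \<inter> F)" | "negligible (ball x r - F)"
      by (auto simp: tube_def negligible_iff_null_sets)
    then show ?thesis
    proof cases
      case 1 then show ?thesis using osc01 by simp
    next
      case 2
      have fy: "f y \<le> 0" if "y \<in> ball x r" for y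
        by (rule precise_le[OF f(1) open_ball _ that], rule negligible_subset[OF negligible_Un[OF 2 f(4)]])
          (auto simp: indicator_def)
      have uy: "u y \<le> s" if "y \<in> ball x r - ?K" for y
        by (rule precise_le[OF u(2) oG _ that], rule negligible_subset[OF negligible_Un[OF 2 FE]])
          (auto simp: E_def)
      have "osc r (W j) x \<le> 0 - 0" for j
      proof (rule osc_le[OF r(1)])
        fix y assume y: "y \<in> ball x r"
        show "0 \<le> W j y \<and> W j y \<le> 0"
          using y fy[of y] uy[of y] WK[of y j] WH[of y j] H0[of y j] W01[of j y] by (cases "y \<in> ?K") auto
      qed
      then have "osc r (W j) x \<le> ?cF x" for j
        by (rule order_trans) (simp add: indicator_def)
      then show ?thesis by simp
    next
      case 3
      have fy: "1 \<le> f y" if "y \<in> ball x r" for y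
        by (rule precise_ge[OF f(1) open_ball _ that], rule negligible_subset[OF negligible_Un[OF 3 f(4)]])
          (auto simp: indicator_def)
      have uy: "s \<le> u y" if "y \<in> ball x r - ?K" for y
        by (rule precise_ge[OF u(2) oG _ that], rule negligible_subset[OF negligible_Un[OF 3 FE]])
          (auto simp: E_def)
      let ?t = "\<lambda>y. - (if y \<in> ?K then c else u y)"
      have lt: "tame ?t" by (intro tame_minus tame_if tame_const lu) auto
      have "ball_sup r ?t x \<le> - s" using uy s(1) by (intro ball_sup_least r) auto
      then have e: "0 < - s - ball_sup r ?t x" using bad by simp
      from small[OF this] show ?thesis
      proof eventually_elim
        case (elim j)
        have "osc r (W j) x \<le> 1 - 1"
        proof (rule osc_le[OF r(1)])
          fix y assume y: "y \<in> ball x r"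
          have "W j y = 1"
          proof (cases "y \<in> ?K")
            case True then show ?thesis using WK[of y j] fy[OF y] f(3)[of y] by auto
          next
            case False
            then have "- u y \<le> ball_sup r ?t x" using ball_sup_upper[OF lt y] by simp
            then have "1 / real (Suc j) \<le> u y - s" using elim by linarith
            from H1[OF this] show ?thesis using WH[OF False] by simp
          qed
          then show "1 \<le> W j y \<and> W j y \<le> 1" by simp
        qed
        then show ?case by (rule order_trans) (simp add: indicator_def)
      qed
    qed
  qed
  have limq: "(\<lambda>j. \<integral>x. q j x \<partial>lborel) \<longlonglongrightarrow> (\<integral>x. ?cF x - ?cE x \<partial>lborel)"
  proof (rule integral_dominated_convergence[where w="indicator (cball 0 (N + r))"])
    show "AE x in lborel. (\<lambda>j. q j x) \<longlonglongrightarrow> ?cF x - ?cE x"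
      using s(2)
    proof eventually_elim
      case (elim x)
      have "\<forall>\<^sub>F j in sequentially. q j x = ?cF x - ?cE x"
        using evF[OF elim] evE[of x] by eventually_elim (simp add: q_def \<psi>_def max_def)
      then show ?case by (rule tendsto_eventually)
    qed
    show "integrable lborel (indicator (cball (0::real^'n) (N + r)) :: _ \<Rightarrow> real)"
      using emeasure_bounded_finite[OF bounded_cball, of "0::real^'n" "N + r"] by (intro integrable_real_indicator) auto
  qed (use q1 lq lc tame_borel in auto)
  have lim\<phi>: "(\<lambda>j. \<integral>x. g x * \<phi> j x \<partial>lborel) \<longlonglongrightarrow> (\<integral>x. indicator ?K x * (g x * (indicator F x - indicator E x)) \<partial>lborel)"
  proof (rule integral_dominated_convergence[where w="\<lambda>x. indicator ?K x * \<bar>g x\<bar>"])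
    have "{x. f x \<noteq> indicator F x} \<in> null_sets lborel"
    proof (rule negligible_borel_null[OF _ f(4)])
      have [measurable]: "f \<in> borel_measurable borel" "F \<in> sets borel" using f(2) F by (auto intro: tame_borel)
      show "{x. f x \<noteq> indicator F x} \<in> sets borel" by measurable
    qed
    then have "AE x in lborel. f x = indicator F x" by (rule AE_I') auto
    then show "AE x in lborel. (\<lambda>j. g x * \<phi> j x) \<longlonglongrightarrow> indicator ?K x * (g x * (indicator F x - indicator E x))"
    proof eventually_elim
      case (elim x)
      have "(\<lambda>j. H j x) \<longlonglongrightarrow> indicator E x"
      proof (rule tendsto_eventually, cases "s < u x")
        case True
        then have "\<forall>\<^sub>F j in sequentially. 1 / real (Suc j) \<le> u x - s" by (intro small) simp
        then show "\<forall>\<^sub>F j in sequentially. H j x = indicator E x"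
          by eventually_elim (use True H1 in \<open>simp add: E_def\<close>)
      next
        case False
        then show "\<forall>\<^sub>F j in sequentially. H j x = indicator E x" using H0[of x] by (simp add: E_def)
      qed
      then have "(\<lambda>j. g x * (indicator ?K x * (f x - H j x))) \<longlonglongrightarrow> g x * (indicator ?K x * (f x - indicator E x))"
        by (intro tendsto_intros)
      moreover have "g x * \<phi> j x = g x * (indicator ?K x * (f x - H j x))" for j by (simp add: \<phi>_def indicator_def)
      moreover have "indicator ?K x * (g x * (indicator F x - indicator E x)) = g x * (indicator ?K x * (f x - indicator E x))"
        using elim by simp
      ultimately show ?case by (simp only:)
    qed
    show "AE x in lborel. norm (g x * \<phi> j x) \<le> indicator ?K x * \<bar>g x\<bar>" for j
    proof (rule AE_I2)
      fix x show "norm (g x * \<phi> j x) \<le> indicator ?K x * \<bar>g x\<bar>"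
        using mult_left_mono[OF \<phi>1[of j x] abs_ge_zero[of "g x"]] by (simp add: abs_mult mult.commute)
    qed
    show "integrable lborel (\<lambda>x. indicator ?K x * \<bar>g x\<bar>)"
      by (intro integrable_compact_support[where R=N] tame_intros tame_indicator g) auto
    show "(\<lambda>x. indicator ?K x * (g x * (indicator F x - indicator E x))) \<in> borel_measurable lborel"
    proof -
      have "tame (\<lambda>x. indicator ?K x * (g x * (indicator F x - indicator E x)))"
        by (intro tame_mult tame_diff tame_indicator g F Eb) auto
      from tame_borel[OF this] show ?thesis by simp
    qed
    show "(\<lambda>x. g x * \<phi> j x) \<in> borel_measurable lborel" for j
      using tame_borel[OF g] tame_borel[OF l\<phi>, of j] by measurable
  qed
  have "0 \<le> (\<integral>x. q j x \<partial>lborel) / (2 * r) + (\<integral>x. g x * \<phi> j x \<partial>lborel)" for j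
  proof -
    have "(\<integral>x. \<psi> j x \<partial>lborel) \<le> (\<integral>x. q j x \<partial>lborel)"
    proof (intro integral_mono integrable_compact_support[where R="N + r"] l\<psi> lq)
      show "q j x = 0" if "N + r < norm x" for x using out(1)[OF that, of j] out(2)[OF that] by (simp add: q_def)
    qed (use out in \<open>auto simp: q_def\<close>)
    then have "(\<integral>x. \<psi> j x \<partial>lborel) / (2 * r) \<le> (\<integral>x. q j x \<partial>lborel) / (2 * r)"
      using r by (intro divide_right_mono) auto
    with min[of j] show ?thesis by linarith
  qed
  then show ?thesis
    using r by (intro LIMSEQ_le_const[OF tendsto_add[OF tendsto_divide[OF limq tendsto_const] lim\<phi>]]) auto
qed

text \<open>On bounded sets the distribution of \<open>w\<close> is a finite measure, which has only countably many atoms.\<close>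
lemma countable_atoms:
  fixes w :: "real^'n \<Rightarrow> real"
  assumes w: "w \<in> borel_measurable borel"
  shows "countable {t. \<not> (AE x in lborel. w x \<noteq> t)}"
proof -
  note [measurable] = w
  define M where "M m = distr (density lborel (indicator (cball (0::real^'n) (real m)))) borel w" for m :: nat
  have fin: "finite_measure (M m)" for m
  proof -
    have "emeasure (density lborel (indicator (cball (0::real^'n) (real m)))) UNIV = emeasure lborel (cball (0::real^'n) (real m))"
      by (subst emeasure_density) (auto intro!: borel_measurable_indicator borel_closed)
    then have "emeasure (density lborel (indicator (cball (0::real^'n) (real m)))) UNIV \<noteq> \<infinity>"
      using emeasure_bounded_finite[OF bounded_cball, of "0::real^'n" "real m"] by simp
    then show ?thesis
      unfolding M_def by (intro finite_measure.finite_measure_distr finite_measureI) auto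
  qed
  have "{t. \<not> (AE x in lborel. w x \<noteq> t)} \<subseteq> (\<Union>m. {t. measure (M m) {t} \<noteq> 0})"
  proof (rule subsetI, rule ccontr)
    fix t assume t: "t \<in> {t. \<not> (AE x in lborel. w x \<noteq> t)}" and "t \<notin> (\<Union>m. {t. measure (M m) {t} \<noteq> 0})"
    then have z: "measure (M m) {t} = 0" for m by blast
    have "cball 0 (real m) \<inter> {x. w x = t} \<in> null_sets lborel" for m
    proof -
      interpret finite_measure "M m" by (rule fin)
      have "emeasure (M m) {t} = 0" using z[of m] by (simp add: emeasure_eq_measure)
      moreover have "emeasure (M m) {t} = emeasure lborel (cball 0 (real m) \<inter> {x. w x = t})"
      proof -
        have A: "{x. w x = t} \<in> sets borel" by measurable
        have "emeasure (M m) {t} = emeasure (density lborel (indicator (cball (0::real^'n) (real m)))) {x. w x = t}"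
          unfolding M_def by (subst emeasure_distr) (auto simp: vimage_def)
        also have "\<dots> = (\<integral>\<^sup>+x. indicator (cball 0 (real m)) x * indicator {x. w x = t} x \<partial>lborel)"
          using A by (intro emeasure_density) (auto intro!: borel_measurable_indicator borel_closed)
        also have "\<dots> = (\<integral>\<^sup>+x. indicator (cball 0 (real m) \<inter> {x. w x = t}) x \<partial>lborel)"
          by (simp add: indicator_inter_arith)
        also have "\<dots> = emeasure lborel (cball 0 (real m) \<inter> {x. w x = t})"
          using A by (intro nn_integral_indicator) auto
        finally show ?thesis .
      qed
      ultimately show ?thesis by (auto simp: null_sets_def)
    qed
    then have "(\<Union>m. cball 0 (real m) \<inter> {x. w x = t}) \<in> null_sets lborel" by (rule null_sets_UN)
    moreover have "(\<Union>m. cball 0 (real m) \<inter> {x. w x = t}) = {x. w x = t}"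
      by (auto intro: real_arch_simple)
    ultimately have "AE x in lborel. w x \<noteq> t" by (intro AE_I') auto
    then show False using t by simp
  qed
  moreover have "countable (\<Union>m. {t. measure (M m) {t} \<noteq> 0})"
    using finite_measure.countable_support[OF fin] by auto
  ultimately show ?thesis by (rule countable_subset)
qed

text \<open>Countably many radii \<open>N\<close> suffice, since minimality in a ball follows from minimality in any larger
  one.  This is why the exceptional levels remain countable.\<close>
lemma regular_level_exists:
  fixes u :: "real^'n \<Rightarrow> real"
  assumes u: "tame u" and r: "0 < r"
  shows "\<exists>s. 0 < s \<and> s < 1 \<and>
    (\<forall>N::nat. AE x in lborel. ball_sup r (\<lambda>y. - (if y \<in> cball 0 (real N) then 2 else u y)) x \<noteq> - s)"
proof -
  let ?w = "\<lambda>N::nat. ball_sup r (\<lambda>y. - (if y \<in> cball 0 (real N) then 2 else u y))"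
  have "?w N \<in> borel_measurable borel" for N
    by (intro tame_borel tame_ball_sup tame_minus tame_if tame_const u r) auto
  from countable_atoms[OF this] have "countable (\<Union>N. uminus ` {t. \<not> (AE x in lborel. ?w N x \<noteq> t)})" by auto
  then have "\<not> {0<..<1} \<subseteq> (\<Union>N. uminus ` {t. \<not> (AE x in lborel. ?w N x \<noteq> t)})"
    using countable_subset uncountable_open_interval[of "0::real" 1] by auto
  then obtain s where s: "0 < s" "s < 1" "s \<notin> (\<Union>N. uminus ` {t. \<not> (AE x in lborel. ?w N x \<noteq> t)})" by (auto simp only: subset_iff greaterThanLessThan_iff)
  have "AE x in lborel. ?w N x \<noteq> - s" for N
  proof (rule ccontr)
    assume "\<not> ?thesis"
    then have "s \<in> uminus ` {t. \<not> (AE x in lborel. ?w N x \<noteq> t)}" by (intro image_eqI[of _ _ "- s"]) auto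
    with s(3) show False by blast
  qed
  then show ?thesis using s(1,2) by blast
qed


section \<open>Plane-like minimizers\<close>

text \<open>The counterpart for sets of \<open>locally_minimal\<close>: modulo null sets, the competitor \<open>F\<close> may differ from
  \<open>E\<close> in a ball around the origin.\<close>
definition locally_minimal_set :: "real \<Rightarrow> (real^'n \<Rightarrow> real) \<Rightarrow> (real^'n) set \<Rightarrow> bool" where
  "locally_minimal_set r g E \<longleftrightarrow>
     (\<forall>F (N::nat). F \<in> sets borel \<and> negligible {x. real N < norm x \<and> (x \<in> F \<longleftrightarrow> x \<notin> E)} \<longrightarrow>
       0 \<le> (\<integral>x. indicator (tube r F) x - indicator (tube r E) x \<partial>lborel) / (2 * r)
         + (\<integral>x. indicator (cball 0 (real N)) x * (g x * (indicator F x - indicator E x)) \<partial>lborel))"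

text \<open>The minimizer of the cell problem is replaced by a precise representative, which does not increase
  the energy, and \<open>E\<close> is a superlevel set at a regular level \<open>s \<in> (0, 1)\<close>.  Since \<open>\<bar>v\<bar> \<le> d + 1\<close>, the level
  set is trapped in the strip of half-width \<open>d + 3\<close>.\<close>
lemma planelike_level_set:
  fixes g :: "real^'n \<Rightarrow> real" and \<omega> :: "real^'n"
  defines "d \<equiv> 160 * real CARD('n) * 2 ^ CARD('n)"
  assumes r: "0 < r" "r < 1" and eta: "\<eta> = 1 / (16 * real CARD('n))"
    and g: "g \<in> borel_measurable borel" "\<And>x. \<bar>g x\<bar> \<le> \<eta>" "cell_int g = 0" "int_periodic g" and \<omega>: "norm \<omega> = 1"
  shows "\<exists>E. E \<in> sets borel \<and> {x. \<omega> \<bullet> x \<le> - (d + 3)} \<subseteq> E \<and> E \<subseteq> {x. \<omega> \<bullet> x \<le> d + 3} \<and>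
    (\<forall>k\<in>int_vecs. \<omega> \<bullet> k = 0 \<longrightarrow> (\<lambda>x. x + k) ` E = E) \<and>
    locally_minimal_set r g E"
proof -
  have d: "0 \<le> d" by (simp add: d_def)
  have lg: "tame g" using g(1,2) by (rule tame_of_bound)
  obtain v0 where v0: "admissible (d + 1) v0"
    "\<And>w. admissible (d + 2) w \<Longrightarrow> cell_energy r g \<omega> v0 \<le> cell_energy r g \<omega> w"
    using centered_minimizer_exists[OF r eta g(1,2,3) \<omega>] unfolding d_def by blast
  have lv0: "tame v0" and pv0: "int_periodic v0" and v0L: "\<And>x. \<bar>v0 x\<bar> \<le> d + 1" using v0(1) by (auto simp: admissible_def)
  have "\<exists>v. v \<in> borel_measurable borel \<and> precise v \<and> negligible {x. v x \<noteq> v0 x} \<and>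
      (\<forall>x. - (d + 1) \<le> v x \<and> v x \<le> d + 1) \<and> (int_periodic v0 \<longrightarrow> int_periodic v)"
  proof (intro precise_representative tame_borel lv0)
    show "- (d + 1) \<le> v0 x \<and> v0 x \<le> d + 1" for x using v0L[of x] by linarith
  qed
  then obtain v where v: "v \<in> borel_measurable borel" "precise v" "negligible {x. v x \<noteq> v0 x}"
      "\<And>x. - (d + 1) \<le> v x \<and> v x \<le> d + 1" "int_periodic v"
    using pv0 by blast
  have vL: "\<bar>v x\<bar> \<le> d + 1" for x using v(4)[of x] by (simp add: abs_le_iff)
  have lv: "tame v" using v(1) vL by (rule tame_of_bound)
  have adm: "admissible (d + 1) v" using lv v(5) vL by (simp add: admissible_def)
  define u where "u = (\<lambda>x. v x - \<omega> \<bullet> x)"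
  have lu: "tame u" unfolding u_def by (intro tame_intros lv)
  have pu: "precise u"
    using precise_add_continuous[OF v(2), of "\<lambda>x. - (\<omega> \<bullet> x)"] by (simp add: u_def continuous_intros)
  have "cell_energy r g \<omega> v \<le> cell_energy r g \<omega> v0"
  proof -
    have "negligible {x. u x \<noteq> v0 x - \<omega> \<bullet> x}"
      by (rule negligible_subset[OF v(3)]) (auto simp: u_def)
    then have "osc r u x \<le> osc r (\<lambda>x. v0 x - \<omega> \<bullet> x) x" for x
      by (intro osc_precise_le pu lu tame_intros lv0 r)
    then have 1: "cell_int (osc r u) \<le> cell_int (osc r (\<lambda>x. v0 x - \<omega> \<bullet> x))"
      by (intro cell_int_mono tame_osc lu tame_intros lv0 r)
    have "{x. v x \<noteq> v0 x} \<in> null_sets lborel"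
    proof (rule negligible_borel_null[OF _ v(3)])
      show "{x. v x \<noteq> v0 x} \<in> sets borel" using v(1) tame_borel[OF lv0] by measurable
    qed
    then have "AE x in lborel. v x = v0 x" by (rule AE_I') auto
    then have "cell_int (\<lambda>x. g x * v x) = cell_int (\<lambda>x. g x * v0 x)"
      unfolding cell_int_def using g(1) v(1) tame_borel[OF lv0] by (intro set_lebesgue_integral_cong_AE) auto
    then show ?thesis using 1 r by (simp add: cell_energy_def u_def[symmetric] divide_right_mono)
  qed
  then have "cell_energy r g \<omega> v \<le> cell_energy r g \<omega> w" if "admissible (d + 2) w" for w
    using v0(2)[OF that] by linarith
  moreover have "admissible (d + 2 - 1) v" using adm by (simp only: add_diff_eq[symmetric]) simp
  ultimately have loc: "locally_minimal r g u"
    unfolding u_def by (intro cell_minimizer_locally_minimal[where L="d + 2"] r lg g)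
  obtain s where s: "0 < s" "s < 1"
    "\<And>N::nat. AE x in lborel. ball_sup r (\<lambda>y. - (if y \<in> cball 0 (real N) then 2 else u y)) x \<noteq> - s"
    using regular_level_exists[OF lu r(1)] by blast
  define E where "E = {x. s < u x}"
  show ?thesis
  proof (intro exI[of _ E] conjI ballI impI allI)
    show "E \<in> sets borel" unfolding E_def using tame_borel[OF lu] by measurable
    show "{x. \<omega> \<bullet> x \<le> - (d + 3)} \<subseteq> E"
    proof
      fix x assume "x \<in> {x. \<omega> \<bullet> x \<le> - (d + 3)}"
      then show "x \<in> E" using v(4)[of x] s(2) by (simp add: E_def u_def)
    qed
    show "E \<subseteq> {x. \<omega> \<bullet> x \<le> d + 3}"
    proof
      fix x assume "x \<in> E"
      then have "s < v x - \<omega> \<bullet> x" by (simp add: E_def u_def)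
      then have "\<omega> \<bullet> x \<le> d + 3" using v(4)[of x] s(1) by linarith
      then show "x \<in> {x. \<omega> \<bullet> x \<le> d + 3}" by simp
    qed
    show "(\<lambda>x. x + k) ` E = E" if k: "k \<in> int_vecs" "\<omega> \<bullet> k = 0" for k
    proof -
      have "u (x + k) = u x" for x
        using int_periodic_add[OF v(5) k(1)] k(2) by (simp add: u_def inner_add_right)
      moreover from this[of "_ - k"] have "u (x - k) = u x" for x by simp
      ultimately show ?thesis unfolding E_def
        by (auto simp: image_iff) (metis diff_add_cancel)
    qed
    show "locally_minimal_set r g E"
      unfolding locally_minimal_set_def E_def using s(2)
      by (intro allI impI level_set_minimal[where c=2] loc pu r lg s(3)) auto
  qed
qed

lemma lborel_integral_lebesgue:
  fixes f f0 :: "real^'n \<Rightarrow> real"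
  assumes "f0 \<in> borel_measurable borel" "f \<in> borel_measurable lebesgue" "AE x in lebesgue. f x = f0 x"
  shows "integral\<^sup>L lebesgue f = integral\<^sup>L lborel f0"
proof -
  have m: "f0 \<in> borel_measurable lborel" using assms(1) by simp
  have "integral\<^sup>L lebesgue f = integral\<^sup>L lebesgue f0"
    using assms measurable_completion[OF m] by (intro integral_cong_AE) auto
  also have "\<dots> = integral\<^sup>L lborel f0" by (rule integral_completion[OF m])
  finally show ?thesis .
qed

lemma AE_not_negligible: "negligible S \<Longrightarrow> AE x in lebesgue. x \<notin> S"
  by (simp add: negligible_iff_null_sets AE_not_in)

lemma energy_eq:
  fixes g g0 :: "real^'n \<Rightarrow> real"
  assumes r: "0 < r" and g: "g \<in> borel_measurable lebesgue" "g0 \<in> borel_measurable borel" "AE x in lebesgue. g x = g0 x"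
    and A: "A \<in> sets lebesgue" "A0 \<in> sets borel" "negligible {x. x \<in> A \<longleftrightarrow> x \<notin> A0}" and \<Omega>: "\<Omega> \<in> sets borel"
  shows "energy r g A \<Omega> = (\<integral>x. indicator \<Omega> x * indicator (tube r A0) x \<partial>lborel) / (2 * r)
    + (\<integral>x. indicator \<Omega> x * (g0 x * indicator A0 x) \<partial>lborel)"
proof -
  have "x \<in> tube r A \<longleftrightarrow> x \<in> tube r A0" for x
    by (rule tube_cong, rule negligible_subset[OF A(3)]) auto
  then have "dilate (ess_boundary A) r = tube r A0" using dilate_ess_boundary[OF A(1) r] by blast
  moreover have c: "tube r A0 \<in> sets borel"
    using tame_borel[OF tame_tube[OF A(2) r]] by (simp add: borel_measurable_indicator_iff)
  moreover have "measure lebesgue (tube r A0 \<inter> \<Omega>) = (\<integral>x. indicator \<Omega> x * indicator (tube r A0) x \<partial>lborel)"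
  proof -
    have "(\<integral>x. indicator \<Omega> x * indicator (tube r A0) x \<partial>lborel) = (\<integral>x. indicator (tube r A0 \<inter> \<Omega>) x \<partial>lborel :: real)"
      by (intro Bochner_Integration.integral_cong) (auto simp: indicator_def)
    also have "\<dots> = measure lborel (tube r A0 \<inter> \<Omega>)" by simp
    also have "\<dots> = measure lebesgue (tube r A0 \<inter> \<Omega>)" using c \<Omega> by simp
    finally show ?thesis by simp
  qed
  moreover have "set_lebesgue_integral lebesgue (A \<inter> \<Omega>) g = (\<integral>x. indicator \<Omega> x * (g0 x * indicator A0 x) \<partial>lborel)"
    unfolding set_lebesgue_integral_def
  proof (rule lborel_integral_lebesgue)
    show "(\<lambda>x. indicator \<Omega> x * (g0 x * indicator A0 x)) \<in> borel_measurable borel"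
      using \<Omega> g(2) A(2) by measurable
    have "A \<inter> \<Omega> \<in> sets lebesgue" using A(1) \<Omega> by auto
    then show "(\<lambda>x. indicat_real (A \<inter> \<Omega>) x *\<^sub>R g x) \<in> borel_measurable lebesgue"
      using g(1) by measurable
    show "AE x in lebesgue. indicat_real (A \<inter> \<Omega>) x *\<^sub>R g x = indicator \<Omega> x * (g0 x * indicator A0 x)"
      using g(3) AE_not_negligible[OF A(3)] by eventually_elim (auto simp: indicator_def)
  qed
  ultimately show ?thesis by (simp add: energy_def Per_def)
qed

text \<open>Setting \<open>g\<close> to zero on all integer translates of a Borel null set keeps it periodic, and the null set
  may contain all points where \<open>g\<close> differs from a Borel function or exceeds \<open>\<eta>\<close>.\<close>
lemma periodic_borel_representative:
  fixes g :: "real^'n \<Rightarrow> real"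
  assumes g: "g \<in> borel_measurable lebesgue" "int_periodic g" "AE x in lebesgue. \<bar>g x\<bar> \<le> \<eta>" and \<eta>: "0 \<le> \<eta>"
  obtains g0 where "g0 \<in> borel_measurable borel" "int_periodic g0" "\<And>x. \<bar>g0 x\<bar> \<le> \<eta>" "AE x in lebesgue. g x = g0 x"
proof -
  obtain g1 where g1: "g1 \<in> borel_measurable lborel" "AE x in lborel. g x = g1 x"
    using completion_ex_borel_measurable_real[OF g(1)] by blast
  have "AE x in lborel. g x = g1 x \<and> \<bar>g x\<bar> \<le> \<eta>"
    using g1(2) g(3)[unfolded AE_completion_iff] by eventually_elim simp
  then obtain N where Nl: "N \<in> null_sets lborel" "{x \<in> space lborel. \<not> (g x = g1 x \<and> \<bar>g x\<bar> \<le> \<eta>)} \<subseteq> N"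
    unfolding eventually_ae_filter by blast
  have N: "N \<in> null_sets lborel" "\<And>x. x \<notin> N \<Longrightarrow> g x = g1 x \<and> \<bar>g x\<bar> \<le> \<eta>"
  proof (rule Nl(1), rule ccontr)
    fix x assume "x \<notin> N" "\<not> (g x = g1 x \<and> \<bar>g x\<bar> \<le> \<eta>)"
    then have "x \<in> {x \<in> space lborel. \<not> (g x = g1 x \<and> \<bar>g x\<bar> \<le> \<eta>)}" by simp
    with Nl(2) \<open>x \<notin> N\<close> show False by (meson subsetD)
  qed
  define Z where "Z = (\<Union>k\<in>int_vecs. (\<lambda>x. x + k) -` N)"
  have "\<exists>m. x \<in> cball (0::real^'n) (real m)" for x
    using real_arch_simple[of "norm x"] by simp
  then have "int_vecs = (\<Union>m::nat. int_vecs \<inter> cball (0::real^'n) (real m))" by blast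
  also have "countable \<dots>" by (rule countable_UN[OF countableI_type]) (rule countable_finite[OF finite_int_vecs])
  finally have ci: "countable (int_vecs :: (real^'n) set)" .
  have Z: "Z \<in> null_sets lborel"
    unfolding Z_def
  proof (rule null_sets_UN'[OF ci], rule negligible_borel_null)
    fix k :: "real^'n"
    show "(\<lambda>x. x + k) -` N \<in> sets borel"
      using N(1) measurable_sets_borel[of "\<lambda>x. x + k" borel N] by auto
    have "negligible N" using N(1) by (simp add: negligible_iff_null_sets null_sets_completionI)
    then show "negligible ((\<lambda>x. x + k) -` N)"
      using negligible_translate_iff[of "\<lambda>x. x \<in> N" k] by (simp add: vimage_def)
  qed
  have NZ: "N \<subseteq> Z"
  proof
    fix x assume "x \<in> N"
    moreover have "(0::real^'n) \<in> int_vecs" by (simp add: int_vecs_def)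
    ultimately show "x \<in> Z" unfolding Z_def by (intro UN_I[of 0]) auto
  qed
  have Zp: "x + k \<in> Z \<longleftrightarrow> x \<in> Z" if k: "k \<in> int_vecs" for x k
  proof
    assume "x + k \<in> Z"
    then obtain j where "j \<in> int_vecs" "x + k + j \<in> N" by (auto simp: Z_def)
    then show "x \<in> Z" using int_vecs_add[OF k, of j] unfolding Z_def by (intro UN_I[of "k + j"]) (auto simp: add.assoc)
  next
    assume "x \<in> Z"
    then obtain j where "j \<in> int_vecs" "x + j \<in> N" by (auto simp: Z_def)
    then show "x + k \<in> Z" using int_vecs_add[OF int_vecs_minus[OF k], of j] unfolding Z_def
      by (intro UN_I[of "- k + j"]) auto
  qed
  define g0 where "g0 x = (if x \<in> Z then 0 else g x)" for x
  show thesis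
  proof (rule that)
    have "g0 = (\<lambda>x. if x \<in> Z then 0 else g1 x)" using N(2) NZ by (auto simp: g0_def fun_eq_iff)
    moreover have "(\<lambda>x. if x \<in> Z then 0 else g1 x) \<in> borel_measurable borel"
      using Z g1(1) by (intro measurable_If_set) auto
    ultimately show "g0 \<in> borel_measurable borel" by simp
    show "int_periodic g0" using g(2) Zp by (auto simp: g0_def int_periodic_def)
    show "\<bar>g0 x\<bar> \<le> \<eta>" for x using N(2)[of x] NZ \<eta> by (auto simp: g0_def)
    have "AE x in lborel. x \<notin> Z" using Z by (rule AE_not_in)
    then show "AE x in lebesgue. g x = g0 x"
      unfolding AE_completion_iff by eventually_elim (simp add: g0_def)
  qed
qed

lemma cell_int_eq_unit_box_integral:
  fixes g g0 :: "real^'n \<Rightarrow> real"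
  assumes g: "g \<in> borel_measurable lebesgue" "g0 \<in> borel_measurable borel" "AE x in lebesgue. g x = g0 x"
  shows "cell_int g0 = set_lebesgue_integral lebesgue (cbox 0 1) g"
  unfolding cell_int_def set_lebesgue_integral_def
proof (rule lborel_integral_lebesgue[symmetric])
  show "(\<lambda>x. indicat_real cell x *\<^sub>R g0 x) \<in> borel_measurable borel" using g(2) by measurable
  have "cbox (0::real^'n) 1 \<in> sets lebesgue" by simp
  then show "(\<lambda>x. indicat_real (cbox 0 1) x *\<^sub>R g x) \<in> borel_measurable lebesgue" using g(1) by measurable
  have "negligible {x::real^'n. x $ i = 1}" for i
    using negligible_hyperplane[of "axis i 1 :: real^'n" 1] by (simp add: inner_axis')
  then have n: "negligible (\<Union>i. {x::real^'n. x $ i = 1})"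
    by (intro negligible_Union) auto
  show "AE x in lebesgue. indicat_real (cbox 0 1) x *\<^sub>R g x = indicat_real cell x *\<^sub>R g0 x"
    using g(3) AE_not_negligible[OF n]
  proof eventually_elim
    case (elim x)
    have "x \<in> cbox 0 1 \<longleftrightarrow> x \<in> cell"
      using elim(2) by (auto simp: mem_box_cart cell_def order.order_iff_strict)
    then show ?case using elim(1) by (simp add: indicator_def)
  qed
qed

text \<open>A ball that contains points inside and outside of \<open>\<Omega>\<close> meets the frontier of \<open>\<Omega>\<close>.  Hence competitors
  that differ from \<open>E\<close> only in \<open>erode \<Omega> r\<close> have the same tube as \<open>E\<close> outside \<open>\<Omega>\<close>.\<close>
lemma ball_outside_erode:
  assumes "x \<notin> \<Omega>" shows "ball x r \<inter> erode \<Omega> r = {}"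
proof (rule ccontr)
  assume "ball x r \<inter> erode \<Omega> r \<noteq> {}"
  then obtain y where y: "dist x y < r" "y \<in> \<Omega>" "y \<notin> dilate (frontier \<Omega>) r" by (auto simp: erode_def)
  have "ball y r \<inter> frontier \<Omega> \<noteq> {}"
  proof (rule connected_Int_frontier)
    have "y \<in> ball y r" using y(1) zero_le_dist[of x y] by (simp del: zero_le_dist)
    then show "ball y r \<inter> \<Omega> \<noteq> {}" using y(2) by blast
    have "x \<in> ball y r" using y(1) by (simp add: dist_commute)
    then show "ball y r - \<Omega> \<noteq> {}" using assms by blast
  qed simp
  then obtain z where "z \<in> frontier \<Omega>" "y \<in> ball z r" by (auto simp: dist_commute)
  then show False using y(3) by (auto simp: dilate_def)
qed

text \<open>A competitor in a ball \<open>\<Omega>\<close> changes neither the tube nor, up to a null set, the set itself outside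
  \<open>\<Omega>\<close>.  So the two integrals over the whole space reduce to the difference of the energies in \<open>\<Omega>\<close>.\<close>
lemma locally_minimal_set_minimizer:
  fixes g g0 :: "real^'n \<Rightarrow> real"
  assumes r: "0 < r"
    and g: "g \<in> borel_measurable lebesgue" "g0 \<in> borel_measurable borel" "AE x in lebesgue. g x = g0 x"
    and lg0: "tame g0" and E: "E \<in> sets borel" and min: "locally_minimal_set r g0 E"
  shows "minimizer_in r g (ball x0 R) E"
  unfolding minimizer_in_def
proof (intro conjI ballI impI)
  show El: "E \<in> sets lebesgue" using E by auto
  let ?\<Omega> = "ball x0 R"
  fix F assume F: "F \<in> sets lebesgue" and eq: "ae_equal (F - erode ?\<Omega> r) (E - erode ?\<Omega> r)"
  obtain F0 N N' where F0: "F = F0 \<union> N" "N \<subseteq> N'" "N' \<in> null_sets lborel" "F0 \<in> sets lborel"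
    using F by (rule sets_completionE)
  have F0b: "F0 \<in> sets borel" using F0 by simp
  have nN: "negligible N'" using F0(3) by (simp add: negligible_iff_null_sets null_sets_completionI)
  have FF0: "negligible {x. x \<in> F \<longleftrightarrow> x \<notin> F0}"
    by (rule negligible_subset[OF nN]) (use F0 in auto)
  have "negligible ((F - erode ?\<Omega> r) - (E - erode ?\<Omega> r))" "negligible ((E - erode ?\<Omega> r) - (F - erode ?\<Omega> r))"
    using eq by (auto simp: ae_equal_def ae_subset_def negligible_iff_null_sets)
  from negligible_Un[OF this] negligible_Un[OF _ FF0]
  have "negligible ((((F - erode ?\<Omega> r) - (E - erode ?\<Omega> r)) \<union> ((E - erode ?\<Omega> r) - (F - erode ?\<Omega> r))) \<union> {x. x \<in> F \<longleftrightarrow> x \<notin> F0})"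
    by blast
  then have B: "negligible {x. x \<notin> erode ?\<Omega> r \<and> (x \<in> F0 \<longleftrightarrow> x \<notin> E)}"
    by (rule negligible_subset) auto
  have er: "erode ?\<Omega> r \<subseteq> ?\<Omega>" by (auto simp: erode_def)
  obtain m :: nat where m: "norm x0 + R \<le> real m" using real_arch_simple by blast
  have \<Omega>m: "?\<Omega> \<subseteq> cball 0 (real m)"
  proof
    fix x assume "x \<in> ?\<Omega>"
    then show "x \<in> cball 0 (real m)" using norm_triangle_ineq2[of x x0] m by (auto simp: dist_norm norm_minus_commute)
  qed
  have "negligible {x. real m < norm x \<and> (x \<in> F0 \<longleftrightarrow> x \<notin> E)}"
    by (rule negligible_subset[OF B]) (use \<Omega>m er in force)
  with min F0b
  have ge: "0 \<le> (\<integral>x. indicator (tube r F0) x - indicator (tube r E) x \<partial>lborel) / (2 * r)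
      + (\<integral>x. indicator (cball 0 (real m)) x * (g0 x * (indicator F0 x - indicator E x)) \<partial>lborel)"
    unfolding locally_minimal_set_def by blast
  have tube_out: "x \<in> tube r F0 \<longleftrightarrow> x \<in> tube r E" if "x \<notin> ?\<Omega>" for x
    by (rule tube_cong, rule negligible_subset[OF B]) (use ball_outside_erode[OF that, of r] in auto)
  have l\<Omega>: "tame (\<lambda>x. indicator ?\<Omega> x * f x)" if "tame f" for f using that by (intro tame_mult tame_indicator) auto
  have int: "integrable lborel (\<lambda>x. indicator ?\<Omega> x * f x)" if "tame f" for f
    by (rule integrable_compact_support[OF l\<Omega>[OF that], of "real m"]) (use \<Omega>m in \<open>force simp: indicator_def\<close>)
  have lI: "tame (indicator F0)" "tame (indicator E)" "tame (indicator (tube r F0))" "tame (indicator (tube r E))"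
    using tame_indicator tame_tube F0b E r by auto
  have 1: "(\<integral>x. indicator (tube r F0) x - indicator (tube r E) x \<partial>lborel)
      = (\<integral>x. indicator ?\<Omega> x * indicator (tube r F0) x \<partial>lborel) - (\<integral>x. indicator ?\<Omega> x * indicator (tube r E) x \<partial>lborel :: real)"
  proof -
    have "(\<integral>x. indicator (tube r F0) x - indicator (tube r E) x \<partial>lborel :: real)
        = (\<integral>x. indicator ?\<Omega> x * indicator (tube r F0) x - indicator ?\<Omega> x * indicator (tube r E) x \<partial>lborel)"
    proof (intro Bochner_Integration.integral_cong refl)
      fix x :: "real^'n"
      show "indicator (tube r F0) x - indicator (tube r E) x = (indicator ?\<Omega> x * indicator (tube r F0) x - indicator ?\<Omega> x * indicator (tube r E) x :: real)"
        using tube_out[of x] by (cases "x \<in> ?\<Omega>") (auto simp: indicator_def)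
    qed
    also have "\<dots> = (\<integral>x. indicator ?\<Omega> x * indicator (tube r F0) x \<partial>lborel) - (\<integral>x. indicator ?\<Omega> x * indicator (tube r E) x \<partial>lborel)"
      by (intro Bochner_Integration.integral_diff int lI)
    finally show ?thesis .
  qed
  have 2: "(\<integral>x. indicator (cball 0 (real m)) x * (g0 x * (indicator F0 x - indicator E x)) \<partial>lborel)
      = (\<integral>x. indicator ?\<Omega> x * (g0 x * indicator F0 x) \<partial>lborel) - (\<integral>x. indicator ?\<Omega> x * (g0 x * indicator E x) \<partial>lborel)"
  proof -
    have "AE x in lebesgue. x \<notin> {x. x \<notin> erode ?\<Omega> r \<and> (x \<in> F0 \<longleftrightarrow> x \<notin> E)}" by (rule AE_not_negligible[OF B])
    then have aeB: "AE x in lborel. x \<notin> {x. x \<notin> erode ?\<Omega> r \<and> (x \<in> F0 \<longleftrightarrow> x \<notin> E)}" unfolding AE_completion_iff .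
    have "(\<integral>x. indicator (cball 0 (real m)) x * (g0 x * (indicator F0 x - indicator E x)) \<partial>lborel)
        = (\<integral>x. indicator ?\<Omega> x * (g0 x * indicator F0 x) - indicator ?\<Omega> x * (g0 x * indicator E x) \<partial>lborel)"
    proof (rule integral_cong_AE)
      show "AE x in lborel. indicator (cball 0 (real m)) x * (g0 x * (indicator F0 x - indicator E x))
          = indicator ?\<Omega> x * (g0 x * indicator F0 x) - indicator ?\<Omega> x * (g0 x * indicator E x)"
        using aeB
      proof eventually_elim
        case (elim x)
        show ?case
        proof (cases "x \<in> ?\<Omega>")
          case True
          then have "x \<in> cball 0 (real m)" using \<Omega>m by blast
          then show ?thesis using True by (simp add: algebra_simps)
        next
          case False
          then have "x \<in> F0 \<longleftrightarrow> x \<in> E" using elim er by blast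
          then show ?thesis using False by (simp add: indicator_def)
        qed
      qed
      have "tame (\<lambda>x. indicator (cball 0 (real m)) x * (g0 x * (indicator F0 x - indicator E x)))"
        by (intro tame_mult tame_diff tame_indicator lg0 F0b E) auto
      from tame_borel[OF this]
      show "(\<lambda>x. indicator (cball 0 (real m)) x * (g0 x * (indicator F0 x - indicator E x))) \<in> borel_measurable lborel"
        by simp
      have "tame (\<lambda>x. indicator ?\<Omega> x * (g0 x * indicator F0 x) - indicator ?\<Omega> x * (g0 x * indicator E x))"
        by (intro tame_diff l\<Omega> tame_mult lg0 lI)
      from tame_borel[OF this]
      show "(\<lambda>x. indicator ?\<Omega> x * (g0 x * indicator F0 x) - indicator ?\<Omega> x * (g0 x * indicator E x)) \<in> borel_measurable lborel"
        by simp
    qed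
    also have "\<dots> = (\<integral>x. indicator ?\<Omega> x * (g0 x * indicator F0 x) \<partial>lborel) - (\<integral>x. indicator ?\<Omega> x * (g0 x * indicator E x) \<partial>lborel)"
      by (intro Bochner_Integration.integral_diff int tame_mult lg0 lI)
    finally show ?thesis .
  qed
  have "energy r g F ?\<Omega> - energy r g E ?\<Omega> \<ge> 0"
    using ge energy_eq[OF r g F F0b FF0, of ?\<Omega>] energy_eq[OF r g El E, of ?\<Omega>]
    unfolding 1 2 by (simp add: diff_divide_distrib)
  then show "energy r g E ?\<Omega> \<le> energy r g F ?\<Omega>" by simp
qed

theorem theorem1p21:
  shows "\<exists>\<eta> M :: real. 0 < \<eta> \<and> \<eta> < 1 \<and> 1 < M \<and>
    (\<forall>(r :: real) (g :: real^'n \<Rightarrow> real) (\<omega> :: real^'n).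
       0 < r \<and> r < 1 \<and>
       g \<in> borel_measurable lebesgue \<and> int_periodic g \<and>
       set_lebesgue_integral lebesgue (cbox 0 1) g = 0 \<and>
       Linf_norm g \<le> ereal \<eta> \<and>
       \<omega> \<in> sphere 0 1
       \<longrightarrow> (\<exists>E :: (real^'n) set.
             class_A_minimizer r g E \<and>
             ae_subset {x. \<omega> \<bullet> x \<le> - M} E \<and>
             ae_subset E {x. \<omega> \<bullet> x \<le> M} \<and>
             (rational_direction \<omega> \<longrightarrow> direction_periodic \<omega> E)))"
proof -
  define \<eta> where "\<eta> = 1 / (16 * real CARD('n))"
  define d where "d = 160 * real CARD('n) * 2 ^ CARD('n)"
  have n: "1 \<le> real CARD('n)" using zero_less_card_finite[where 'a='n] by (simp add: Suc_le_eq)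
  have "1 < 16 * real CARD('n)" using n by linarith
  then have \<eta>: "0 < \<eta>" "\<eta> < 1" by (auto simp: \<eta>_def)
  have "\<exists>E :: (real^'n) set. class_A_minimizer r g E \<and>
      ae_subset {x. \<omega> \<bullet> x \<le> - (d + 3)} E \<and> ae_subset E {x. \<omega> \<bullet> x \<le> d + 3} \<and>
      (rational_direction \<omega> \<longrightarrow> direction_periodic \<omega> E)"
    if r: "0 < r" "r < 1" and g: "g \<in> borel_measurable lebesgue" "int_periodic g"
      "set_lebesgue_integral lebesgue (cbox 0 1) g = 0" "Linf_norm g \<le> ereal \<eta>" and \<omega>: "\<omega> \<in> sphere 0 1"
    for r :: real and g :: "real^'n \<Rightarrow> real" and \<omega> :: "real^'n"
  proof -
    have "AE x in lebesgue. ereal \<bar>g x\<bar> \<le> Linf_norm g" unfolding Linf_norm_def by (rule esssup_AE)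
    then have ae: "AE x in lebesgue. \<bar>g x\<bar> \<le> \<eta>"
    proof eventually_elim
      case (elim x)
      then have "ereal \<bar>g x\<bar> \<le> ereal \<eta>" using g(4) by (rule order_trans)
      then show ?case by simp
    qed
    obtain g0 where g0: "g0 \<in> borel_measurable borel" "int_periodic g0" "\<And>x. \<bar>g0 x\<bar> \<le> \<eta>" "AE x in lebesgue. g x = g0 x"
      using periodic_borel_representative[OF g(1,2) ae less_imp_le[OF \<eta>(1)]] by metis
    have lg0: "tame g0" using g0(1,3) by (rule tame_of_bound)
    have c0: "cell_int g0 = 0" using cell_int_eq_unit_box_integral[OF g(1) g0(1,4)] g(3) by simp
    have \<omega>1: "norm \<omega> = 1" using \<omega> by simp
    obtain E :: "(real^'n) set" where E: "E \<in> sets borel" "{x. \<omega> \<bullet> x \<le> - (d + 3)} \<subseteq> E" "E \<subseteq> {x. \<omega> \<bullet> x \<le> d + 3}"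
      "\<forall>k\<in>int_vecs. \<omega> \<bullet> k = 0 \<longrightarrow> (\<lambda>x. x + k) ` E = E" "locally_minimal_set r g0 E"
      using planelike_level_set[OF r \<eta>_def g0(1,3) c0 g0(2) \<omega>1, folded d_def] by blast
    have "minimizer_in r g (ball x R) E" for x R
      by (rule locally_minimal_set_minimizer[OF r(1) g(1) g0(1,4) lg0 E(1,5)])
    then have "class_A_minimizer r g E" by (simp add: class_A_minimizer_def)
    moreover have "ae_subset A B" if "A \<subseteq> B" for A B :: "(real^'n) set"
    proof -
      have "A - B = {}" using that by blast
      then show ?thesis unfolding ae_subset_def by (simp only: null_sets.empty_sets)
    qed
    moreover have "direction_periodic \<omega> E"
      unfolding direction_periodic_def ae_equal_def using E(4) by (auto simp: ae_subset_def)
    ultimately show ?thesis using E(2,3) by blast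
  qed
  moreover have "1 < d + 3" by (simp add: d_def add_nonneg_pos)
  ultimately show ?thesis using \<eta> by blast
qed

end
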